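(* The Bousfield lattice $\mathsf{B}=\mathsf{B}(\Lambda)$ of $\mathsf{D}(\Lambda)$ has cardinality at least $2^{2^{\aleph_0}}$.
   Context: Fix a countable field $k$ and integers $n_i\ge 2$ for all $i\ge 1$. Let $\Lambda = k[x_1,x_2,x_3,\dots]/(x_i^{n_i}\ \text{for all } i)$, graded by $\deg x_i = 2^i$. All modules are graded; $\mathsf{D}(\Lambda)$ is the unbounded derived category of (cochain complexes of) graded $\Lambda$-modules with degree-preserving maps, and $\otimes^L_\Lambda$ is the derived tensor product. For an object $X$ of $\mathsf{D}(\Lambda)$, its Bousfield class is $\langle X\rangle=\{W\in \mathrm{ob}\,\mathsf{D}(\Lambda) : X\otimes^L_\Lambda W=0\}$. The Bousfield lattice $\mathsf{B}(\Lambda)$ is the collection of all Bousfield classes, ordered by reverse inclusion (so $\langle X\rangle\le\langle Y\rangle$ iff $Y\otimes^L_\Lambda W=0$ implies $X\otimes^L_\Lambda W=0$); since $\Lambda$ is countable, it is known to be a set. *)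

theory Defs
  imports
    "HOL-Algebra.Module"
    "HOL-Algebra.QuotRing"
    "HOL-Algebra.Generated_Groups"
    "HOL-Algebra.Free_Abelian_Groups"
    "HOL-Algebra.Algebraic_Closure_Type"
    "HOL-Library.Poly_Mapping"
begin

section \<open>The truncated polynomial algebra\<close>

text \<open>
  Monomials in countably many variables are finitely supported exponent functions; polynomials
  are finitely supported functions on monomials, with the convolution product. The variables are
  \<open>x\<^sub>1, x\<^sub>2, \<dots>\<close>, and \<open>x\<^sub>i\<close> is stored at position \<open>i - 1\<close>.
\<close>

type_synonym 'k npoly = "(nat \<Rightarrow>\<^sub>0 nat) \<Rightarrow>\<^sub>0 'k"

definition xvar :: "nat \<Rightarrow> 'k::field npoly" where
  "xvar i = Poly_Mapping.single (Poly_Mapping.single (i - 1) 1) 1"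

definition truncated_poly :: "(nat \<Rightarrow> nat) \<Rightarrow> 'k::field npoly set ring" where
  "truncated_poly n =
     ring_of_type_algebra Quot (Idl\<^bsub>ring_of_type_algebra\<^esub> {xvar i ^ n i | i. i \<ge> 1})"

definition monom_degree :: "(nat \<Rightarrow>\<^sub>0 nat) \<Rightarrow> nat" where
  "monom_degree m = (\<Sum>v\<in>Poly_Mapping.keys m. Poly_Mapping.lookup m v * 2 ^ (v + 1))"

definition truncated_poly_piece :: "(nat \<Rightarrow> nat) \<Rightarrow> int \<Rightarrow> 'k::field npoly set set" where
  "truncated_poly_piece n j =
     {Idl\<^bsub>ring_of_type_algebra\<^esub> {xvar i ^ n i | i. i \<ge> 1} +>\<^bsub>ring_of_type_algebra\<^esub> f | f.
        \<forall>m\<in>Poly_Mapping.keys f. int (monom_degree m) = j}"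


section \<open>Graded modules and cochain complexes\<close>

record ('r, 'm) graded_module = "('r, 'm) module" +
  piece :: "int \<Rightarrow> 'm set"

record ('r, 'm) cochain_complex =
  cobj :: "int \<Rightarrow> ('r, 'm) graded_module"
  cdiff :: "int \<Rightarrow> 'm \<Rightarrow> 'm"

definition is_graded_module ::
    "(nat \<Rightarrow> nat) \<Rightarrow> ('k::field npoly set, 'm) graded_module \<Rightarrow> bool" where
  "is_graded_module n M \<longleftrightarrow>
     module (truncated_poly n) M \<and>
     (\<forall>j. subgroup (piece M j) (add_monoid M)) \<and>
     (\<forall>x\<in>carrier M. \<exists>!f. f \<in> (\<Pi> j\<in>UNIV. piece M j) \<and> finite {j. f j \<noteq> \<zero>\<^bsub>M\<^esub>} \<and>
        x = finsum M f {j. f j \<noteq> \<zero>\<^bsub>M\<^esub>}) \<and>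
     (\<forall>i j. \<forall>r\<in>truncated_poly_piece n i. \<forall>x\<in>piece M j. r \<odot>\<^bsub>M\<^esub> x \<in> piece M (i + j))"

definition graded_hom ::
    "(nat \<Rightarrow> nat) \<Rightarrow> ('k::field npoly set, 'm) graded_module \<Rightarrow>
     ('k npoly set, 'l) graded_module \<Rightarrow> ('m \<Rightarrow> 'l) set" where
  "graded_hom n M N =
     {h. h \<in> carrier M \<rightarrow> carrier N \<and>
       (\<forall>x\<in>carrier M. \<forall>y\<in>carrier M. h (x \<oplus>\<^bsub>M\<^esub> y) = h x \<oplus>\<^bsub>N\<^esub> h y) \<and>
       (\<forall>r\<in>carrier (truncated_poly n). \<forall>x\<in>carrier M. h (r \<odot>\<^bsub>M\<^esub> x) = r \<odot>\<^bsub>N\<^esub> h x) \<and>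
       (\<forall>j. h ` piece M j \<subseteq> piece N j)}"

definition is_complex ::
    "(nat \<Rightarrow> nat) \<Rightarrow> ('k::field npoly set, 'm) cochain_complex \<Rightarrow> bool" where
  "is_complex n C \<longleftrightarrow>
     (\<forall>s. is_graded_module n (cobj C s)) \<and>
     (\<forall>s. cdiff C s \<in> graded_hom n (cobj C s) (cobj C (s + 1))) \<and>
     (\<forall>s. \<forall>x\<in>carrier (cobj C s). cdiff C (s + 1) (cdiff C s x) = \<zero>\<^bsub>cobj C (s + 2)\<^esub>)"

definition cocycles :: "('r, 'm) cochain_complex \<Rightarrow> int \<Rightarrow> 'm set" where
  "cocycles C s = {z \<in> carrier (cobj C s). cdiff C s z = \<zero>\<^bsub>cobj C (s + 1)\<^esub>}"

definition coboundaries :: "('r, 'm) cochain_complex \<Rightarrow> int \<Rightarrow> 'm set" where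
  "coboundaries C s = cdiff C (s - 1) ` carrier (cobj C (s - 1))"

text \<open>A complex is a zero object of the derived category iff it is acyclic.\<close>

definition acyclic_complex :: "('r, 'm) cochain_complex \<Rightarrow> bool" where
  "acyclic_complex C \<longleftrightarrow> (\<forall>s. cocycles C s \<subseteq> coboundaries C s)"

definition chain_map ::
    "(nat \<Rightarrow> nat) \<Rightarrow> ('k::field npoly set, 'm) cochain_complex \<Rightarrow>
     ('k npoly set, 'l) cochain_complex \<Rightarrow> (int \<Rightarrow> 'm \<Rightarrow> 'l) \<Rightarrow> bool" where
  "chain_map n C D q \<longleftrightarrow>
     (\<forall>s. q s \<in> graded_hom n (cobj C s) (cobj D s)) \<and>
     (\<forall>s. \<forall>x\<in>carrier (cobj C s). q (s + 1) (cdiff C s x) = cdiff D s (q s x))"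

text \<open>The last two clauses say that \<open>q\<close> is injective and surjective on cohomology.\<close>

definition quasi_iso ::
    "(nat \<Rightarrow> nat) \<Rightarrow> ('k::field npoly set, 'm) cochain_complex \<Rightarrow>
     ('k npoly set, 'l) cochain_complex \<Rightarrow> (int \<Rightarrow> 'm \<Rightarrow> 'l) \<Rightarrow> bool" where
  "quasi_iso n C D q \<longleftrightarrow>
     chain_map n C D q \<and>
     (\<forall>s. \<forall>z\<in>cocycles C s. q s z \<in> coboundaries D s \<longrightarrow> z \<in> coboundaries C s) \<and>
     (\<forall>s. \<forall>w\<in>cocycles D s. \<exists>z\<in>cocycles C s. q s z \<ominus>\<^bsub>cobj D s\<^esub> w \<in> coboundaries D s)"


section \<open>Semi-free resolutions\<close>

definition lin_span :: "('r, 'c) ring_scheme \<Rightarrow> ('r, 'm, 'd) module_scheme \<Rightarrow> 'm set \<Rightarrow> 'm set" where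
  "lin_span R M B =
     {finsum M (\<lambda>b. c b \<odot>\<^bsub>M\<^esub> b) S | c S. finite S \<and> S \<subseteq> B \<and> c \<in> S \<rightarrow> carrier R}"

definition lin_indep :: "('r, 'c) ring_scheme \<Rightarrow> ('r, 'm, 'd) module_scheme \<Rightarrow> 'm set \<Rightarrow> bool" where
  "lin_indep R M B \<longleftrightarrow>
     (\<forall>c S. finite S \<and> S \<subseteq> B \<and> c \<in> S \<rightarrow> carrier R \<and>
        finsum M (\<lambda>b. c b \<odot>\<^bsub>M\<^esub> b) S = \<zero>\<^bsub>M\<^esub> \<longrightarrow> (\<forall>b\<in>S. c b = \<zero>\<^bsub>R\<^esub>))"

text \<open>
  A complex is semi-free if it is the union of subcomplexes \<open>0 = P\<^sub>-\<^sub>1 \<subseteq> P\<^sub>0 \<subseteq> P\<^sub>1 \<subseteq> \<dots>\<close> such that each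
  \<open>P\<^sub>i / P\<^sub>i\<^sub>-\<^sub>1\<close> is free on a set of homogeneous cocycles. Here \<open>P\<^sub>i\<close> is the span of the basis
  elements of rank at most \<open>i\<close>.
\<close>

definition semifree ::
    "(nat \<Rightarrow> nat) \<Rightarrow> ('k::field npoly set, 'm) cochain_complex \<Rightarrow> bool" where
  "semifree n P \<longleftrightarrow>
     is_complex n P \<and>
     (\<exists>(B :: int \<Rightarrow> 'm set) (rank :: int \<Rightarrow> 'm \<Rightarrow> nat).
        (\<forall>s. B s \<subseteq> (\<Union>j. piece (cobj P s) j)) \<and>
        (\<forall>s. lin_indep (truncated_poly n) (cobj P s) (B s)) \<and>
        (\<forall>s. lin_span (truncated_poly n) (cobj P s) (B s) = carrier (cobj P s)) \<and>
        (\<forall>s. \<forall>b\<in>B s. cdiff P s b \<in>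
           lin_span (truncated_poly n) (cobj P (s + 1)) {c \<in> B (s + 1). rank (s + 1) c < rank s b}))"

definition semifree_resolution ::
    "(nat \<Rightarrow> nat) \<Rightarrow> ('k::field npoly set, 'm) cochain_complex \<Rightarrow>
     ('k npoly set, 'l) cochain_complex \<Rightarrow> bool" where
  "semifree_resolution n P V \<longleftrightarrow> semifree n P \<and> (\<exists>q. quasi_iso n P V q)"


section \<open>Tensor products of complexes\<close>

text \<open>
  In cohomological degree \<open>s\<close> the tensor product of complexes is the direct sum over \<open>p\<close> of the
  modules \<open>P\<^sup>p \<otimes> W\<^sup>s\<^sup>-\<^sup>p\<close>. It is presented here by one set of generators and relations: the
  triple \<open>(p, x, y)\<close> represents \<open>x \<otimes> y\<close> with \<open>x\<close> in \<open>P\<^sup>p\<close> and \<open>y\<close> in \<open>W\<^sup>s\<^sup>-\<^sup>p\<close>, and the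
  relations are biadditivity and balancedness over the ring.
\<close>

definition tensor_gens ::
    "('r, 'm) cochain_complex \<Rightarrow> ('r, 'l) cochain_complex \<Rightarrow> int \<Rightarrow> (int \<times> 'm \<times> 'l) set" where
  "tensor_gens P W s =
     {(p, x, y). x \<in> carrier (cobj P p) \<and> y \<in> carrier (cobj W (s - p))}"

definition tensor_rels ::
    "(nat \<Rightarrow> nat) \<Rightarrow> ('k::field npoly set, 'm) cochain_complex \<Rightarrow>
     ('k npoly set, 'l) cochain_complex \<Rightarrow> int \<Rightarrow> ((int \<times> 'm \<times> 'l) \<Rightarrow>\<^sub>0 int) set" where
  "tensor_rels n P W s = generate (free_Abelian_group (tensor_gens P W s))
     ({frag_of (p, x \<oplus>\<^bsub>cobj P p\<^esub> x', y) - frag_of (p, x, y) - frag_of (p, x', y) | p x x' y.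
         x \<in> carrier (cobj P p) \<and> x' \<in> carrier (cobj P p) \<and> y \<in> carrier (cobj W (s - p))} \<union>
      {frag_of (p, x, y \<oplus>\<^bsub>cobj W (s - p)\<^esub> y') - frag_of (p, x, y) - frag_of (p, x, y') | p x y y'.
         x \<in> carrier (cobj P p) \<and> y \<in> carrier (cobj W (s - p)) \<and> y' \<in> carrier (cobj W (s - p))} \<union>
      {frag_of (p, r \<odot>\<^bsub>cobj P p\<^esub> x, y) - frag_of (p, x, r \<odot>\<^bsub>cobj W (s - p)\<^esub> y) | p r x y.
         r \<in> carrier (truncated_poly n) \<and> x \<in> carrier (cobj P p) \<and> y \<in> carrier (cobj W (s - p))})"

text \<open>
  Maps out of the tensor product are induced by maps on generators: \<open>A\<close> is a coset of the
  relations, and adding the target relations to its image gives a coset again. The fields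
  \<open>mult\<close> and \<open>one\<close>, which the module record inherits from rings, play no role.
\<close>

definition tensor_module ::
    "(nat \<Rightarrow> nat) \<Rightarrow> ('k::field npoly set, 'm) cochain_complex \<Rightarrow>
     ('k npoly set, 'l) cochain_complex \<Rightarrow> int \<Rightarrow>
     ('k npoly set, ((int \<times> 'm \<times> 'l) \<Rightarrow>\<^sub>0 int) set) graded_module" where
  "tensor_module n P W s =
     (let F = free_Abelian_group (tensor_gens P W s); N = tensor_rels n P W s in
      \<lparr>carrier = carrier (F Mod N),
       monoid.mult = undefined,
       one = undefined,
       ring.zero = \<one>\<^bsub>F Mod N\<^esub>,
       add = (\<otimes>\<^bsub>F Mod N\<^esub>),
       module.smult = (\<lambda>r A. N <#>\<^bsub>F\<^esub>
          frag_extend (\<lambda>(p, x, y). frag_of (p, r \<odot>\<^bsub>cobj P p\<^esub> x, y)) ` A),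
       piece = (\<lambda>j. {N #>\<^bsub>F\<^esub> c | c. Poly_Mapping.keys c \<subseteq>
          {(p, x, y). \<exists>i. x \<in> piece (cobj P p) i \<and> y \<in> piece (cobj W (s - p)) (j - i)}})\<rparr>)"

definition tensor_complex ::
    "(nat \<Rightarrow> nat) \<Rightarrow> ('k::field npoly set, 'm) cochain_complex \<Rightarrow>
     ('k npoly set, 'l) cochain_complex \<Rightarrow>
     ('k npoly set, ((int \<times> 'm \<times> 'l) \<Rightarrow>\<^sub>0 int) set) cochain_complex" where
  "tensor_complex n P W =
     \<lparr>cobj = tensor_module n P W,
      cdiff = (\<lambda>s A. tensor_rels n P W (s + 1) <#>\<^bsub>free_Abelian_group (tensor_gens P W (s + 1))\<^esub>
        frag_extend (\<lambda>(p, x, y).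
          frag_of (p + 1, cdiff P p x, y) +
          frag_cmul (if even p then 1 else -1) (frag_of (p, x, cdiff W (s - p) y))) ` A)\<rparr>"

text \<open>
  Up to isomorphism in the derived category the following does not depend on the resolution
  chosen. A resolution with carriers in the type of \<open>V\<close> exists whenever that type is infinite
  and at least as large as the ring.
\<close>

definition derived_tensor ::
    "(nat \<Rightarrow> nat) \<Rightarrow> ('k::field npoly set, 'u) cochain_complex \<Rightarrow>
     ('k npoly set, 'u) cochain_complex \<Rightarrow>
     ('k npoly set, ((int \<times> 'u \<times> 'u) \<Rightarrow>\<^sub>0 int) set) cochain_complex" where
  "derived_tensor n V W =
     tensor_complex n (SOME P :: ('k npoly set, 'u) cochain_complex. semifree_resolution n P V) W"


section \<open>The Bousfield lattice\<close>

text \<open>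
  The type \<open>'u\<close> is the universe from which the modules take their elements. If two complexes have
  different Bousfield classes for some universe, witnessed by some \<open>W\<close> in it, then they have
  different classes in the class of all complexes, so a lower bound for the lattice over \<open>'u\<close> is a
  lower bound for the full lattice. Complexes that differ only by values of their operations outside
  the carriers occur in the same classes, so they do not add elements to the lattice. The order
  (reverse inclusion) is not needed for the cardinality.
\<close>

definition bousfield_class ::
    "(nat \<Rightarrow> nat) \<Rightarrow> ('k::field npoly set, 'u) cochain_complex \<Rightarrow>
     ('k npoly set, 'u) cochain_complex set" where
  "bousfield_class n V = {W. is_complex n W \<and> acyclic_complex (derived_tensor n V W)}"

definition bousfield_lattice ::
    "(nat \<Rightarrow> nat) \<Rightarrow> ('k::field npoly set, 'u) cochain_complex set set" where
  "bousfield_lattice n = {bousfield_class n V | V. is_complex n V}"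

end

theory Submission
  imports Defs
begin

text \<open>
  Let \<open>T\<^sub>B\<close>, for a set \<open>B\<close> of natural numbers, be the telescope (homotopy colimit) of a sequence of copies
  of \<open>\<Lambda>\<close>, suitably shifted, in which step \<open>m\<close> multiplies by \<open>y\<^sub>m = x\<^sub>m\<^sub>+\<^sub>1 ^ (n\<^sub>m\<^sub>+\<^sub>1 - 1)\<close> if
  \<open>m \<in> B\<close>, and by \<open>y\<^sub>m = 1\<close> if \<open>m \<notin> B\<close>. It is a complex of free modules in degrees \<open>-1\<close> and 0 with
  \<open>d f\<^sub>m = e\<^sub>m - y\<^sub>m e\<^sub>m\<^sub>+\<^sub>1\<close>.

  Tensoring with a telescope is taking a colimit. Hence \<open>P \<otimes> T\<^sub>C\<close> is acyclic iff every cohomology class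
  of \<open>P\<close> is annihilated by the products of the multipliers of \<open>T\<^sub>C\<close> from any stage on
  (\<open>acyclic_tensor_telescope_iff\<close>). This condition only involves the cohomology of \<open>P\<close>, so it can be
  checked on any complex quasi-isomorphic to \<open>P\<close> (\<open>killed_by_quasi_iso\<close>). It follows that
  \<open>T\<^sub>B \<otimes> T\<^sub>C\<close> can be studied through the products of the multipliers of \<open>T\<^sub>B\<close> and \<open>T\<^sub>C\<close>. If \<open>B \<inter> C\<close> is
  infinite, then beyond every stage some variable \<open>x\<^sub>i\<close> occurs in both multipliers. Its exponent in the
  product is \<open>2 (n\<^sub>i - 1) \<ge> n\<^sub>i\<close>, so the product vanishes
  (\<open>killed_by_telescope_sum\<close>); if \<open>B \<inter> C\<close> is empty, the products are nonzero monomials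
  (\<open>not_killed_by_telescope_sum\<close>).

  Now take continuum many sets \<open>B\<close> such that the difference of any two of them is infinite
  (\<open>infinite_prefix_codes_diff\<close>). To each subfamily belongs the direct sum of the telescopes of its
  members. The telescope of the complement of \<open>B\<close> lies in the Bousfield class of this sum iff \<open>B\<close> is
  not a member. So different subfamilies have different Bousfield classes, and there are as
  many subfamilies as there are sets of real numbers.

  The sums are semifree, so they are resolutions of themselves, and the derived tensor product, which is
  formed with some chosen resolution, can be computed from them
  (\<open>acyclic_derived_tensor_telescope_sum_iff\<close>). They have at most continuum many elements, hence copies with
  carriers in the universe \<open>'u\<close> (\<open>vectors_embedding\<close>).
\<close>


section \<open>Complexes of graded modules\<close>

lemma is_complex_module: "is_complex n C \<Longrightarrow> module (truncated_poly n) (cobj C s)"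
  by (simp add: is_complex_def is_graded_module_def)

lemma is_complex_abelian_group: "is_complex n C \<Longrightarrow> abelian_group (cobj C s)"
  using is_complex_module module.axioms(2) by blast

lemma is_complex_comm_group: "is_complex n C \<Longrightarrow> comm_group (add_monoid (cobj C s))"
  using abelian_group.a_comm_group is_complex_abelian_group by blast

lemma is_complex_zero_closed: "is_complex n C \<Longrightarrow> \<zero>\<^bsub>cobj C s\<^esub> \<in> carrier (cobj C s)"
  by (meson abelian_group_def abelian_monoid.zero_closed is_complex_abelian_group)

lemma is_complex_add_closed:
  "\<lbrakk>is_complex n C; x \<in> carrier (cobj C s); y \<in> carrier (cobj C s)\<rbrakk>
    \<Longrightarrow> x \<oplus>\<^bsub>cobj C s\<^esub> y \<in> carrier (cobj C s)"
  by (meson abelian_group_def abelian_monoid.a_closed is_complex_abelian_group)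

lemma is_complex_smult_closed:
  "\<lbrakk>is_complex n C; r \<in> carrier (truncated_poly n); x \<in> carrier (cobj C s)\<rbrakk>
    \<Longrightarrow> r \<odot>\<^bsub>cobj C s\<^esub> x \<in> carrier (cobj C s)"
  by (meson is_complex_module module.smult_closed)

lemma is_complex_graded_hom:
  "is_complex n C \<Longrightarrow> cdiff C s \<in> graded_hom n (cobj C s) (cobj C (s + 1))"
  by (simp add: is_complex_def)

lemma graded_hom_closed:
  "\<lbrakk>h \<in> graded_hom n M N; x \<in> carrier M\<rbrakk> \<Longrightarrow> h x \<in> carrier N"
  by (auto simp: graded_hom_def)

lemma graded_hom_add:
  "\<lbrakk>h \<in> graded_hom n M N; x \<in> carrier M; y \<in> carrier M\<rbrakk> \<Longrightarrow> h (x \<oplus>\<^bsub>M\<^esub> y) = h x \<oplus>\<^bsub>N\<^esub> h y"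
  by (auto simp: graded_hom_def)

lemma graded_hom_smult:
  "\<lbrakk>h \<in> graded_hom n M N; r \<in> carrier (truncated_poly n); x \<in> carrier M\<rbrakk>
    \<Longrightarrow> h (r \<odot>\<^bsub>M\<^esub> x) = r \<odot>\<^bsub>N\<^esub> h x"
  by (auto simp: graded_hom_def)

lemma graded_hom_group_hom:
  assumes "h \<in> graded_hom n M N" "abelian_group M" "abelian_group N"
  shows "group_hom (add_monoid M) (add_monoid N) h"
proof -
  interpret M: abelian_group M by fact
  interpret N: abelian_group N by fact
  show ?thesis
    using assms(1) by unfold_locales (auto simp: hom_def graded_hom_def)
qed

lemma graded_hom_zero:
  assumes "h \<in> graded_hom n M N" "abelian_group M" "abelian_group N"
  shows "h \<zero>\<^bsub>M\<^esub> = \<zero>\<^bsub>N\<^esub>"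
  using group_hom.hom_one[OF graded_hom_group_hom[OF assms]] by simp

lemma graded_hom_minus:
  assumes "h \<in> graded_hom n M N" "abelian_group M" "abelian_group N"
    and "x \<in> carrier M" "y \<in> carrier M"
  shows "h (x \<ominus>\<^bsub>M\<^esub> y) = h x \<ominus>\<^bsub>N\<^esub> h y"
proof -
  interpret M: abelian_group M by fact
  interpret N: abelian_group N by fact
  interpret group_hom "add_monoid M" "add_monoid N" h
    using graded_hom_group_hom[OF assms(1-3)] .
  have "h (\<ominus>\<^bsub>M\<^esub> y) = \<ominus>\<^bsub>N\<^esub> h y"
    using hom_inv[of y] assms(5) by (simp add: a_inv_def)
  then show ?thesis
    using assms(4,5) graded_hom_add[OF assms(1), of x "\<ominus>\<^bsub>M\<^esub> y"] by (simp add: a_minus_def)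
qed

lemma cdiff_closed:
  "\<lbrakk>is_complex n C; x \<in> carrier (cobj C s)\<rbrakk> \<Longrightarrow> cdiff C s x \<in> carrier (cobj C (s + 1))"
  by (meson graded_hom_closed is_complex_graded_hom)

lemma cdiff_add:
  "\<lbrakk>is_complex n C; x \<in> carrier (cobj C s); y \<in> carrier (cobj C s)\<rbrakk>
    \<Longrightarrow> cdiff C s (x \<oplus>\<^bsub>cobj C s\<^esub> y) = cdiff C s x \<oplus>\<^bsub>cobj C (s + 1)\<^esub> cdiff C s y"
  by (meson graded_hom_add is_complex_graded_hom)

lemma cdiff_smult:
  "\<lbrakk>is_complex n C; r \<in> carrier (truncated_poly n); x \<in> carrier (cobj C s)\<rbrakk>
    \<Longrightarrow> cdiff C s (r \<odot>\<^bsub>cobj C s\<^esub> x) = r \<odot>\<^bsub>cobj C (s + 1)\<^esub> cdiff C s x"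
  by (meson graded_hom_smult is_complex_graded_hom)

lemma cdiff_zero:
  "is_complex n C \<Longrightarrow> cdiff C s \<zero>\<^bsub>cobj C s\<^esub> = \<zero>\<^bsub>cobj C (s + 1)\<^esub>"
  by (meson graded_hom_zero is_complex_graded_hom is_complex_abelian_group)

lemma coboundariesI:
  "x \<in> carrier (cobj C (s - 1)) \<Longrightarrow> cdiff C (s - 1) x \<in> coboundaries C s"
  by (simp add: coboundaries_def)

lemma coboundaries_smult:
  assumes "is_complex n C" "r \<in> carrier (truncated_poly n)" "b \<in> coboundaries C s"
  shows "r \<odot>\<^bsub>cobj C s\<^esub> b \<in> coboundaries C s"
proof -
  obtain x where x: "x \<in> carrier (cobj C (s - 1))" "b = cdiff C (s - 1) x"
    using assms(3) by (auto simp: coboundaries_def)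
  have "r \<odot>\<^bsub>cobj C s\<^esub> b = cdiff C (s - 1) (r \<odot>\<^bsub>cobj C (s - 1)\<^esub> x)"
    using cdiff_smult[OF assms(1,2) x(1)] x(2) by simp
  then show ?thesis
    using is_complex_smult_closed[OF assms(1,2) x(1)] by (simp add: coboundariesI)
qed

lemma coboundaries_subgroup:
  assumes "is_complex n C"
  shows "subgroup (coboundaries C s) (add_monoid (cobj C s))"
proof -
  have "group_hom (add_monoid (cobj C (s - 1))) (add_monoid (cobj C s)) (cdiff C (s - 1))"
    using graded_hom_group_hom[of "cdiff C (s - 1)" n "cobj C (s - 1)" "cobj C s"]
      is_complex_graded_hom[OF assms, of "s - 1"] is_complex_abelian_group[OF assms] by simp
  then show ?thesis
    using group_hom.img_is_subgroup by (fastforce simp: coboundaries_def)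
qed


section \<open>Tensor products of complexes\<close>

text \<open>The differential of the tensor product on formal sums of generators, before passing to
  cosets of the relations.\<close>

definition tensor_d ::
    "('r, 'm) cochain_complex \<Rightarrow> ('r, 'l) cochain_complex \<Rightarrow> int \<Rightarrow>
     ((int \<times> 'm \<times> 'l) \<Rightarrow>\<^sub>0 int) \<Rightarrow> ((int \<times> 'm \<times> 'l) \<Rightarrow>\<^sub>0 int)" where
  "tensor_d P W s = frag_extend (\<lambda>(p, x, y).
     frag_of (p + 1, cdiff P p x, y) +
     frag_cmul (if even p then 1 else -1) (frag_of (p, x, cdiff W (s - p) y)))"

lemma frag_of_diff_keys:
  "a \<in> S \<Longrightarrow> b \<in> S \<Longrightarrow> Poly_Mapping.keys (frag_of a - frag_of b) \<subseteq> S"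
  "a \<in> S \<Longrightarrow> b \<in> S \<Longrightarrow> c \<in> S \<Longrightarrow> Poly_Mapping.keys (frag_of a - frag_of b - frag_of c) \<subseteq> S"
  using keys_diff[of "frag_of a" "frag_of b"] keys_diff[of "frag_of a - frag_of b" "frag_of c"] by auto

text \<open>A map on formal sums respects the tensor relations as soon as it does so on the three kinds of
  defining relations. The target is any additive subgroup \<open>N\<close>, because the lemma is used for maps
  that change the cohomological degree: the differential raises it by one and the homotopy of a
  telescope lowers it by one.\<close>

lemma frag_extend_maps_rels:
  fixes P :: "('k::field npoly set, 'm) cochain_complex" and W :: "('k npoly set, 'l) cochain_complex"
  assumes P: "is_complex n P" and W: "is_complex n W"
    and N: "0 \<in> N" "\<And>a b. a \<in> N \<Longrightarrow> b \<in> N \<Longrightarrow> a - b \<in> N"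
    and l: "\<And>p x x' y. \<lbrakk>x \<in> carrier (cobj P p); x' \<in> carrier (cobj P p); y \<in> carrier (cobj W (s - p))\<rbrakk>
       \<Longrightarrow> g (p, x \<oplus>\<^bsub>cobj P p\<^esub> x', y) - g (p, x, y) - g (p, x', y) \<in> N"
    and r: "\<And>p x y y'. \<lbrakk>x \<in> carrier (cobj P p); y \<in> carrier (cobj W (s - p)); y' \<in> carrier (cobj W (s - p))\<rbrakk>
       \<Longrightarrow> g (p, x, y \<oplus>\<^bsub>cobj W (s - p)\<^esub> y') - g (p, x, y) - g (p, x, y') \<in> N"
    and b: "\<And>p a x y. \<lbrakk>a \<in> carrier (truncated_poly n); x \<in> carrier (cobj P p); y \<in> carrier (cobj W (s - p))\<rbrakk>
       \<Longrightarrow> g (p, a \<odot>\<^bsub>cobj P p\<^esub> x, y) - g (p, x, a \<odot>\<^bsub>cobj W (s - p)\<^esub> y) \<in> N"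
    and c: "c \<in> tensor_rels n P W s"
  shows "frag_extend g c \<in> N"
proof -
  let ?F = "free_Abelian_group (tensor_gens P W s)"
  let ?K = "{c. Poly_Mapping.keys c \<subseteq> tensor_gens P W s \<and> frag_extend g c \<in> N}"
  have neg: "- a \<in> N" if "a \<in> N" for a using N(2)[OF N(1) that] by simp
  have add: "a + b \<in> N" if "a \<in> N" "b \<in> N" for a b
    using N(2)[OF that(1) neg[OF that(2)]] by simp
  have K: "subgroup ?K ?F"
  proof (rule group.subgroupI)
    show "?K \<noteq> {}" using N(1) by (auto intro!: exI[of _ 0])
    show "inv\<^bsub>?F\<^esub> a \<in> ?K" if "a \<in> ?K" for a
      using that neg by (simp add: frag_extend_minus)
    show "a \<otimes>\<^bsub>?F\<^esub> b \<in> ?K" if "a \<in> ?K" "b \<in> ?K" for a b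
      using that add keys_add[of a b] by (auto simp: frag_extend_add)
  qed auto
  note closed = is_complex_add_closed[OF P] is_complex_add_closed[OF W]
    is_complex_smult_closed[OF P] is_complex_smult_closed[OF W]
  have "tensor_rels n P W s \<subseteq> ?K"
    unfolding tensor_rels_def
  proof (rule group.generate_subgroup_incl[OF group_free_Abelian_group _ K], intro Un_least)
    show "{frag_of (p, x \<oplus>\<^bsub>cobj P p\<^esub> x', y) - frag_of (p, x, y) - frag_of (p, x', y) | p x x' y.
         x \<in> carrier (cobj P p) \<and> x' \<in> carrier (cobj P p) \<and> y \<in> carrier (cobj W (s - p))} \<subseteq> ?K"
      by (intro subsetI, elim CollectE exE conjE, hypsubst, intro CollectI conjI frag_of_diff_keys)
        (simp_all add: tensor_gens_def closed frag_extend_diff l)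
    show "{frag_of (p, x, y \<oplus>\<^bsub>cobj W (s - p)\<^esub> y') - frag_of (p, x, y) - frag_of (p, x, y') | p x y y'.
         x \<in> carrier (cobj P p) \<and> y \<in> carrier (cobj W (s - p)) \<and> y' \<in> carrier (cobj W (s - p))} \<subseteq> ?K"
      by (intro subsetI, elim CollectE exE conjE, hypsubst, intro CollectI conjI frag_of_diff_keys)
        (simp_all add: tensor_gens_def closed frag_extend_diff r)
    show "{frag_of (p, r \<odot>\<^bsub>cobj P p\<^esub> x, y) - frag_of (p, x, r \<odot>\<^bsub>cobj W (s - p)\<^esub> y) | p r x y.
         r \<in> carrier (truncated_poly n) \<and> x \<in> carrier (cobj P p) \<and> y \<in> carrier (cobj W (s - p))} \<subseteq> ?K"
      by (intro subsetI, elim CollectE exE conjE, hypsubst, intro CollectI conjI frag_of_diff_keys)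
        (simp_all add: tensor_gens_def closed frag_extend_diff b)
  qed
  then show ?thesis using c by blast
qed

text \<open>The differential sends a generator to a sum of two terms, the second with a sign. These identities
  sort the image of a defining relation into a defining relation for each term.\<close>

lemma frag_cmul_regroup:
  "a + frag_cmul k b - (a' + frag_cmul k b') = (a - a') + frag_cmul k (b - b')"
  "a + frag_cmul k b - (a' + frag_cmul k b') - (a'' + frag_cmul k b'') = (a - a' - a'') + frag_cmul k (b - b' - b'')"
  by (rule poly_mapping_eqI; simp add: lookup_add lookup_minus right_diff_distrib)+

context
  fixes n :: "nat \<Rightarrow> nat"
    and P :: "('k::field npoly set, 'm) cochain_complex" and W :: "('k npoly set, 'l) cochain_complex"
  assumes P: "is_complex n P" and W: "is_complex n W"
begin

lemma tensor_rels_subgroup: "subgroup (tensor_rels n P W s) (free_Abelian_group (tensor_gens P W s))"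
  unfolding tensor_rels_def
proof (rule group.generate_is_subgroup[OF group_free_Abelian_group], intro Un_least)
  note closed = is_complex_add_closed[OF P] is_complex_add_closed[OF W]
    is_complex_smult_closed[OF P] is_complex_smult_closed[OF W]
  let ?C = "carrier (free_Abelian_group (tensor_gens P W s))"
  show "{frag_of (p, x \<oplus>\<^bsub>cobj P p\<^esub> x', y) - frag_of (p, x, y) - frag_of (p, x', y) | p x x' y.
       x \<in> carrier (cobj P p) \<and> x' \<in> carrier (cobj P p) \<and> y \<in> carrier (cobj W (s - p))} \<subseteq> ?C"
    by (intro subsetI, elim CollectE exE conjE, hypsubst, unfold carrier_free_Abelian_group_iff, intro frag_of_diff_keys)
      (simp_all add: tensor_gens_def closed)
  show "{frag_of (p, x, y \<oplus>\<^bsub>cobj W (s - p)\<^esub> y') - frag_of (p, x, y) - frag_of (p, x, y') | p x y y'.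
       x \<in> carrier (cobj P p) \<and> y \<in> carrier (cobj W (s - p)) \<and> y' \<in> carrier (cobj W (s - p))} \<subseteq> ?C"
    by (intro subsetI, elim CollectE exE conjE, hypsubst, unfold carrier_free_Abelian_group_iff, intro frag_of_diff_keys)
      (simp_all add: tensor_gens_def closed)
  show "{frag_of (p, r \<odot>\<^bsub>cobj P p\<^esub> x, y) - frag_of (p, x, r \<odot>\<^bsub>cobj W (s - p)\<^esub> y) | p r x y.
       r \<in> carrier (truncated_poly n) \<and> x \<in> carrier (cobj P p) \<and> y \<in> carrier (cobj W (s - p))} \<subseteq> ?C"
    by (intro subsetI, elim CollectE exE conjE, hypsubst, unfold carrier_free_Abelian_group_iff, intro frag_of_diff_keys)
      (simp_all add: tensor_gens_def closed)
qed

lemma tensor_rels_keys: "c \<in> tensor_rels n P W s \<Longrightarrow> Poly_Mapping.keys c \<subseteq> tensor_gens P W s"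
  using subsetD[OF subgroup.subset[OF tensor_rels_subgroup], of c s] by simp

lemma tensor_rels_zero: "0 \<in> tensor_rels n P W s"
  using subgroup.one_closed[OF tensor_rels_subgroup, of s] by simp

lemma tensor_rels_add:
  "\<lbrakk>a \<in> tensor_rels n P W s; b \<in> tensor_rels n P W s\<rbrakk> \<Longrightarrow> a + b \<in> tensor_rels n P W s"
  using subgroup.m_closed[OF tensor_rels_subgroup, of a s b] by simp

lemma tensor_rels_minus: "a \<in> tensor_rels n P W s \<Longrightarrow> - a \<in> tensor_rels n P W s"
  using subgroup.m_inv_closed[OF tensor_rels_subgroup, of a s] tensor_rels_keys[of a s] by simp

lemma tensor_rels_diff:
  "\<lbrakk>a \<in> tensor_rels n P W s; b \<in> tensor_rels n P W s\<rbrakk> \<Longrightarrow> a - b \<in> tensor_rels n P W s"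
  using tensor_rels_add[of a s "- b"] tensor_rels_minus[of b s] by simp

lemma tensor_rels_cmul:
  "a \<in> tensor_rels n P W s \<Longrightarrow> frag_cmul (if Q then 1 else -1) a \<in> tensor_rels n P W s"
  using tensor_rels_minus by simp

lemma tensor_rels_left:
  assumes "x \<in> carrier (cobj P p)" "x' \<in> carrier (cobj P p)" "y \<in> carrier (cobj W (s - p))"
  shows "frag_of (p, x \<oplus>\<^bsub>cobj P p\<^esub> x', y) - frag_of (p, x, y) - frag_of (p, x', y) \<in> tensor_rels n P W s"
  unfolding tensor_rels_def by (rule generate.incl) (use assms in blast)

lemma tensor_rels_right:
  assumes "x \<in> carrier (cobj P p)" "y \<in> carrier (cobj W (s - p))" "y' \<in> carrier (cobj W (s - p))"
  shows "frag_of (p, x, y \<oplus>\<^bsub>cobj W (s - p)\<^esub> y') - frag_of (p, x, y) - frag_of (p, x, y') \<in> tensor_rels n P W s"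
  unfolding tensor_rels_def by (rule generate.incl) (use assms in blast)

lemma tensor_rels_balanced:
  assumes "r \<in> carrier (truncated_poly n)" "x \<in> carrier (cobj P p)" "y \<in> carrier (cobj W (s - p))"
  shows "frag_of (p, r \<odot>\<^bsub>cobj P p\<^esub> x, y) - frag_of (p, x, r \<odot>\<^bsub>cobj W (s - p)\<^esub> y) \<in> tensor_rels n P W s"
  unfolding tensor_rels_def by (rule generate.incl) (use assms in blast)

lemma tensor_rels_zero_left:
  assumes "y \<in> carrier (cobj W (s - p))"
  shows "frag_of (p, \<zero>\<^bsub>cobj P p\<^esub>, y) \<in> tensor_rels n P W s"
proof -
  interpret abelian_group "cobj P p" using is_complex_abelian_group[OF P] .
  show ?thesis
    using tensor_rels_minus[OF tensor_rels_left[OF zero_closed zero_closed assms]] by simp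
qed

lemma tensor_rels_zero_right:
  assumes "x \<in> carrier (cobj P p)"
  shows "frag_of (p, x, \<zero>\<^bsub>cobj W (s - p)\<^esub>) \<in> tensor_rels n P W s"
proof -
  interpret abelian_group "cobj W (s - p)" using is_complex_abelian_group[OF W] .
  show ?thesis
    using tensor_rels_minus[OF tensor_rels_right[OF assms zero_closed zero_closed]] by simp
qed

lemma tensor_d_keys:
  assumes "Poly_Mapping.keys c \<subseteq> tensor_gens P W s"
  shows "Poly_Mapping.keys (tensor_d P W s c) \<subseteq> tensor_gens P W (s + 1)"
proof -
  let ?g = "\<lambda>(p, x, y). frag_of (p + 1, cdiff P p x, y) +
    frag_cmul (if even p then 1 else -1) (frag_of (p, x, cdiff W (s - p) y))"
  have dy: "cdiff W (s - p) y \<in> carrier (cobj W (s + 1 - p))" if "y \<in> carrier (cobj W (s - p))" for p y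
    using cdiff_closed[OF W that] by (simp only: diff_add_eq)
  have "Poly_Mapping.keys (?g u) \<subseteq> tensor_gens P W (s + 1)"
    if "u \<in> tensor_gens P W s" for u
  proof -
    obtain p x y where u': "u = (p, x, y)" by (cases u)
    then have u: "u = (p, x, y)" "x \<in> carrier (cobj P p)" "y \<in> carrier (cobj W (s - p))"
      using that by (auto simp: tensor_gens_def)
    have "(p + 1, cdiff P p x, y) \<in> tensor_gens P W (s + 1)" "(p, x, cdiff W (s - p) y) \<in> tensor_gens P W (s + 1)"
      using cdiff_closed[OF P u(2)] dy[OF u(3)] u(2,3) by (simp_all add: tensor_gens_def)
    moreover have "Poly_Mapping.keys (?g u) \<subseteq>
        {(p + 1, cdiff P p x, y), (p, x, cdiff W (s - p) y)}"
    proof -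
      have "?g u = frag_of (p + 1, cdiff P p x, y) +
          frag_cmul (if even p then 1 else -1) (frag_of (p, x, cdiff W (s - p) y))"
        by (simp only: u(1) prod.case)
      moreover have "Poly_Mapping.keys (frag_cmul (if even p then 1 else -1) (frag_of (p, x, cdiff W (s - p) y)))
          \<subseteq> {(p, x, cdiff W (s - p) y)}"
        using keys_cmul by force
      ultimately show ?thesis using keys_add by fastforce
    qed
    ultimately show ?thesis by blast
  qed
  then show ?thesis
    unfolding tensor_d_def using assms by (intro order_trans[OF keys_frag_extend] UN_least) blast
qed

lemma tensor_d_rels:
  assumes "c \<in> tensor_rels n P W s"
  shows "tensor_d P W s c \<in> tensor_rels n P W (s + 1)"
  unfolding tensor_d_def
proof (rule frag_extend_maps_rels[OF P W tensor_rels_zero _ _ _ _ assms])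
  fix p :: int and x x' y y' and r :: "'k npoly set"
  let ?g = "\<lambda>(p, x, y). frag_of (p + 1, cdiff P p x, y) +
    frag_cmul (if even p then 1 else -1) (frag_of (p, x, cdiff W (s - p) y))"
  have e: "s + 1 - p = s - p + 1" by simp
  assume x: "x \<in> carrier (cobj P p)" and y: "y \<in> carrier (cobj W (s - p))"
  have dx: "cdiff P p x \<in> carrier (cobj P (p + 1))" using cdiff_closed[OF P x] .
  have dy: "cdiff W (s - p) y \<in> carrier (cobj W (s + 1 - p))" using cdiff_closed[OF W y] by (simp only: e)
  have y2: "y \<in> carrier (cobj W (s + 1 - (p + 1)))" using y by simp
  { assume x': "x' \<in> carrier (cobj P p)"
    have dx': "cdiff P p x' \<in> carrier (cobj P (p + 1))" using cdiff_closed[OF P x'] .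
    show "?g (p, x \<oplus>\<^bsub>cobj P p\<^esub> x', y) -
       ?g (p, x, y) -
       ?g (p, x', y) \<in> tensor_rels n P W (s + 1)"
      using tensor_rels_add[OF tensor_rels_left[OF dx dx' y2] tensor_rels_cmul[OF tensor_rels_left[OF x x' dy], of "even p"]]
      by (simp only: prod.case frag_cmul_regroup cdiff_add[OF P x x']) }
  { assume y': "y' \<in> carrier (cobj W (s - p))"
    have dy': "cdiff W (s - p) y' \<in> carrier (cobj W (s + 1 - p))" using cdiff_closed[OF W y'] by (simp only: e)
    have y2': "y' \<in> carrier (cobj W (s + 1 - (p + 1)))" using y' by simp
    show "?g (p, x, y \<oplus>\<^bsub>cobj W (s - p)\<^esub> y') -
       ?g (p, x, y) -
       ?g (p, x, y') \<in> tensor_rels n P W (s + 1)"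
      using tensor_rels_add[OF tensor_rels_right[OF dx y2 y2'] tensor_rels_cmul[OF tensor_rels_right[OF x dy dy'], of "even p"]]
      by (simp only: prod.case frag_cmul_regroup cdiff_add[OF W y y'] e add_diff_cancel_right) }
  { assume r: "r \<in> carrier (truncated_poly n)"
    show "?g (p, r \<odot>\<^bsub>cobj P p\<^esub> x, y) -
       ?g (p, x, r \<odot>\<^bsub>cobj W (s - p)\<^esub> y) \<in> tensor_rels n P W (s + 1)"
      using tensor_rels_add[OF tensor_rels_balanced[OF r dx y2] tensor_rels_cmul[OF tensor_rels_balanced[OF r x dy], of "even p"]]
      by (simp only: prod.case frag_cmul_regroup cdiff_smult[OF P r x] cdiff_smult[OF W r y] e add_diff_cancel_right) }
qed (rule tensor_rels_diff)

lemma tensor_d_diff: "tensor_d P W s (a - b) = tensor_d P W s a - tensor_d P W s b"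
  by (simp add: tensor_d_def frag_extend_diff)

lemma r_coset_tensor_rels:
  "tensor_rels n P W s #>\<^bsub>free_Abelian_group (tensor_gens P W s)\<^esub> c = {b. b - c \<in> tensor_rels n P W s}"
proof -
  have "b \<in> (\<Union>h\<in>tensor_rels n P W s. {h + c})" if "b - c \<in> tensor_rels n P W s" for b
    using that by (auto intro!: bexI[OF _ that])
  then show ?thesis by (auto simp: r_coset_def)
qed

text \<open>The differential maps relations to relations, so adding the target relations to the image of a
  coset gives the coset of the image of any representative.\<close>

lemma cdiff_tensor_complex_coset:
  "cdiff (tensor_complex n P W) s {b. b - c \<in> tensor_rels n P W s}
    = {b. b - tensor_d P W s c \<in> tensor_rels n P W (s + 1)}" (is "?L = ?R")
proof
  show "?L \<subseteq> ?R"
  proof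
    fix b assume "b \<in> ?L"
    then obtain h a where h: "h \<in> tensor_rels n P W (s + 1)" "a - c \<in> tensor_rels n P W s"
        "b = h + tensor_d P W s a"
      by (auto simp: tensor_complex_def set_mult_def tensor_d_def)
    have "b - tensor_d P W s c = h + tensor_d P W s (a - c)" by (simp add: h(3) tensor_d_diff)
    then show "b \<in> ?R" using tensor_rels_add[OF h(1) tensor_d_rels[OF h(2)]] by simp
  qed
  show "?R \<subseteq> ?L"
  proof
    fix b assume "b \<in> ?R"
    then have "b - tensor_d P W s c \<in> tensor_rels n P W (s + 1)" by simp
    moreover have "b = (b - tensor_d P W s c) + tensor_d P W s c" by simp
    moreover have "c - c \<in> tensor_rels n P W s" by (simp add: tensor_rels_zero)
    ultimately show "b \<in> ?L"
      unfolding tensor_complex_def set_mult_def tensor_d_def[symmetric]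
      by (auto intro!: bexI[of _ "b - tensor_d P W s c"] exI[of _ c])
  qed
qed

text \<open>This unwinds the cosets once and for all: acyclicity of the tensor product becomes a statement
  about formal sums of generators modulo relations.\<close>

lemma acyclic_tensor_complex_iff:
  "acyclic_complex (tensor_complex n P W) \<longleftrightarrow>
    (\<forall>s c. Poly_Mapping.keys c \<subseteq> tensor_gens P W s \<and> tensor_d P W s c \<in> tensor_rels n P W (s + 1) \<longrightarrow>
      (\<exists>b. Poly_Mapping.keys b \<subseteq> tensor_gens P W (s - 1) \<and>
         c - tensor_d P W (s - 1) b \<in> tensor_rels n P W s))"
proof -
  let ?Q = "\<lambda>s c. {b. b - c \<in> tensor_rels n P W s}"
  have carrier_F: "carrier (free_Abelian_group S) = {c. Poly_Mapping.keys c \<subseteq> S}" for S :: "(int \<times> 'm \<times> 'l) set"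
    by (simp add: free_Abelian_group_def)
  have carr: "carrier (cobj (tensor_complex n P W) s) = ?Q s ` {c. Poly_Mapping.keys c \<subseteq> tensor_gens P W s}" for s
    by (simp add: tensor_complex_def tensor_module_def Let_def carrier_FactGroup r_coset_tensor_rels carrier_F)
  have zero: "\<zero>\<^bsub>cobj (tensor_complex n P W) s\<^esub> = tensor_rels n P W s" for s
    by (simp add: tensor_complex_def tensor_module_def Let_def)
  have eq: "?Q s a = ?Q s b \<longleftrightarrow> a - b \<in> tensor_rels n P W s" for s a b
  proof
    assume "?Q s a = ?Q s b"
    moreover have "a \<in> ?Q s a" using tensor_rels_zero by simp
    ultimately show "a - b \<in> tensor_rels n P W s" by blast
  next
    assume ab: "a - b \<in> tensor_rels n P W s"
    have "c - a \<in> tensor_rels n P W s \<longleftrightarrow> c - b \<in> tensor_rels n P W s" for c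
      using tensor_rels_add[OF _ ab, where a="c - a"] tensor_rels_diff[OF _ ab, where a="c - b"] by auto
    then show "?Q s a = ?Q s b" by blast
  qed
  have eq0: "?Q s a = tensor_rels n P W s \<longleftrightarrow> a \<in> tensor_rels n P W s" for s a
    using eq[where a = a and b = 0] by simp
  have image_filter: "{A \<in> f ` K. T A} = f ` {c \<in> K. T (f c)}" for f :: "'a \<Rightarrow> 'b" and K T
    by auto
  have cyc: "cocycles (tensor_complex n P W) s =
      ?Q s ` {c. Poly_Mapping.keys c \<subseteq> tensor_gens P W s \<and> tensor_d P W s c \<in> tensor_rels n P W (s + 1)}" for s
    unfolding cocycles_def carr zero image_filter cdiff_tensor_complex_coset eq0 by simp
  have bou: "coboundaries (tensor_complex n P W) s =
      ?Q s ` tensor_d P W (s - 1) ` {b. Poly_Mapping.keys b \<subseteq> tensor_gens P W (s - 1)}" for s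
    using cdiff_tensor_complex_coset[of "s - 1"]
    by (simp add: coboundaries_def carr image_image)
  show ?thesis
    unfolding acyclic_complex_def cyc bou image_subset_iff
    by (simp add: image_iff eq Bex_def, blast)
qed

end


section \<open>Contracting a tensor factor\<close>

text \<open>
  The map \<open>x \<otimes> y \<mapsto> \<phi>(y) x\<close> to the first factor, where \<open>\<phi>\<close> is a linear functional on the part of
  the second factor in degree 0, and \<open>x \<otimes> y \<mapsto> 0\<close> when \<open>y\<close> has another degree. The values lie in a
  module with a carrier, to which \<^const>\<open>frag_extend\<close> does not apply; the map is therefore chosen
  by the universal property of the free abelian group.
\<close>

definition tensor_contract ::
    "('k::field npoly set, 'm) cochain_complex \<Rightarrow> ('k npoly set, 'l) cochain_complex \<Rightarrow>
     ('l \<Rightarrow> 'k npoly set) \<Rightarrow> int \<Rightarrow> ((int \<times> 'm \<times> 'l) \<Rightarrow>\<^sub>0 int) \<Rightarrow> 'm" where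
  "tensor_contract P W \<phi> s =
    (SOME h. h \<in> hom (free_Abelian_group (tensor_gens P W s)) (add_monoid (cobj P s)) \<and>
      (\<forall>p x y. (p, x, y) \<in> tensor_gens P W s \<longrightarrow>
         h (frag_of (p, x, y)) = (if p = s then \<phi> y \<odot>\<^bsub>cobj P s\<^esub> x else \<zero>\<^bsub>cobj P s\<^esub>)))"

text \<open>Linearity over the ring, with no reference to the gradings: the functionals and homotopies of a
  telescope multiply by monomials, so they shift degrees.\<close>

definition linear_functional ::
    "(nat \<Rightarrow> nat) \<Rightarrow> ('k::field npoly set, 'l) graded_module \<Rightarrow> ('l \<Rightarrow> 'k npoly set) \<Rightarrow> bool" where
  "linear_functional n M \<phi> \<longleftrightarrow>
    \<phi> \<in> carrier M \<rightarrow> carrier (truncated_poly n) \<and>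
    (\<forall>y\<in>carrier M. \<forall>y'\<in>carrier M. \<phi> (y \<oplus>\<^bsub>M\<^esub> y') = \<phi> y \<oplus>\<^bsub>truncated_poly n\<^esub> \<phi> y') \<and>
    (\<forall>r\<in>carrier (truncated_poly n). \<forall>y\<in>carrier M. \<phi> (r \<odot>\<^bsub>M\<^esub> y) = r \<otimes>\<^bsub>truncated_poly n\<^esub> \<phi> y)"

definition linear_map ::
    "(nat \<Rightarrow> nat) \<Rightarrow> ('k::field npoly set, 'm) graded_module \<Rightarrow> ('k npoly set, 'l) graded_module \<Rightarrow> ('m \<Rightarrow> 'l) \<Rightarrow> bool" where
  "linear_map n M N h \<longleftrightarrow>
    h \<in> carrier M \<rightarrow> carrier N \<and>
    (\<forall>y\<in>carrier M. \<forall>y'\<in>carrier M. h (y \<oplus>\<^bsub>M\<^esub> y') = h y \<oplus>\<^bsub>N\<^esub> h y') \<and>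
    (\<forall>r\<in>carrier (truncated_poly n). \<forall>y\<in>carrier M. h (r \<odot>\<^bsub>M\<^esub> y) = r \<odot>\<^bsub>N\<^esub> h y)"

context
  fixes n :: "nat \<Rightarrow> nat"
    and P :: "('k::field npoly set, 'm) cochain_complex" and W :: "('k npoly set, 'l) cochain_complex"
    and \<phi> :: "'l \<Rightarrow> 'k npoly set"
  assumes P: "is_complex n P" and W: "is_complex n W"
    and phi: "linear_functional n (cobj W 0) \<phi>"
begin

lemma linear_functional_closed: "y \<in> carrier (cobj W 0) \<Longrightarrow> \<phi> y \<in> carrier (truncated_poly n)"
  using phi by (auto simp: linear_functional_def)

lemma tensor_contract:
  shows tensor_contract_hom:
      "tensor_contract P W \<phi> s \<in> hom (free_Abelian_group (tensor_gens P W s)) (add_monoid (cobj P s))"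
    and tensor_contract_frag_of:
      "\<lbrakk>x \<in> carrier (cobj P p); y \<in> carrier (cobj W (s - p))\<rbrakk> \<Longrightarrow>
        tensor_contract P W \<phi> s (frag_of (p, x, y))
         = (if p = s then \<phi> y \<odot>\<^bsub>cobj P s\<^esub> x else \<zero>\<^bsub>cobj P s\<^esub>)"
proof -
  let ?f = "\<lambda>(p, x, y). if p = s then \<phi> y \<odot>\<^bsub>cobj P s\<^esub> x else \<zero>\<^bsub>cobj P s\<^esub>"
  interpret Ps: comm_group "add_monoid (cobj P s)" using is_complex_comm_group[OF P] .
  have "?f ` tensor_gens P W s \<subseteq> carrier (add_monoid (cobj P s))"
    using is_complex_smult_closed[OF P linear_functional_closed] is_complex_zero_closed[OF P] by (auto simp: tensor_gens_def)
  then obtain h where "h \<in> hom (free_Abelian_group (tensor_gens P W s)) (add_monoid (cobj P s))"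
    "\<And>u. u \<in> tensor_gens P W s \<Longrightarrow> h (frag_of u) = ?f u"
    using Ps.free_Abelian_group_universal by blast
  then have "\<exists>h. h \<in> hom (free_Abelian_group (tensor_gens P W s)) (add_monoid (cobj P s)) \<and>
      (\<forall>p x y. (p, x, y) \<in> tensor_gens P W s \<longrightarrow>
         h (frag_of (p, x, y)) = (if p = s then \<phi> y \<odot>\<^bsub>cobj P s\<^esub> x else \<zero>\<^bsub>cobj P s\<^esub>))"
    by (intro exI[of _ h]) auto
  from someI_ex[OF this, folded tensor_contract_def] show
    "tensor_contract P W \<phi> s \<in> hom (free_Abelian_group (tensor_gens P W s)) (add_monoid (cobj P s))"
    "\<lbrakk>x \<in> carrier (cobj P p); y \<in> carrier (cobj W (s - p))\<rbrakk> \<Longrightarrow>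
        tensor_contract P W \<phi> s (frag_of (p, x, y))
         = (if p = s then \<phi> y \<odot>\<^bsub>cobj P s\<^esub> x else \<zero>\<^bsub>cobj P s\<^esub>)"
    by (simp_all add: tensor_gens_def)
qed

lemma tensor_contract_group_hom:
  "group_hom (free_Abelian_group (tensor_gens P W s)) (add_monoid (cobj P s)) (tensor_contract P W \<phi> s)"
proof -
  interpret Ps: comm_group "add_monoid (cobj P s)" using is_complex_comm_group[OF P] .
  show ?thesis
    using tensor_contract_hom
    by (simp add: group_hom_def group_hom_axioms_def Ps.group_axioms)
qed

lemma tensor_contract_closed:
  "Poly_Mapping.keys c \<subseteq> tensor_gens P W s \<Longrightarrow> tensor_contract P W \<phi> s c \<in> carrier (cobj P s)"
  using group_hom.hom_closed[OF tensor_contract_group_hom, of c s] by simp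

lemma tensor_contract_zero: "tensor_contract P W \<phi> s 0 = \<zero>\<^bsub>cobj P s\<^esub>"
  using group_hom.hom_one[OF tensor_contract_group_hom, of s] by simp

lemma tensor_contract_add:
  "\<lbrakk>Poly_Mapping.keys a \<subseteq> tensor_gens P W s; Poly_Mapping.keys b \<subseteq> tensor_gens P W s\<rbrakk>
    \<Longrightarrow> tensor_contract P W \<phi> s (a + b) = tensor_contract P W \<phi> s a \<oplus>\<^bsub>cobj P s\<^esub> tensor_contract P W \<phi> s b"
  using group_hom.hom_mult[OF tensor_contract_group_hom, of a s b] by simp

lemma tensor_contract_minus:
  "Poly_Mapping.keys a \<subseteq> tensor_gens P W s \<Longrightarrow>
    tensor_contract P W \<phi> s (- a) = \<ominus>\<^bsub>cobj P s\<^esub> tensor_contract P W \<phi> s a"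
  using group_hom.hom_inv[OF tensor_contract_group_hom, of a s] by (simp add: a_inv_def)

lemma tensor_contract_diff:
  "\<lbrakk>Poly_Mapping.keys a \<subseteq> tensor_gens P W s; Poly_Mapping.keys b \<subseteq> tensor_gens P W s\<rbrakk>
    \<Longrightarrow> tensor_contract P W \<phi> s (a - b) = tensor_contract P W \<phi> s a \<ominus>\<^bsub>cobj P s\<^esub> tensor_contract P W \<phi> s b"
  using tensor_contract_add[of a s "- b"] by (simp add: tensor_contract_minus a_minus_def)

text \<open>Additivity of \<open>\<phi>\<close> takes care of the relations that are additive in the second factor, and
  \<open>\<phi> (r y) = r \<phi> y\<close> of the balancing relations.\<close>

lemma tensor_contract_rels:
  assumes "c \<in> tensor_rels n P W s"
  shows "tensor_contract P W \<phi> s c = \<zero>\<^bsub>cobj P s\<^esub>"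
proof -
  let ?F = "free_Abelian_group (tensor_gens P W s)" and ?h = "tensor_contract P W \<phi> s"
  let ?K = "kernel ?F (add_monoid (cobj P s)) ?h"
  interpret Ps: module "truncated_poly n" "cobj P s" using is_complex_module[OF P] .
  note closed = is_complex_add_closed[OF P] is_complex_add_closed[OF W]
    is_complex_smult_closed[OF P] is_complex_smult_closed[OF W]
  have diff2: "frag_of a - frag_of b \<in> ?K"
    if "a \<in> tensor_gens P W s" "b \<in> tensor_gens P W s" "?h (frag_of a) = ?h (frag_of b)" for a b
    using that frag_of_diff_keys(1)[of a _ b] tensor_contract_closed[of "frag_of b" s]
    by (simp add: kernel_def tensor_contract_diff Ps.minus_eq Ps.M.r_neg)
  have diff3: "frag_of a - frag_of b - frag_of c \<in> ?K"
    if "a \<in> tensor_gens P W s" "b \<in> tensor_gens P W s" "c \<in> tensor_gens P W s"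
      "?h (frag_of a) = ?h (frag_of b) \<oplus>\<^bsub>cobj P s\<^esub> ?h (frag_of c)" for a b c
  proof -
    have b: "?h (frag_of b) \<in> carrier (cobj P s)" and c: "?h (frag_of c) \<in> carrier (cobj P s)"
      using that(2,3) tensor_contract_closed by simp_all
    have "?h (frag_of a) \<ominus>\<^bsub>cobj P s\<^esub> ?h (frag_of b) = ?h (frag_of c)"
      unfolding that(4) Ps.minus_eq Ps.M.a_comm[OF b c] using b c by (simp add: Ps.M.a_assoc Ps.M.r_neg)
    then show ?thesis
      using that(1-3) frag_of_diff_keys[of a _ b] c
      by (simp add: kernel_def tensor_contract_diff) (simp add: Ps.minus_eq Ps.M.r_neg)
  qed
  have lin: "y \<in> carrier (cobj W 0) \<Longrightarrow> y' \<in> carrier (cobj W 0) \<Longrightarrow>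
      \<phi> (y \<oplus>\<^bsub>cobj W 0\<^esub> y') = \<phi> y \<oplus>\<^bsub>truncated_poly n\<^esub> \<phi> y'"
    "r \<in> carrier (truncated_poly n) \<Longrightarrow> y \<in> carrier (cobj W 0) \<Longrightarrow>
      \<phi> (r \<odot>\<^bsub>cobj W 0\<^esub> y) = r \<otimes>\<^bsub>truncated_poly n\<^esub> \<phi> y" for y y' r
    using phi by (auto simp: linear_functional_def)
  have "tensor_rels n P W s \<subseteq> ?K"
    unfolding tensor_rels_def
  proof (rule group.generate_subgroup_incl[OF group_free_Abelian_group _ group_hom.subgroup_kernel[OF tensor_contract_group_hom]],
      intro Un_least)
    show "{frag_of (p, x \<oplus>\<^bsub>cobj P p\<^esub> x', y) - frag_of (p, x, y) - frag_of (p, x', y) | p x x' y.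
         x \<in> carrier (cobj P p) \<and> x' \<in> carrier (cobj P p) \<and> y \<in> carrier (cobj W (s - p))} \<subseteq> ?K"
      by (intro subsetI, elim CollectE exE conjE, hypsubst, intro diff3)
        (auto simp: tensor_gens_def closed tensor_contract_frag_of Ps.smult_r_distr linear_functional_closed)
    show "{frag_of (p, x, y \<oplus>\<^bsub>cobj W (s - p)\<^esub> y') - frag_of (p, x, y) - frag_of (p, x, y') | p x y y'.
         x \<in> carrier (cobj P p) \<and> y \<in> carrier (cobj W (s - p)) \<and> y' \<in> carrier (cobj W (s - p))} \<subseteq> ?K"
      by (intro subsetI, elim CollectE exE conjE, hypsubst, intro diff3)
        (auto simp: tensor_gens_def closed tensor_contract_frag_of Ps.smult_l_distr linear_functional_closed lin)
    show "{frag_of (p, r \<odot>\<^bsub>cobj P p\<^esub> x, y) - frag_of (p, x, r \<odot>\<^bsub>cobj W (s - p)\<^esub> y) | p r x y.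
         r \<in> carrier (truncated_poly n) \<and> x \<in> carrier (cobj P p) \<and> y \<in> carrier (cobj W (s - p))} \<subseteq> ?K"
      by (intro subsetI, elim CollectE exE conjE, hypsubst, intro diff2)
        (auto simp: tensor_gens_def closed tensor_contract_frag_of linear_functional_closed lin Ps.smult_assoc1[symmetric] Ps.R.m_comm)
  qed
  then show ?thesis using assms by (auto simp: kernel_def)
qed

end


section \<open>Tensoring with a telescope\<close>

lemma frag_diff_induct [consumes 1, case_names zero diff gen]:
  assumes "Poly_Mapping.keys c \<subseteq> S"
    and "T 0"
    and "\<And>a b. \<lbrakk>Poly_Mapping.keys a \<subseteq> S; Poly_Mapping.keys b \<subseteq> S; T a; T b\<rbrakk> \<Longrightarrow> T (a - b)"
    and "\<And>u. u \<in> S \<Longrightarrow> T (frag_of u)"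
  shows "T c"
  using assms by (rule free_Abelian_group_induct)

text \<open>The properties of the telescope (homotopy colimit) of a sequence of maps from the ring to itself
  that the tensor product sees. The map from stage \<open>m\<close> to stage \<open>M\<close> is multiplication by \<open>Y m M\<close>, and
  \<open>e m\<close> is the generator of stage \<open>m\<close>. The functional \<open>\<phi> M\<close> pushes everything up to stage \<open>M\<close> forward
  to stage \<open>M\<close>, and \<open>\<eta> M\<close> records the path taken, so that \<open>y\<close> is homologous to \<open>\<phi> M y \<cdot> e M\<close> through
  \<open>\<eta> M y\<close>. These formulas hold once \<open>M\<close> is beyond all stages in which \<open>y\<close> has entries; this is why
  they are required for large \<open>M\<close> only. In short, \<open>\<eta> M\<close> contracts the part of the telescope up to
  stage \<open>M\<close> to the free module on \<open>e M\<close>.\<close>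

locale telescope =
  fixes n :: "nat \<Rightarrow> nat" and W :: "('k::field npoly set, 'l) cochain_complex"
    and Y :: "nat \<Rightarrow> nat \<Rightarrow> 'k npoly set" and e :: "nat \<Rightarrow> 'l"
    and \<phi> :: "nat \<Rightarrow> 'l \<Rightarrow> 'k npoly set" and \<eta> :: "nat \<Rightarrow> 'l \<Rightarrow> 'l"
  assumes W: "is_complex n W"
    and concentrated: "\<lbrakk>s \<noteq> 0; s \<noteq> -1\<rbrakk> \<Longrightarrow> carrier (cobj W s) = {\<zero>\<^bsub>cobj W s\<^esub>}"
    and Y_closed: "Y m M \<in> carrier (truncated_poly n)"
    and e_closed: "e m \<in> carrier (cobj W 0)"
    and phi_linear: "linear_functional n (cobj W 0) (\<phi> M)"
    and eta_linear: "linear_map n (cobj W 0) (cobj W (-1)) (\<eta> M)"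
    and decompose: "y \<in> carrier (cobj W 0) \<Longrightarrow>
      \<forall>\<^sub>F M in sequentially. \<phi> M y \<odot>\<^bsub>cobj W 0\<^esub> e M \<oplus>\<^bsub>cobj W 0\<^esub> cdiff W (-1) (\<eta> M y) = y"
    and on_boundary: "g \<in> carrier (cobj W (-1)) \<Longrightarrow>
      \<forall>\<^sub>F M in sequentially. \<phi> M (cdiff W (-1) g) = \<zero>\<^bsub>truncated_poly n\<^esub> \<and> \<eta> M (cdiff W (-1) g) = g"
    and phi_e: "m \<le> M \<Longrightarrow> \<phi> M (e m) = Y m M"
    and phi_shift: "y \<in> carrier (cobj W 0) \<Longrightarrow>
      \<forall>\<^sub>F M in sequentially. \<forall>N\<ge>M. Y M N \<otimes>\<^bsub>truncated_poly n\<^esub> \<phi> M y = \<phi> N y"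

text \<open>The colimit of the cohomology of \<open>C\<close> along multiplication by the \<open>Y m M\<close> vanishes: every class, put
  at any stage, dies at a later one.\<close>

definition killed_by ::
    "(nat \<Rightarrow> nat \<Rightarrow> 'r) \<Rightarrow> ('r, 'm) cochain_complex \<Rightarrow> bool" where
  "killed_by Y C \<longleftrightarrow>
    (\<forall>s. \<forall>z\<in>cocycles C s. \<forall>m. \<exists>M\<ge>m. Y m M \<odot>\<^bsub>cobj C s\<^esub> z \<in> coboundaries C s)"

locale tensor_telescope = telescope n W Y e \<phi> \<eta>
  for n :: "nat \<Rightarrow> nat" and W :: "('k::field npoly set, 'l) cochain_complex"
    and Y e \<phi> \<eta> +
  fixes P :: "('k npoly set, 'm) cochain_complex"
  assumes P: "is_complex n P"
begin

text \<open>The homotopy \<open>x \<otimes> y \<mapsto> \<plusminus> x \<otimes> \<eta> M y\<close>. The sign makes the terms \<open>d x \<otimes> \<eta> M y\<close> of \<open>D H\<close> and \<open>H D\<close> cancel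
  below.\<close>

definition contraction :: "nat \<Rightarrow> int \<Rightarrow> ((int \<times> 'm \<times> 'l) \<Rightarrow>\<^sub>0 int) \<Rightarrow> ((int \<times> 'm \<times> 'l) \<Rightarrow>\<^sub>0 int)" where
  "contraction M s = frag_extend (\<lambda>(p, x, y).
     if p = s then frag_cmul (if even p then 1 else -1) (frag_of (p, x, \<eta> M y)) else 0)"

text \<open>The generators \<open>x \<otimes> y\<close> for which stage \<open>M\<close> is already late enough for all formulas of the locale.
  A formal sum has finitely many generators, so they are all good for late stages.\<close>

definition good :: "nat \<Rightarrow> int \<Rightarrow> (int \<times> 'm \<times> 'l) set" where
  "good M s = {(p, x, y). x \<in> carrier (cobj P p) \<and> y \<in> carrier (cobj W (s - p)) \<and>
     (p = s \<longrightarrow> \<phi> M y \<odot>\<^bsub>cobj W 0\<^esub> e M \<oplus>\<^bsub>cobj W 0\<^esub> cdiff W (-1) (\<eta> M y) = y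
        \<and> (\<forall>N\<ge>M. Y M N \<otimes>\<^bsub>truncated_poly n\<^esub> \<phi> M y = \<phi> N y)) \<and>
     (p = s + 1 \<longrightarrow> \<phi> M (cdiff W (-1) y) = \<zero>\<^bsub>truncated_poly n\<^esub> \<and> \<eta> M (cdiff W (-1) y) = y)}"

lemma good_subset: "good M s \<subseteq> tensor_gens P W s"
  by (auto simp: good_def tensor_gens_def)

lemma eventually_good:
  assumes "Poly_Mapping.keys c \<subseteq> tensor_gens P W s"
  shows "\<forall>\<^sub>F M in sequentially. Poly_Mapping.keys c \<subseteq> good M s"
proof -
  have "\<forall>\<^sub>F M in sequentially. u \<in> good M s" if u: "u \<in> tensor_gens P W s" for u
  proof -
    obtain p x y where u': "u = (p, x, y)" by (cases u)
    have x: "x \<in> carrier (cobj P p)" and y: "y \<in> carrier (cobj W (s - p))"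
      using u u' by (auto simp: tensor_gens_def)
    consider "p = s" | "p = s + 1" | "p \<noteq> s" "p \<noteq> s + 1" by blast
    then show ?thesis
    proof cases
      case 1
      then show ?thesis
        using eventually_conj[OF decompose phi_shift, of y y] x y by (simp add: good_def u')
    next
      case 2
      then show ?thesis
        using on_boundary[of y] x y by (simp add: good_def u')
    qed (use x y in \<open>simp add: good_def u'\<close>)
  qed
  then have "\<forall>\<^sub>F M in sequentially. \<forall>u\<in>Poly_Mapping.keys c. u \<in> good M s"
    using assms by (intro eventually_ball_finite) auto
  then show ?thesis by (rule eventually_mono) blast
qed

lemma eta_closed: "y \<in> carrier (cobj W 0) \<Longrightarrow> \<eta> M y \<in> carrier (cobj W (-1))"
  using eta_linear[of M] by (auto simp: linear_map_def)

lemma contraction_keys: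
  assumes "Poly_Mapping.keys c \<subseteq> tensor_gens P W s"
  shows "Poly_Mapping.keys (contraction M s c) \<subseteq> tensor_gens P W (s - 1)"
proof -
  let ?g = "\<lambda>(p, x, y). if p = s then frag_cmul (if even p then 1 else -1) (frag_of (p, x, \<eta> M y)) else 0"
  have "Poly_Mapping.keys (?g u) \<subseteq> tensor_gens P W (s - 1)" if "u \<in> tensor_gens P W s" for u
  proof -
    obtain p x y where u: "u = (p, x, y)" by (cases u)
    show ?thesis
    proof (cases "p = s")
      case True
      then have "(p, x, \<eta> M y) \<in> tensor_gens P W (s - 1)"
        using that eta_closed[of y M] by (simp add: u tensor_gens_def)
      then show ?thesis using True by (simp add: u)
    qed (simp add: u)
  qed
  then show ?thesis
    unfolding contraction_def using assms by (intro order_trans[OF keys_frag_extend] UN_least) blast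
qed

lemma contraction_diff: "contraction M s (a - b) = contraction M s a - contraction M s b"
  by (simp add: contraction_def frag_extend_diff)

lemma contraction_rels:
  assumes "c \<in> tensor_rels n P W s"
  shows "contraction M s c \<in> tensor_rels n P W (s - 1)"
  unfolding contraction_def
proof (rule frag_extend_maps_rels[OF P W tensor_rels_zero[OF P W] _ _ _ _ assms])
  fix p :: int and x x' y y' and r :: "'k npoly set"
  let ?g = "\<lambda>(p, x, y). if p = s then frag_cmul (if even p then 1 else -1) (frag_of (p, x, \<eta> M y)) else 0"
  have sm: "frag_cmul k a - frag_cmul k b - frag_cmul k c = frag_cmul k (a - b - c)"
    "frag_cmul k a - frag_cmul k b = frag_cmul k (a - b)" for k and a b c :: "(int \<times> 'm \<times> 'l) \<Rightarrow>\<^sub>0 int"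
    by (rule poly_mapping_eqI; simp add: lookup_minus right_diff_distrib)+
  assume x: "x \<in> carrier (cobj P p)" and y: "y \<in> carrier (cobj W (s - p))"
  have ey: "p = s \<Longrightarrow> \<eta> M y \<in> carrier (cobj W (s - 1 - p))" using eta_closed[of y M] y by simp
  { assume x': "x' \<in> carrier (cobj P p)"
    show "?g (p, x \<oplus>\<^bsub>cobj P p\<^esub> x', y) - ?g (p, x, y) - ?g (p, x', y) \<in> tensor_rels n P W (s - 1)"
    proof (cases "p = s")
      case True
      then show ?thesis
        using tensor_rels_cmul[OF P W tensor_rels_left[OF P W x x' ey[OF True]], of "even p"]
        by (simp only: prod.case if_True simp_thms sm)
    qed (simp add: tensor_rels_zero[OF P W]) }
  { assume y': "y' \<in> carrier (cobj W (s - p))"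
    show "?g (p, x, y \<oplus>\<^bsub>cobj W (s - p)\<^esub> y') - ?g (p, x, y) - ?g (p, x, y') \<in> tensor_rels n P W (s - 1)"
    proof (cases "p = s")
      case True
      then have ey': "\<eta> M y' \<in> carrier (cobj W (s - 1 - p))" using eta_closed[of y' M] y' by simp
      have "\<eta> M (y \<oplus>\<^bsub>cobj W (s - p)\<^esub> y') = \<eta> M y \<oplus>\<^bsub>cobj W (s - 1 - p)\<^esub> \<eta> M y'"
        using True y y' eta_linear[of M] by (simp add: linear_map_def)
      then show ?thesis
        using True tensor_rels_cmul[OF P W tensor_rels_right[OF P W x ey[OF True] ey'], of "even p"]
        by (simp only: prod.case if_True simp_thms sm)
    qed (simp add: tensor_rels_zero[OF P W]) }
  { assume r: "r \<in> carrier (truncated_poly n)"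
    show "?g (p, r \<odot>\<^bsub>cobj P p\<^esub> x, y) - ?g (p, x, r \<odot>\<^bsub>cobj W (s - p)\<^esub> y) \<in> tensor_rels n P W (s - 1)"
    proof (cases "p = s")
      case True
      have "\<eta> M (r \<odot>\<^bsub>cobj W (s - p)\<^esub> y) = r \<odot>\<^bsub>cobj W (s - 1 - p)\<^esub> \<eta> M y"
        using True y r eta_linear[of M] by (simp add: linear_map_def)
      then show ?thesis
        using True tensor_rels_cmul[OF P W tensor_rels_balanced[OF P W r x ey[OF True]], of "even p"]
        by (simp only: prod.case if_True simp_thms sm)
    qed (simp add: tensor_rels_zero[OF P W]) }
qed (rule tensor_rels_diff[OF P W])

lemma phi_closed: "y \<in> carrier (cobj W 0) \<Longrightarrow> \<phi> M y \<in> carrier (truncated_poly n)"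
  using linear_functional_closed[OF P W phi_linear] .

text \<open>The identity minus \<open>D H + H D\<close> is \<open>x \<otimes> y \<mapsto> \<phi> M y \<cdot> x \<otimes> e M\<close>: up to homotopy a formal sum in the tensor
  product is a single element of \<open>P\<close>, placed at stage \<open>M\<close>. It suffices to compare both sides on
  generators. If \<open>y\<close> has degree 0, the claim is the decomposition of \<open>y\<close>. If \<open>y\<close> has degree \<open>-1\<close>, only
  \<open>\<eta> M (d y) = y\<close> contributes, and in all other degrees \<open>y = 0\<close>.\<close>

lemma contraction_homotopy:
  assumes "Poly_Mapping.keys c \<subseteq> good M s"
  shows "c - tensor_d P W (s - 1) (contraction M s c) - contraction M (s + 1) (tensor_d P W s c)
    - frag_of (s, tensor_contract P W (\<phi> M) s c, e M) \<in> tensor_rels n P W s"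
  using assms
proof (induction c rule: frag_diff_induct)
  let ?R = "tensor_rels n P W s" and ?h = "tensor_contract P W (\<phi> M) s"
  have eM: "e M \<in> carrier (cobj W (s - s))" using e_closed by simp
  case zero
  then show ?case
    using tensor_rels_minus[OF P W tensor_rels_zero_left[OF P W eM]]
    by (simp add: tensor_d_def contraction_def tensor_contract_zero[OF P W phi_linear])
next
  case (diff a b)
  let ?R = "tensor_rels n P W s" and ?h = "tensor_contract P W (\<phi> M) s"
  let ?T = "\<lambda>c. c - tensor_d P W (s - 1) (contraction M s c) - contraction M (s + 1) (tensor_d P W s c)"
  have eM: "e M \<in> carrier (cobj W (s - s))" using e_closed by simp
  have ha: "?h a \<in> carrier (cobj P s)" and hb: "?h b \<in> carrier (cobj P s)"
    using diff(1,2) good_subset[of M s] by (auto intro!: tensor_contract_closed[OF P W phi_linear])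
  interpret Ps: abelian_group "cobj P s" using is_complex_abelian_group[OF P] .
  have hab: "?h (a - b) = ?h a \<ominus>\<^bsub>cobj P s\<^esub> ?h b"
    using diff(1,2) good_subset[of M s] by (intro tensor_contract_diff[OF P W phi_linear]) auto
  have cancel: "(?h a \<ominus>\<^bsub>cobj P s\<^esub> ?h b) \<oplus>\<^bsub>cobj P s\<^esub> ?h b = ?h a"
    using ha hb by (simp add: Ps.minus_eq Ps.a_assoc Ps.l_neg)
  have 3: "frag_of (s, ?h a, e M) - frag_of (s, ?h (a - b), e M) - frag_of (s, ?h b, e M) \<in> ?R"
    using tensor_rels_left[OF P W Ps.minus_closed[OF ha hb] hb eM] by (simp add: hab cancel)
  have "?T (a - b) = ?T a - ?T b"
    by (simp add: tensor_d_diff[OF P W] contraction_diff algebra_simps)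
  then have "?T (a - b) - frag_of (s, ?h (a - b), e M) =
      ((?T a - frag_of (s, ?h a, e M)) - (?T b - frag_of (s, ?h b, e M))) +
      (frag_of (s, ?h a, e M) - frag_of (s, ?h (a - b), e M) - frag_of (s, ?h b, e M))"
    by simp
  then show ?case
    using tensor_rels_add[OF P W tensor_rels_diff[OF P W diff(3,4)] 3] by (simp only:)
next
  case (gen u)
  let ?R = "tensor_rels n P W s" and ?h = "tensor_contract P W (\<phi> M) s"
  have eM: "e M \<in> carrier (cobj W (s - s))" using e_closed by simp
  obtain p x y where u: "u = (p, x, y)" by (cases u)
  have x: "x \<in> carrier (cobj P p)" and y: "y \<in> carrier (cobj W (s - p))"
    using gen by (auto simp: u good_def)
  let ?s = "\<lambda>p :: int. if even p then 1 else -1 :: int"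
  have D: "tensor_d P W s (frag_of u) = frag_of (p + 1, cdiff P p x, y) +
      frag_cmul (?s p) (frag_of (p, x, cdiff W (s - p) y))"
    by (simp only: tensor_d_def frag_extend_of u prod.case)
  have C: "contraction M t (frag_of (q, v, w)) = (if q = t then frag_cmul (?s q) (frag_of (q, v, \<eta> M w)) else 0)"
    for t q v w by (simp only: contraction_def frag_extend_of prod.case)
  have Cadd: "contraction M t (v + frag_cmul k w) = contraction M t v + frag_cmul k (contraction M t w)" for t v w k
    by (simp add: contraction_def frag_extend_add frag_extend_cmul)
  have h: "?h (frag_of u) = (if p = s then \<phi> M y \<odot>\<^bsub>cobj P s\<^esub> x else \<zero>\<^bsub>cobj P s\<^esub>)"
    using tensor_contract_frag_of[OF P W phi_linear x y] by (simp add: u)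
  have sgn: "frag_cmul (?s q) (frag_cmul (?s q) a) = a" "frag_cmul (?s (q + 1)) a = - frag_cmul (?s q) a"
    for q and a :: "(int \<times> 'm \<times> 'l) \<Rightarrow>\<^sub>0 int"
    by (cases "even q"; simp)+
  consider "p = s" | "p = s + 1" | "p \<noteq> s" "p \<noteq> s + 1" by blast
  then show ?case
  proof cases
    case 1
    have x: "x \<in> carrier (cobj P s)" and y: "y \<in> carrier (cobj W 0)" using x y 1 by simp_all
    let ?b = "cdiff W (-1) (\<eta> M y)"
    have b: "?b \<in> carrier (cobj W 0)" using cdiff_closed[OF W eta_closed[OF y]] by simp
    have ye: "\<phi> M y \<odot>\<^bsub>cobj W 0\<^esub> e M \<oplus>\<^bsub>cobj W 0\<^esub> ?b = y" using gen 1 by (simp add: u good_def)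
    have DC: "tensor_d P W (s - 1) (contraction M s (frag_of u)) =
        frag_cmul (?s s) (frag_of (s + 1, cdiff P s x, \<eta> M y)) + frag_of (s, x, ?b)"
    proof -
      have "tensor_d P W (s - 1) (contraction M s (frag_of u)) =
        frag_cmul (?s s) (tensor_d P W (s - 1) (frag_of (s, x, \<eta> M y)))"
        by (simp only: u C 1 simp_thms if_True tensor_d_def frag_extend_cmul)
      also have "tensor_d P W (s - 1) (frag_of (s, x, \<eta> M y)) =
        frag_of (s + 1, cdiff P s x, \<eta> M y) + frag_cmul (?s s) (frag_of (s, x, ?b))"
        by (simp add: tensor_d_def)
      finally show ?thesis by (simp only: frag_cmul_distrib2 sgn)
    qed
    have CD: "contraction M (s + 1) (tensor_d P W s (frag_of u)) =
        - frag_cmul (?s s) (frag_of (s + 1, cdiff P s x, \<eta> M y))"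
      unfolding D Cadd C 1 by (simp only: sgn) simp
    have "frag_of (s, x, y) - frag_of (s, x, \<phi> M y \<odot>\<^bsub>cobj W 0\<^esub> e M) - frag_of (s, x, ?b) \<in> ?R"
      using tensor_rels_right[OF P W x, of "\<phi> M y \<odot>\<^bsub>cobj W 0\<^esub> e M" s ?b, unfolded diff_self]
        is_complex_smult_closed[OF W phi_closed[OF y] e_closed] b by (simp add: ye)
    moreover have "frag_of (s, \<phi> M y \<odot>\<^bsub>cobj P s\<^esub> x, e M) - frag_of (s, x, \<phi> M y \<odot>\<^bsub>cobj W 0\<^esub> e M) \<in> ?R"
      using tensor_rels_balanced[OF P W phi_closed[OF y] x eM] by simp
    ultimately have "(frag_of (s, x, y) - frag_of (s, x, \<phi> M y \<odot>\<^bsub>cobj W 0\<^esub> e M) - frag_of (s, x, ?b)) -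
       (frag_of (s, \<phi> M y \<odot>\<^bsub>cobj P s\<^esub> x, e M) - frag_of (s, x, \<phi> M y \<odot>\<^bsub>cobj W 0\<^esub> e M)) \<in> ?R"
      by (rule tensor_rels_diff[OF P W])
    then show ?thesis
      unfolding DC CD h by (simp add: u 1)
  next
    case 2
    have g: "\<phi> M (cdiff W (-1) y) = \<zero>\<^bsub>truncated_poly n\<^esub>" "\<eta> M (cdiff W (-1) y) = y"
      using gen 2 by (auto simp: u good_def)
    have "contraction M s (frag_of u) = 0" by (simp add: u C 2)
    moreover have "contraction M (s + 1) (tensor_d P W s (frag_of u)) = frag_of u"
      unfolding D Cadd C using 2 g by (simp add: u)
    ultimately show ?thesis
      using 2 h tensor_rels_minus[OF P W tensor_rels_zero_left[OF P W eM]] by (simp add: tensor_d_def)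
  next
    case 3
    then have "y = \<zero>\<^bsub>cobj W (s - p)\<^esub>" using concentrated[of "s - p"] y by auto
    then have "frag_of u \<in> ?R" using tensor_rels_zero_right[OF P W x] by (simp add: u)
    moreover have "contraction M s (frag_of u) = 0" by (simp add: u C 3)
    moreover have "contraction M (s + 1) (tensor_d P W s (frag_of u)) = 0"
      unfolding D Cadd C using 3 by simp
    ultimately show ?thesis
      using 3 h tensor_rels_diff[OF P W _ tensor_rels_zero_left[OF P W eM]] by (simp add: tensor_d_def)
  qed
qed

text \<open>Contraction with \<open>\<phi> M\<close> is a chain map on good sums, because \<open>\<phi> M\<close> vanishes on boundaries.\<close>

lemma tensor_contract_tensor_d:
  assumes "Poly_Mapping.keys c \<subseteq> good M s"
  shows "tensor_contract P W (\<phi> M) (s + 1) (tensor_d P W s c) = cdiff P s (tensor_contract P W (\<phi> M) s c)"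
  using assms
proof (induction c rule: frag_diff_induct)
  case zero
  then show ?case
    by (simp add: tensor_d_def tensor_contract_zero[OF P W phi_linear] cdiff_zero[OF P])
next
  case (diff a b)
  have k: "Poly_Mapping.keys a \<subseteq> tensor_gens P W s" "Poly_Mapping.keys b \<subseteq> tensor_gens P W s"
    using diff(1,2) good_subset by blast+
  note cl = tensor_contract_closed[OF P W phi_linear]
  show ?case
    using diff k
    by (simp add: tensor_d_diff[OF P W] tensor_contract_diff[OF P W phi_linear] tensor_d_keys[OF P W]
        graded_hom_minus[OF is_complex_graded_hom[OF P] is_complex_abelian_group[OF P] is_complex_abelian_group[OF P]] cl)
next
  case (gen u)
  let ?h = "tensor_contract P W (\<phi> M)"
  let ?s = "\<lambda>p :: int. if even p then 1 else -1 :: int"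
  obtain p x y where u: "u = (p, x, y)" by (cases u)
  have x: "x \<in> carrier (cobj P p)" and y: "y \<in> carrier (cobj W (s - p))"
    using gen by (auto simp: u good_def)
  have dx: "cdiff P p x \<in> carrier (cobj P (p + 1))" using cdiff_closed[OF P x] .
  have y2: "y \<in> carrier (cobj W (s + 1 - (p + 1)))" using y by simp
  have dy: "cdiff W (s - p) y \<in> carrier (cobj W (s + 1 - p))"
    using cdiff_closed[OF W y] by (simp only: diff_add_eq)
  interpret Ps: module "truncated_poly n" "cobj P (s + 1)" using is_complex_module[OF P] .
  have D: "tensor_d P W s (frag_of u) = frag_of (p + 1, cdiff P p x, y) +
      frag_cmul (?s p) (frag_of (p, x, cdiff W (s - p) y))"
    by (simp only: tensor_d_def frag_extend_of u prod.case)
  have g: "(p + 1, cdiff P p x, y) \<in> tensor_gens P W (s + 1)" "(p, x, cdiff W (s - p) y) \<in> tensor_gens P W (s + 1)"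
    using dx y2 x dy by (simp_all add: tensor_gens_def)
  have k: "Poly_Mapping.keys (frag_cmul (?s p) (frag_of (p, x, cdiff W (s - p) y))) \<subseteq> tensor_gens P W (s + 1)"
    using g(2) order_trans[OF keys_cmul] by fastforce
  have h2: "?h (s + 1) (frag_of (p, x, cdiff W (s - p) y)) = \<zero>\<^bsub>cobj P (s + 1)\<^esub>"
    unfolding tensor_contract_frag_of[OF P W phi_linear x dy]
    using gen x by (auto simp: u good_def)
  have h2': "?h (s + 1) (frag_cmul (?s p) (frag_of (p, x, cdiff W (s - p) y))) = \<zero>\<^bsub>cobj P (s + 1)\<^esub>"
    using h2 tensor_contract_minus[OF P W phi_linear, of "frag_of (p, x, cdiff W (s - p) y)" "s + 1"] g(2)
    by (cases "even p") simp_all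
  have "?h (s + 1) (tensor_d P W s (frag_of u)) = ?h (s + 1) (frag_of (p + 1, cdiff P p x, y))"
    unfolding D using tensor_contract_add[OF P W phi_linear _ k] g(1) h2'
      tensor_contract_closed[OF P W phi_linear, of "frag_of (p + 1, cdiff P p x, y)" "s + 1"] by simp
  also have "\<dots> = cdiff P s (?h s (frag_of u))"
    unfolding tensor_contract_frag_of[OF P W phi_linear dx y2] u tensor_contract_frag_of[OF P W phi_linear x y]
    using x y cdiff_smult[OF P phi_closed] by (auto simp: cdiff_zero[OF P])
  finally show ?case .
qed

lemma tensor_contract_shift:
  assumes "Poly_Mapping.keys c \<subseteq> good M s" "M \<le> N"
  shows "tensor_contract P W (\<phi> N) s c = Y M N \<odot>\<^bsub>cobj P s\<^esub> tensor_contract P W (\<phi> M) s c"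
  using assms(1)
proof (induction c rule: frag_diff_induct)
  interpret Ps: module "truncated_poly n" "cobj P s" using is_complex_module[OF P] .
  case zero
  then show ?case by (simp add: tensor_contract_zero[OF P W phi_linear] Y_closed)
next
  case (diff a b)
  interpret Ps: module "truncated_poly n" "cobj P s" using is_complex_module[OF P] .
  have k: "Poly_Mapping.keys a \<subseteq> tensor_gens P W s" "Poly_Mapping.keys b \<subseteq> tensor_gens P W s"
    using diff(1,2) good_subset by blast+
  show ?case
    using diff(3,4) k tensor_contract_closed[OF P W phi_linear] Y_closed
    by (simp add: tensor_contract_diff[OF P W phi_linear] Ps.minus_eq Ps.smult_r_distr Ps.smult_r_minus)
next
  case (gen u)
  interpret Ps: module "truncated_poly n" "cobj P s" using is_complex_module[OF P] .
  obtain p x y where u: "u = (p, x, y)" by (cases u)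
  have x: "x \<in> carrier (cobj P p)" and y: "y \<in> carrier (cobj W (s - p))"
    using gen by (auto simp: u good_def)
  show ?case
    unfolding u tensor_contract_frag_of[OF P W phi_linear x y]
    using gen x y assms(2) phi_closed Y_closed by (auto simp: u good_def Ps.smult_assoc1[symmetric])
qed

text \<open>Contraction at stage \<open>M\<close> turns a cocycle \<open>c\<close> of the tensor product into a cocycle \<open>z\<close> of \<open>P\<close>, and at a
  later stage \<open>N\<close> into \<open>Y M N \<cdot> z\<close>. If this is a coboundary \<open>d w\<close>, then the homotopy at stage \<open>N\<close>
  together with \<open>w \<otimes> e N\<close> bounds \<open>c\<close>. Conversely, contracting a formal sum that bounds \<open>z \<otimes> e m\<close>
  shows that \<open>Y m M \<cdot> z\<close> is a coboundary for large \<open>M\<close>.\<close>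

theorem acyclic_tensor_telescope_iff: "acyclic_complex (tensor_complex n P W) \<longleftrightarrow> killed_by Y P"
proof
  assume K: "killed_by Y P"
  show "acyclic_complex (tensor_complex n P W)"
    unfolding acyclic_tensor_complex_iff[OF P W]
  proof (intro allI impI, elim conjE)
    fix s c
    assume c: "Poly_Mapping.keys c \<subseteq> tensor_gens P W s" and Dc: "tensor_d P W s c \<in> tensor_rels n P W (s + 1)"
    obtain M where M: "\<And>N. N \<ge> M \<Longrightarrow> Poly_Mapping.keys c \<subseteq> good N s"
      using eventually_good[OF c] by (auto simp: eventually_sequentially)
    let ?z = "tensor_contract P W (\<phi> M) s c"
    have "?z \<in> cocycles P s"
      using tensor_contract_closed[OF P W phi_linear c] tensor_contract_tensor_d[OF M[OF order_refl]]
        tensor_contract_rels[OF P W phi_linear Dc]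
      by (simp add: cocycles_def)
    then obtain N where N: "N \<ge> M" "Y M N \<odot>\<^bsub>cobj P s\<^esub> ?z \<in> coboundaries P s"
      using K unfolding killed_by_def by blast
    then obtain w where w: "w \<in> carrier (cobj P (s - 1))" "tensor_contract P W (\<phi> N) s c = cdiff P (s - 1) w"
      unfolding tensor_contract_shift[OF M[OF order_refl] N(1), symmetric] by (auto simp: coboundaries_def)
    let ?b = "contraction N s c + frag_of (s - 1, w, e N)"
    have kb: "Poly_Mapping.keys ?b \<subseteq> tensor_gens P W (s - 1)"
      using contraction_keys[OF c, of N] w(1) e_closed[of N]
      by (intro order_trans[OF keys_add]) (auto simp: tensor_gens_def)
    have z: "cdiff W 0 (e N) = \<zero>\<^bsub>cobj W (s - (s - 1))\<^esub>"
      using cdiff_closed[OF W e_closed, of N] concentrated[of 1] by simp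
    have "tensor_d P W (s - 1) (frag_of (s - 1, w, e N)) =
        frag_of (s, cdiff P (s - 1) w, e N) +
        frag_cmul (if even (s - 1) then 1 else -1) (frag_of (s - 1, w, \<zero>\<^bsub>cobj W (s - (s - 1))\<^esub>))"
      by (simp only: tensor_d_def frag_extend_of prod.case z diff_self diff_add_cancel)
    then have "c - tensor_d P W (s - 1) ?b =
       (c - tensor_d P W (s - 1) (contraction N s c) - contraction N (s + 1) (tensor_d P W s c)
         - frag_of (s, tensor_contract P W (\<phi> N) s c, e N))
       + (contraction N (s + 1) (tensor_d P W s c)
       - frag_cmul (if even (s - 1) then 1 else -1) (frag_of (s - 1, w, \<zero>\<^bsub>cobj W (s - (s - 1))\<^esub>)))"
      unfolding w(2) by (simp add: tensor_d_def frag_extend_add algebra_simps)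
    also have "\<dots> \<in> tensor_rels n P W s"
      using contraction_rels[OF Dc, of N] 
      by (intro tensor_rels_add[OF P W] tensor_rels_diff[OF P W] tensor_rels_cmul[OF P W]
          contraction_homotopy M N(1) tensor_rels_zero_right[OF P W] w(1)) simp
    finally show "\<exists>b. Poly_Mapping.keys b \<subseteq> tensor_gens P W (s - 1) \<and>
        c - tensor_d P W (s - 1) b \<in> tensor_rels n P W s"
      using kb by blast
  qed
next
  assume A: "acyclic_complex (tensor_complex n P W)"
  show "killed_by Y P"
    unfolding killed_by_def
  proof (intro allI ballI)
    fix s z m
    assume "z \<in> cocycles P s"
    then have z: "z \<in> carrier (cobj P s)" "cdiff P s z = \<zero>\<^bsub>cobj P (s + 1)\<^esub>"
      by (auto simp: cocycles_def)
    have em: "e m \<in> carrier (cobj W (s - s))" using e_closed by simp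
    have em': "e m \<in> carrier (cobj W (s + 1 - (s + 1)))" using e_closed by simp
    let ?c = "frag_of (s, z, e m)"
    have kc: "Poly_Mapping.keys ?c \<subseteq> tensor_gens P W s" using z(1) em by (simp add: tensor_gens_def)
    have d: "cdiff W (s - s) (e m) = \<zero>\<^bsub>cobj W (s + 1 - s)\<^esub>"
      using cdiff_closed[OF W e_closed, of m] concentrated[of 1] by simp
    have "tensor_d P W s ?c = frag_of (s + 1, \<zero>\<^bsub>cobj P (s + 1)\<^esub>, e m) +
        frag_cmul (if even s then 1 else -1) (frag_of (s, z, \<zero>\<^bsub>cobj W (s + 1 - s)\<^esub>))"
      by (simp only: tensor_d_def frag_extend_of prod.case d z(2))
    then have "tensor_d P W s ?c \<in> tensor_rels n P W (s + 1)"
      using tensor_rels_add[OF P W tensor_rels_zero_left[OF P W em'] tensor_rels_cmul[OF P W tensor_rels_zero_right[OF P W z(1)]]]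
      by metis
    then obtain b where b: "Poly_Mapping.keys b \<subseteq> tensor_gens P W (s - 1)"
        "?c - tensor_d P W (s - 1) b \<in> tensor_rels n P W s"
      using A kc unfolding acyclic_tensor_complex_iff[OF P W] by blast
    obtain M where M: "M \<ge> m" "Poly_Mapping.keys b \<subseteq> good M (s - 1)"
      using eventually_happens'[OF _ eventually_conj[OF eventually_good[OF b(1)] eventually_ge_at_top[of m]]] by auto
    let ?h = "tensor_contract P W (\<phi> M)"
    have kd: "Poly_Mapping.keys (tensor_d P W (s - 1) b) \<subseteq> tensor_gens P W s"
      using tensor_d_keys[OF P W b(1)] by simp
    interpret Ps: abelian_group "cobj P s" using is_complex_abelian_group[OF P] .
    have "?h s ?c \<ominus>\<^bsub>cobj P s\<^esub> ?h s (tensor_d P W (s - 1) b) = \<zero>\<^bsub>cobj P s\<^esub>"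
      using tensor_contract_rels[OF P W phi_linear b(2)] tensor_contract_diff[OF P W phi_linear kc kd] by simp
    then have "?h s ?c = ?h s (tensor_d P W (s - 1) b)"
      using tensor_contract_closed[OF P W phi_linear kc] tensor_contract_closed[OF P W phi_linear kd]
        Ps.minus_equality[of "?h s ?c" "\<ominus>\<^bsub>cobj P s\<^esub> ?h s (tensor_d P W (s - 1) b)"]
      by (simp add: Ps.minus_eq)
    also have "\<dots> = cdiff P (s - 1) (?h (s - 1) b)"
      using tensor_contract_tensor_d[OF M(2)] by simp
    finally have "Y m M \<odot>\<^bsub>cobj P s\<^esub> z = cdiff P (s - 1) (?h (s - 1) b)"
      using tensor_contract_frag_of[OF P W phi_linear z(1) em] phi_e[OF M(1)] by simp
    then show "\<exists>M\<ge>m. Y m M \<odot>\<^bsub>cobj P s\<^esub> z \<in> coboundaries P s"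
      using M(1) coboundariesI[OF tensor_contract_closed[OF P W phi_linear b(1)]] by metis
  qed
qed

end


section \<open>Invariance under quasi-isomorphism\<close>

text \<open>The condition depends only on the cohomology as a module over the ring.\<close>

lemma killed_by_quasi_iso:
  fixes P :: "('k::field npoly set, 'm) cochain_complex" and V :: "('k npoly set, 'l) cochain_complex"
  assumes P: "is_complex n P" and V: "is_complex n V" and q: "quasi_iso n P V q"
    and Y: "\<And>m M. Y m M \<in> carrier (truncated_poly n)"
  shows "killed_by Y P \<longleftrightarrow> killed_by Y V"
proof -
  have qh: "q s \<in> graded_hom n (cobj P s) (cobj V s)" for s
    using q by (simp add: quasi_iso_def chain_map_def)
  have qd: "q (s + 1) (cdiff P s x) = cdiff V s (q s x)" if "x \<in> carrier (cobj P s)" for s x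
    using q that by (simp add: quasi_iso_def chain_map_def)
  have inj: "z \<in> coboundaries P s" if "z \<in> cocycles P s" "q s z \<in> coboundaries V s" for s z
    using q that by (simp add: quasi_iso_def)
  have surj: "\<exists>z\<in>cocycles P s. q s z \<ominus>\<^bsub>cobj V s\<^esub> w \<in> coboundaries V s" if "w \<in> cocycles V s" for s w
    using q that by (simp add: quasi_iso_def)
  have qB: "q s b \<in> coboundaries V s" if b: "b \<in> coboundaries P s" for s b
  proof -
    obtain x where x: "x \<in> carrier (cobj P (s - 1))" "b = cdiff P (s - 1) x"
      using b unfolding coboundaries_def by blast
    show ?thesis
      using qd[OF x(1)] graded_hom_closed[OF qh x(1)] by (simp add: x(2) coboundariesI)
  qed
  show ?thesis
  proof
    assume K: "killed_by Y P"
    show "killed_by Y V"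
      unfolding killed_by_def
    proof (intro allI ballI)
      fix s w m
      assume w: "w \<in> cocycles V s"
      then have wc: "w \<in> carrier (cobj V s)" by (simp add: cocycles_def)
      obtain z where z: "z \<in> cocycles P s" "q s z \<ominus>\<^bsub>cobj V s\<^esub> w \<in> coboundaries V s"
        using surj[OF w] by blast
      then have zc: "z \<in> carrier (cobj P s)" by (simp add: cocycles_def)
      obtain M where M: "M \<ge> m" "Y m M \<odot>\<^bsub>cobj P s\<^esub> z \<in> coboundaries P s"
        using K z(1) unfolding killed_by_def by blast
      interpret Vs: module "truncated_poly n" "cobj V s" using is_complex_module[OF V] .
      let ?r = "Y m M"
      have c: "q s z \<in> carrier (cobj V s)" using graded_hom_closed[OF qh zc] .
      have 1: "?r \<odot>\<^bsub>cobj V s\<^esub> q s z \<in> coboundaries V s"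
        using qB[OF M(2)] graded_hom_smult[OF qh Y zc] by simp
      have 2: "?r \<odot>\<^bsub>cobj V s\<^esub> (q s z \<ominus>\<^bsub>cobj V s\<^esub> w) \<in> coboundaries V s"
        using coboundaries_smult[OF V Y z(2)] .
      have 3: "\<ominus>\<^bsub>cobj V s\<^esub> (?r \<odot>\<^bsub>cobj V s\<^esub> (q s z \<ominus>\<^bsub>cobj V s\<^esub> w)) \<in> coboundaries V s"
        using subgroup.m_inv_closed[OF coboundaries_subgroup[OF V] 2] by (simp add: a_inv_def)
      have "?r \<odot>\<^bsub>cobj V s\<^esub> w = ?r \<odot>\<^bsub>cobj V s\<^esub> q s z \<oplus>\<^bsub>cobj V s\<^esub> \<ominus>\<^bsub>cobj V s\<^esub> (?r \<odot>\<^bsub>cobj V s\<^esub> (q s z \<ominus>\<^bsub>cobj V s\<^esub> w))"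
        using c wc Y by (simp add: Vs.minus_eq Vs.smult_r_distr Vs.smult_r_minus Vs.M.minus_add Vs.M.r_neg2)
      also have "\<dots> \<in> coboundaries V s"
        using subgroup.m_closed[OF coboundaries_subgroup[OF V] 1 3] by simp
      finally show "\<exists>M\<ge>m. Y m M \<odot>\<^bsub>cobj V s\<^esub> w \<in> coboundaries V s" using M(1) by blast
    qed
  next
    assume K: "killed_by Y V"
    show "killed_by Y P"
      unfolding killed_by_def
    proof (intro allI ballI)
      fix s z m
      assume "z \<in> cocycles P s"
      then have z: "z \<in> carrier (cobj P s)" "cdiff P s z = \<zero>\<^bsub>cobj P (s + 1)\<^esub>" by (simp_all add: cocycles_def)
      have "cdiff V s (q s z) = \<zero>\<^bsub>cobj V (s + 1)\<^esub>"
        using qd[OF z(1)] graded_hom_zero[OF qh is_complex_abelian_group[OF P] is_complex_abelian_group[OF V]] z(2)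
        by simp
      then have "q s z \<in> cocycles V s" using graded_hom_closed[OF qh z(1)] by (simp add: cocycles_def)
      then obtain M where M: "M \<ge> m" "Y m M \<odot>\<^bsub>cobj V s\<^esub> q s z \<in> coboundaries V s"
        using K unfolding killed_by_def by blast
      interpret Ps: module "truncated_poly n" "cobj P (s + 1)" using is_complex_module[OF P] .
      have "Y m M \<odot>\<^bsub>cobj P s\<^esub> z \<in> cocycles P s"
        using is_complex_smult_closed[OF P Y z(1)] cdiff_smult[OF P Y z(1)] z(2) Y by (simp add: cocycles_def)
      then have "Y m M \<odot>\<^bsub>cobj P s\<^esub> z \<in> coboundaries P s"
        using inj M(2) graded_hom_smult[OF qh Y z(1)] by simp
      then show "\<exists>M\<ge>m. Y m M \<odot>\<^bsub>cobj P s\<^esub> z \<in> coboundaries P s" using M(1) by blast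
    qed
  qed
qed

lemma quasi_iso_id:
  assumes "is_complex n V"
  shows "quasi_iso n V V (\<lambda>s x. x)"
proof -
  have "w \<ominus>\<^bsub>cobj V s\<^esub> w \<in> coboundaries V s" if "w \<in> cocycles V s" for w s
  proof -
    interpret abelian_group "cobj V s" using is_complex_abelian_group[OF assms] .
    have "w \<ominus>\<^bsub>cobj V s\<^esub> w = \<zero>\<^bsub>cobj V s\<^esub>" using that by (simp add: cocycles_def minus_eq r_neg)
    then show ?thesis using subgroup.one_closed[OF coboundaries_subgroup[OF assms]] by simp
  qed
  then show ?thesis by (auto simp: quasi_iso_def chain_map_def graded_hom_def)
qed


section \<open>The truncated polynomial algebra as a graded ring\<close>

text \<open>The ideal of relations is spanned by monomials, so membership can be read off from the exponents
  that occur. This makes it visible that the ideal is homogeneous and that a monomial with all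
  exponents below the bounds does not lie in it.\<close>

definition monomial_ideal :: "(nat \<Rightarrow> nat) \<Rightarrow> 'k::field npoly set" where
  "monomial_ideal n = {f. \<forall>m\<in>Poly_Mapping.keys f. \<exists>i. n (Suc i) \<le> Poly_Mapping.lookup m i}"

lemma poly_mapping_sum_singles:
  assumes "finite S" "Poly_Mapping.keys f \<subseteq> S"
  shows "(\<Sum>m\<in>S. Poly_Mapping.single m (Poly_Mapping.lookup f m)) = f"
proof (rule poly_mapping_eqI)
  fix k
  have "Poly_Mapping.lookup (\<Sum>m\<in>S. Poly_Mapping.single m (Poly_Mapping.lookup f m)) k =
      (\<Sum>m\<in>S. if m = k then Poly_Mapping.lookup f m else 0)"
    by (simp add: lookup_sum lookup_single when_def)
  also have "\<dots> = Poly_Mapping.lookup f k"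
    using assms by (auto simp: sum.delta' in_keys_iff)
  finally show "Poly_Mapping.lookup (\<Sum>m\<in>S. Poly_Mapping.single m (Poly_Mapping.lookup f m)) k = Poly_Mapping.lookup f k" .
qed

lemma xvar_power: "(xvar (Suc i) ^ k :: 'k::field npoly) = Poly_Mapping.single (Poly_Mapping.single i k) 1"
  by (induction k) (simp_all add: xvar_def mult_single flip: single_add)

lemma ring_of_type_algebra_simps [simp]:
  "carrier ring_of_type_algebra = UNIV" "monoid.mult ring_of_type_algebra = (*)" "add ring_of_type_algebra = (+)"
  "\<one>\<^bsub>ring_of_type_algebra\<^esub> = 1" "\<zero>\<^bsub>ring_of_type_algebra\<^esub> = 0"
  by (simp_all add: ring_of_type_algebra_def fun_eq_iff)

lemma a_inv_ring_of_type_algebra [simp]: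
  "\<ominus>\<^bsub>ring_of_type_algebra\<^esub> f = - f" for f :: "'a::comm_ring_1"
proof -
  interpret ring "ring_of_type_algebra :: 'a ring" by (rule ring_from_type_algebra)
  show ?thesis by (rule minus_equality) simp_all
qed

lemma monomial_ideal_zero: "0 \<in> monomial_ideal n"
  by (simp add: monomial_ideal_def)

lemma monomial_ideal_add: "f \<in> monomial_ideal n \<Longrightarrow> g \<in> monomial_ideal n \<Longrightarrow> f + g \<in> monomial_ideal n"
  using keys_add[of f g] by (auto simp: monomial_ideal_def)

lemma monomial_ideal_minus: "f \<in> monomial_ideal n \<Longrightarrow> - f \<in> monomial_ideal n"
  by (auto simp: monomial_ideal_def in_keys_iff)

lemma monomial_ideal_diff: "f \<in> monomial_ideal n \<Longrightarrow> g \<in> monomial_ideal n \<Longrightarrow> f - g \<in> monomial_ideal n"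
  using monomial_ideal_add[of f n "- g"] monomial_ideal_minus[of g n] by simp

lemma monomial_ideal_mult:
  assumes "f \<in> monomial_ideal n"
  shows "g * f \<in> monomial_ideal n"
  unfolding monomial_ideal_def
proof (intro CollectI ballI)
  fix m assume "m \<in> Poly_Mapping.keys (g * f)"
  then obtain a b where ab: "m = a + b" "b \<in> Poly_Mapping.keys f"
    using keys_mult[of g f] by blast
  then obtain i where "n (Suc i) \<le> Poly_Mapping.lookup b i"
    using assms by (auto simp: monomial_ideal_def)
  then show "\<exists>i. n (Suc i) \<le> Poly_Mapping.lookup m i" by (auto simp: ab lookup_add intro!: exI[of _ i])
qed

lemma ideal_monomial_ideal: "ideal (monomial_ideal n :: 'k::field npoly set) ring_of_type_algebra"
proof (rule idealI)
  show "ring (ring_of_type_algebra :: 'k npoly ring)" by (rule ring_from_type_algebra)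
  interpret ring "ring_of_type_algebra :: 'k npoly ring" by (rule ring_from_type_algebra)
  show "subgroup (monomial_ideal n :: 'k npoly set) (add_monoid ring_of_type_algebra)"
    by (rule add.subgroupI)
      (auto simp: monomial_ideal_add monomial_ideal_minus simp flip: a_inv_def intro: monomial_ideal_zero)
  show "x \<otimes>\<^bsub>ring_of_type_algebra\<^esub> a \<in> monomial_ideal n" "a \<otimes>\<^bsub>ring_of_type_algebra\<^esub> x \<in> monomial_ideal n"
    if "a \<in> monomial_ideal n" for a x :: "'k npoly"
    using monomial_ideal_mult[OF that, of x] by (simp_all add: mult.commute[of a x])
qed

text \<open>A monomial in which the exponent of \<open>x\<^sub>i\<close> reaches \<open>n\<^sub>i\<close> is a multiple of \<open>x\<^sub>i ^ n\<^sub>i\<close>.\<close>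

lemma single_in_ideal:
  assumes I: "ideal I (ring_of_type_algebra :: 'k::field npoly ring)"
    and gens: "\<And>i. i \<ge> 1 \<Longrightarrow> xvar i ^ n i \<in> I" and i: "n (Suc i) \<le> Poly_Mapping.lookup m i"
  shows "Poly_Mapping.single m c \<in> I"
proof -
  interpret ideal I ring_of_type_algebra by fact
  have "m = (m - Poly_Mapping.single i (n (Suc i))) + Poly_Mapping.single i (n (Suc i))"
    using i by (intro poly_mapping_eqI) (auto simp: lookup_add lookup_minus lookup_single when_def)
  then have "Poly_Mapping.single m c = Poly_Mapping.single (m - Poly_Mapping.single i (n (Suc i))) c * xvar (Suc i) ^ n (Suc i)"
    by (simp add: xvar_power mult_single)
  then show ?thesis using I_l_closed[OF gens[of "Suc i"]] by simp
qed

lemma Idl_eq_monomial_ideal: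
  "Idl\<^bsub>ring_of_type_algebra\<^esub> {xvar i ^ n i | i. i \<ge> 1} = (monomial_ideal n :: 'k::field npoly set)"
proof
  interpret ring "ring_of_type_algebra :: 'k npoly ring" by (rule ring_from_type_algebra)
  let ?G = "{xvar i ^ n i | i. i \<ge> 1} :: 'k npoly set"
  have "?G \<subseteq> monomial_ideal n"
  proof
    fix f :: "'k npoly" assume "f \<in> ?G"
    then obtain i where "f = xvar i ^ n i" "i \<ge> 1" by blast
    then obtain j where "f = xvar (Suc j) ^ n (Suc j)" by (cases i) auto
    then show "f \<in> monomial_ideal n" by (auto simp: xvar_power monomial_ideal_def intro!: exI[of _ j])
  qed
  then show "Idl\<^bsub>ring_of_type_algebra\<^esub> ?G \<subseteq> monomial_ideal n"
    by (rule genideal_minimal[OF ideal_monomial_ideal])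
  have I: "ideal (Idl\<^bsub>ring_of_type_algebra\<^esub> ?G) ring_of_type_algebra" by (rule genideal_ideal) simp
  interpret I: ideal "Idl\<^bsub>ring_of_type_algebra\<^esub> ?G" "ring_of_type_algebra :: 'k npoly ring" by fact
  have gens: "xvar i ^ n i \<in> Idl\<^bsub>ring_of_type_algebra\<^esub> ?G" if "i \<ge> 1" for i
    using genideal_self[of ?G] that by (auto simp: subset_iff)
  show "monomial_ideal n \<subseteq> Idl\<^bsub>ring_of_type_algebra\<^esub> ?G"
  proof
    fix f :: "'k npoly" assume f: "f \<in> monomial_ideal n"
    have "(\<Sum>m\<in>S. Poly_Mapping.single m (Poly_Mapping.lookup f m)) \<in> Idl\<^bsub>ring_of_type_algebra\<^esub> ?G"
      if "finite S" "S \<subseteq> Poly_Mapping.keys f" for S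
      using that
    proof (induction S rule: finite_induct)
      case empty
      then show ?case using I.zero_closed by simp
    next
      case (insert m S)
      then obtain i where "n (Suc i) \<le> Poly_Mapping.lookup m i" using f by (auto simp: monomial_ideal_def)
      then show ?case
        using insert I.a_closed[OF single_in_ideal[OF I gens]] by simp
    qed
    from this[OF finite_keys order_refl] show "f \<in> Idl\<^bsub>ring_of_type_algebra\<^esub> ?G"
      by (simp add: poly_mapping_sum_singles)
  qed
qed

definition poly_class :: "(nat \<Rightarrow> nat) \<Rightarrow> 'k::field npoly \<Rightarrow> 'k npoly set" where
  "poly_class n f = {g. g - f \<in> monomial_ideal n}"

lemma a_r_coset_monomial_ideal: "monomial_ideal n +>\<^bsub>ring_of_type_algebra\<^esub> f = poly_class n f"
proof -
  have "g \<in> (\<Union>h\<in>monomial_ideal n. {h + f})" if "g - f \<in> monomial_ideal n" for g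
    using that by (auto intro!: bexI[OF _ that])
  then show ?thesis by (auto simp: a_r_coset_def r_coset_def poly_class_def)
qed

lemma poly_class_eq_iff: "poly_class n f = poly_class n g \<longleftrightarrow> f - g \<in> monomial_ideal n"
proof
  assume "poly_class n f = poly_class n g"
  moreover have "f \<in> poly_class n f" by (simp add: poly_class_def monomial_ideal_zero)
  ultimately show "f - g \<in> monomial_ideal n" by (auto simp: poly_class_def)
next
  assume fg: "f - g \<in> monomial_ideal n"
  have "h - f \<in> monomial_ideal n \<longleftrightarrow> h - g \<in> monomial_ideal n" for h
    using monomial_ideal_add[OF _ fg, of "h - f"] monomial_ideal_diff[OF _ fg, of "h - g"] by auto
  then show "poly_class n f = poly_class n g" by (simp add: poly_class_def)
qed

lemma truncated_poly_eq: "truncated_poly n = ring_of_type_algebra Quot monomial_ideal n"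
  unfolding truncated_poly_def Idl_eq_monomial_ideal ..

lemma cring_truncated_poly: "cring (truncated_poly n :: 'k::field npoly set ring)"
  unfolding truncated_poly_eq
  by (rule ideal.quotient_is_cring[OF ideal_monomial_ideal cring_from_type_algebra])

lemma carrier_truncated_poly: "carrier (truncated_poly n) = range (poly_class n)"
  unfolding truncated_poly_eq FactRing_def A_RCOSETS_def' by (auto simp: a_r_coset_monomial_ideal)

lemma poly_class_in_carrier [simp]: "poly_class n f \<in> carrier (truncated_poly n)"
  by (simp add: carrier_truncated_poly)

lemma truncated_poly_add [simp]: "poly_class n f \<oplus>\<^bsub>truncated_poly n\<^esub> poly_class n g = poly_class n (f + g)"
  using ring_hom_add[OF ideal.rcos_ring_hom[OF ideal_monomial_ideal[of n]], of f g]
  by (simp add: truncated_poly_eq a_r_coset_monomial_ideal)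

lemma truncated_poly_mult [simp]: "poly_class n f \<otimes>\<^bsub>truncated_poly n\<^esub> poly_class n g = poly_class n (f * g)"
  using ring_hom_mult[OF ideal.rcos_ring_hom[OF ideal_monomial_ideal[of n]], of f g]
  by (simp add: truncated_poly_eq a_r_coset_monomial_ideal)

lemma truncated_poly_one: "\<one>\<^bsub>truncated_poly n\<^esub> = poly_class n 1"
  using ring_hom_one[OF ideal.rcos_ring_hom[OF ideal_monomial_ideal[of n]], symmetric]
  by (simp only: truncated_poly_eq a_r_coset_monomial_ideal ring_of_type_algebra_simps)

lemma truncated_poly_zero: "\<zero>\<^bsub>truncated_poly n\<^esub> = poly_class n 0"
  using a_r_coset_monomial_ideal[of n 0]
  by (simp add: truncated_poly_eq FactRing_def a_r_coset_def r_coset_def)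

lemma truncated_poly_finsum:
  assumes "finite S"
  shows "finsum (truncated_poly n) (\<lambda>j. poly_class n (g j)) S = poly_class n (\<Sum>j\<in>S. g j)"
proof -
  interpret cring "truncated_poly n" by (rule cring_truncated_poly)
  show ?thesis using assms by (induction S rule: finite_induct) (simp_all add: truncated_poly_zero)
qed

definition homogeneous_part :: "int \<Rightarrow> 'k::field npoly \<Rightarrow> 'k npoly" where
  "homogeneous_part j f =
    (\<Sum>m\<in>{m\<in>Poly_Mapping.keys f. int (monom_degree m) = j}. Poly_Mapping.single m (Poly_Mapping.lookup f m))"

lemma lookup_homogeneous_part:
  "Poly_Mapping.lookup (homogeneous_part j f) m = (if int (monom_degree m) = j then Poly_Mapping.lookup f m else 0)"
  unfolding homogeneous_part_def
  by (simp add: lookup_sum lookup_single when_def sum.delta' in_keys_iff)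

lemma keys_homogeneous_part:
  "Poly_Mapping.keys (homogeneous_part j f) = {m\<in>Poly_Mapping.keys f. int (monom_degree m) = j}"
  by (auto simp: in_keys_iff lookup_homogeneous_part split: if_splits)

lemma homogeneous_part_add: "homogeneous_part j (f + g) = homogeneous_part j f + homogeneous_part j g"
  by (rule poly_mapping_eqI) (simp add: lookup_homogeneous_part lookup_add)

lemma homogeneous_part_diff: "homogeneous_part j (f - g) = homogeneous_part j f - homogeneous_part j g"
  by (rule poly_mapping_eqI) (simp add: lookup_homogeneous_part lookup_minus)

lemma homogeneous_part_monomial_ideal: "f \<in> monomial_ideal n \<Longrightarrow> homogeneous_part j f \<in> monomial_ideal n"
  by (auto simp: monomial_ideal_def keys_homogeneous_part)

lemma sum_homogeneous_part:
  "(\<Sum>j\<in>(\<lambda>m. int (monom_degree m)) ` Poly_Mapping.keys f. homogeneous_part j f) = f"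
proof (rule poly_mapping_eqI)
  fix m
  show "Poly_Mapping.lookup (\<Sum>j\<in>(\<lambda>m. int (monom_degree m)) ` Poly_Mapping.keys f. homogeneous_part j f) m
      = Poly_Mapping.lookup f m"
    by (auto simp: lookup_sum lookup_homogeneous_part sum.delta' in_keys_iff)
qed

text \<open>
  The projection of the ring onto its homogeneous piece of degree \<open>j\<close>. It is independent of the
  chosen representative because the ideal is homogeneous.
\<close>

definition component :: "(nat \<Rightarrow> nat) \<Rightarrow> int \<Rightarrow> 'k::field npoly set \<Rightarrow> 'k npoly set" where
  "component n j r = poly_class n (homogeneous_part j (SOME f. r = poly_class n f))"

lemma component_poly_class: "component n j (poly_class n f) = poly_class n (homogeneous_part j f)"
proof -
  have "poly_class n f = poly_class n (SOME g. poly_class n f = poly_class n g)" by (rule someI) (rule refl)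
  then have "homogeneous_part j (f - (SOME g. poly_class n f = poly_class n g)) \<in> monomial_ideal n"
    unfolding poly_class_eq_iff by (rule homogeneous_part_monomial_ideal)
  then show ?thesis by (simp add: component_def poly_class_eq_iff homogeneous_part_diff monomial_ideal_minus[of "_ - _", simplified])
qed

lemma truncated_poly_piece_eq:
  "truncated_poly_piece n j = {poly_class n f | f. \<forall>m\<in>Poly_Mapping.keys f. int (monom_degree m) = j}"
  unfolding truncated_poly_piece_def Idl_eq_monomial_ideal a_r_coset_monomial_ideal ..

lemma truncated_poly_cases:
  assumes "r \<in> carrier (truncated_poly n)"
  obtains f where "r = poly_class n f"
  using assms by (auto simp: carrier_truncated_poly)

lemma component_in_piece: "r \<in> carrier (truncated_poly n) \<Longrightarrow> component n j r \<in> truncated_poly_piece n j"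
  by (auto elim!: truncated_poly_cases simp: component_poly_class truncated_poly_piece_eq keys_homogeneous_part)

lemma piece_subset_carrier: "truncated_poly_piece n j \<subseteq> carrier (truncated_poly n)"
  by (auto simp: truncated_poly_piece_eq)

lemma component_closed: "r \<in> carrier (truncated_poly n) \<Longrightarrow> component n j r \<in> carrier (truncated_poly n)"
  using component_in_piece piece_subset_carrier by blast

lemma component_add:
  "\<lbrakk>r \<in> carrier (truncated_poly n); r' \<in> carrier (truncated_poly n)\<rbrakk> \<Longrightarrow>
    component n j (r \<oplus>\<^bsub>truncated_poly n\<^esub> r') = component n j r \<oplus>\<^bsub>truncated_poly n\<^esub> component n j r'"
  by (auto elim!: truncated_poly_cases simp: component_poly_class homogeneous_part_add)

lemma component_zero: "component n j \<zero>\<^bsub>truncated_poly n\<^esub> = \<zero>\<^bsub>truncated_poly n\<^esub>"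
  by (simp add: truncated_poly_zero component_poly_class homogeneous_part_def)

lemma component_piece:
  assumes "r \<in> truncated_poly_piece n i"
  shows "component n j r = (if i = j then r else \<zero>\<^bsub>truncated_poly n\<^esub>)"
proof -
  obtain f where f: "r = poly_class n f" "\<forall>m\<in>Poly_Mapping.keys f. int (monom_degree m) = i"
    using assms by (auto simp: truncated_poly_piece_eq)
  then have "homogeneous_part j f = (if i = j then f else 0)"
    by (intro poly_mapping_eqI) (auto simp: lookup_homogeneous_part in_keys_iff)
  then show ?thesis by (simp add: f(1) component_poly_class truncated_poly_zero)
qed

lemma component_finite:
  assumes "r \<in> carrier (truncated_poly n)"
  shows "finite {j. component n j r \<noteq> \<zero>\<^bsub>truncated_poly n\<^esub>}"
proof -
  obtain f where f: "r = poly_class n f" using assms by (rule truncated_poly_cases)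
  have "{j. component n j r \<noteq> \<zero>\<^bsub>truncated_poly n\<^esub>} \<subseteq> (\<lambda>m. int (monom_degree m)) ` Poly_Mapping.keys f"
  proof
    fix j assume "j \<in> {j. component n j r \<noteq> \<zero>\<^bsub>truncated_poly n\<^esub>}"
    then have "homogeneous_part j f \<noteq> 0" by (auto simp: f component_poly_class truncated_poly_zero)
    then have "Poly_Mapping.keys (homogeneous_part j f) \<noteq> {}" by simp
    then show "j \<in> (\<lambda>m. int (monom_degree m)) ` Poly_Mapping.keys f" by (auto simp: keys_homogeneous_part)
  qed
  then show ?thesis by (rule finite_subset) simp
qed

lemma component_sum:
  assumes "r \<in> carrier (truncated_poly n)" "finite S" "{j. component n j r \<noteq> \<zero>\<^bsub>truncated_poly n\<^esub>} \<subseteq> S"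
  shows "finsum (truncated_poly n) (\<lambda>j. component n j r) S = r"
proof -
  interpret cring "truncated_poly n" by (rule cring_truncated_poly)
  obtain f where f: "r = poly_class n f" using assms(1) by (rule truncated_poly_cases)
  let ?J = "(\<lambda>m. int (monom_degree m)) ` Poly_Mapping.keys f"
  have "finsum (truncated_poly n) (\<lambda>j. component n j r) S = finsum (truncated_poly n) (\<lambda>j. component n j r) (S \<union> ?J)"
    using assms(2,3) by (intro add.finprod_mono_neutral_cong_left) (auto simp: f component_poly_class)
  also have "\<dots> = poly_class n (\<Sum>j\<in>S \<union> ?J. homogeneous_part j f)"
    using assms(2) by (simp add: f component_poly_class truncated_poly_finsum)
  also have "(\<Sum>j\<in>S \<union> ?J. homogeneous_part j f) = (\<Sum>j\<in>?J. homogeneous_part j f)"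
    using assms(2)
  proof (intro sum.mono_neutral_right ballI)
    fix j assume "j \<in> S \<union> ?J - ?J"
    then have "Poly_Mapping.keys (homogeneous_part j f) = {}" by (auto simp: keys_homogeneous_part)
    then show "homogeneous_part j f = 0" by simp
  qed auto
  finally show ?thesis by (simp add: f sum_homogeneous_part)
qed

lemma monom_degree_superset:
  assumes "finite S" "Poly_Mapping.keys m \<subseteq> S"
  shows "monom_degree m = (\<Sum>v\<in>S. Poly_Mapping.lookup m v * 2 ^ (v + 1))"
  unfolding monom_degree_def using assms by (intro sum.mono_neutral_left) (auto simp: in_keys_iff)

lemma monom_degree_add: "monom_degree (a + b) = monom_degree a + monom_degree b"
proof -
  let ?S = "Poly_Mapping.keys a \<union> Poly_Mapping.keys b"
  show ?thesis
    using monom_degree_superset[of ?S "a + b"] monom_degree_superset[of ?S a] monom_degree_superset[of ?S b] keys_add[of a b]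
    by (simp add: lookup_add distrib_right sum.distrib)
qed

lemma piece_mult:
  assumes "r \<in> truncated_poly_piece n i" "r' \<in> truncated_poly_piece n j"
  shows "r \<otimes>\<^bsub>truncated_poly n\<^esub> r' \<in> truncated_poly_piece n (i + j)"
proof -
  obtain f g where "r = poly_class n f" "\<forall>m\<in>Poly_Mapping.keys f. int (monom_degree m) = i"
    "r' = poly_class n g" "\<forall>m\<in>Poly_Mapping.keys g. int (monom_degree m) = j"
    using assms by (auto simp: truncated_poly_piece_eq)
  then show ?thesis
    using keys_mult[of f g] by (fastforce simp: truncated_poly_piece_eq monom_degree_add intro!: exI[of _ "f * g"])
qed

lemma piece_subgroup: "subgroup (truncated_poly_piece n j :: 'k::field npoly set set) (add_monoid (truncated_poly n))"
proof -
  interpret cring "truncated_poly n :: 'k npoly set ring" by (rule cring_truncated_poly)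
  let ?p = "component n j :: 'k npoly set \<Rightarrow> 'k npoly set"
  have "group_hom (add_monoid (truncated_poly n)) (add_monoid (truncated_poly n)) ?p"
    by unfold_locales (auto simp: hom_def component_add component_closed)
  then have "subgroup (?p ` carrier (add_monoid (truncated_poly n))) (add_monoid (truncated_poly n))"
    by (rule group_hom.img_is_subgroup)
  moreover have "?p ` carrier (add_monoid (truncated_poly n)) = truncated_poly_piece n j"
  proof
    show "?p ` carrier (add_monoid (truncated_poly n)) \<subseteq> truncated_poly_piece n j"
      using component_in_piece by auto
    show "truncated_poly_piece n j \<subseteq> ?p ` carrier (add_monoid (truncated_poly n))"
    proof
      fix r :: "'k npoly set" assume r: "r \<in> truncated_poly_piece n j"
      then have "r = ?p r" using component_piece[OF r, of j] by simp
      moreover have "r \<in> carrier (add_monoid (truncated_poly n))" using r piece_subset_carrier by auto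
      ultimately show "r \<in> ?p ` carrier (add_monoid (truncated_poly n))" by (rule image_eqI)
    qed
  qed
  ultimately show ?thesis by (simp only:)
qed


section \<open>Products of top powers of the variables\<close>

text \<open>The element \<open>x\<^sub>i ^ (n\<^sub>i - 1)\<close> spans the socle of \<open>k[x\<^sub>i] / (x\<^sub>i ^ n\<^sub>i)\<close>. The variable \<open>x\<^sub>i\<close> belongs to
  the position \<open>i - 1\<close>, hence the successor.\<close>

definition socle_exponent :: "(nat \<Rightarrow> nat) \<Rightarrow> nat set \<Rightarrow> nat \<Rightarrow> nat" where
  "socle_exponent n B j = (if j \<in> B then n (Suc j) - 1 else 0)"

definition socle_poly :: "(nat \<Rightarrow> nat) \<Rightarrow> nat set \<Rightarrow> nat \<Rightarrow> nat \<Rightarrow> 'k::field npoly" where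
  "socle_poly n B m M = (\<Prod>j\<in>{m..<M}. xvar (Suc j) ^ socle_exponent n B j)"

lemma socle_poly_eq_single:
  "(socle_poly n B m M :: 'a::field npoly) =
    Poly_Mapping.single (\<Sum>j\<in>{m..<M}. Poly_Mapping.single j (socle_exponent n B j)) 1"
proof -
  have "(\<Prod>j\<in>S. xvar (Suc j) ^ k j :: 'a npoly) = Poly_Mapping.single (\<Sum>j\<in>S. Poly_Mapping.single j (k j)) 1"
    if "finite S" for S and k :: "nat \<Rightarrow> nat"
    using that by (induction S rule: finite_induct) (simp_all add: xvar_power mult_single)
  then show ?thesis by (simp add: socle_poly_def)
qed

abbreviation socle_monomial :: "(nat \<Rightarrow> nat) \<Rightarrow> nat set \<Rightarrow> nat \<Rightarrow> nat \<Rightarrow> 'k::field npoly set" where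
  "socle_monomial n B m M \<equiv> poly_class n (socle_poly n B m M)"

lemma socle_poly_refl: "socle_poly n B m m = 1"
  by (simp add: socle_poly_def)

lemma socle_poly_trans: "m \<le> M \<Longrightarrow> M \<le> N \<Longrightarrow> socle_poly n B m M * socle_poly n B M N = socle_poly n B m N"
  unfolding socle_poly_def by (rule prod.atLeastLessThan_concat)

text \<open>The product contains the square of the socle element of \<open>x\<^sub>j\<^sub>+\<^sub>1\<close>, whose exponent \<open>2 (n\<^sub>j\<^sub>+\<^sub>1 - 1)\<close> is
  at least \<open>n\<^sub>j\<^sub>+\<^sub>1\<close> because \<open>n\<^sub>j\<^sub>+\<^sub>1 \<ge> 2\<close>.\<close>

lemma socle_monomial_mult_eq_zero:
  assumes n: "\<And>i. i \<ge> 1 \<Longrightarrow> n i \<ge> 2" and j: "j \<in> B" "j \<in> C" "m \<le> j" "j < M" "m' \<le> j" "j < M'"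
  shows "socle_monomial n B m M \<otimes>\<^bsub>truncated_poly n\<^esub> socle_monomial n C m' M' = \<zero>\<^bsub>truncated_poly n\<^esub>"
proof -
  have look: "Poly_Mapping.lookup (\<Sum>j\<in>{m..<M}. Poly_Mapping.single j (socle_exponent n B j)) i
      = (if i \<in> {m..<M} then socle_exponent n B i else 0)" for m M B i
    by (simp add: lookup_sum lookup_single when_def sum.delta')
  have "n (Suc j) \<le> (n (Suc j) - 1) + (n (Suc j) - 1)" using n[of "Suc j"] by simp
  then have "socle_poly n B m M * socle_poly n C m' M' \<in> monomial_ideal n"
    using j by (auto simp: socle_poly_eq_single mult_single monomial_ideal_def lookup_add look intro!: exI[of _ j])
      (simp add: socle_exponent_def)
  then show ?thesis by (simp add: truncated_poly_zero poly_class_eq_iff)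
qed

text \<open>No variable occurs in both factors, so every exponent stays below its bound.\<close>

lemma socle_monomial_mult_neq_zero:
  assumes n: "\<And>i. i \<ge> 1 \<Longrightarrow> n i \<ge> 2" and BC: "B \<inter> C = {}"
  shows "socle_monomial n B m M \<otimes>\<^bsub>truncated_poly n\<^esub> socle_monomial n C m' M' \<noteq> \<zero>\<^bsub>truncated_poly n\<^esub>"
proof -
  have look: "Poly_Mapping.lookup (\<Sum>j\<in>{m..<M}. Poly_Mapping.single j (socle_exponent n B j)) i
      = (if i \<in> {m..<M} then socle_exponent n B i else 0)" for m M B i
    by (simp add: lookup_sum lookup_single when_def sum.delta')
  have "socle_exponent n B i + socle_exponent n C i < n (Suc i)" for i
    using n[of "Suc i"] BC by (auto simp: socle_exponent_def)
  note lt = this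
  have "\<not> n (Suc i) \<le> (if P then socle_exponent n B i else 0) + (if Q then socle_exponent n C i else 0)" for i P Q
    using lt[of i] by (cases P; cases Q) simp_all
  then have "socle_poly n B m M * socle_poly n C m' M' \<notin> (monomial_ideal n :: 'a npoly set)"
    by (simp add: socle_poly_eq_single mult_single monomial_ideal_def lookup_add look)
  then show ?thesis by (simp add: truncated_poly_zero poly_class_eq_iff)
qed

lemma socle_poly_Suc: "socle_poly n B m (Suc m) = xvar (Suc m) ^ socle_exponent n B m"
  by (simp add: socle_poly_def)

lemma monom_degree_single: "monom_degree (Poly_Mapping.single i k) = k * 2 ^ (i + 1)"
  by (simp add: monom_degree_def)

lemma socle_monomial_Suc_in_piece:
  "socle_monomial n B m (Suc m) \<in> truncated_poly_piece n (int (socle_exponent n B m * 2 ^ (m + 1)))"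
  by (auto simp: truncated_poly_piece_eq socle_poly_Suc xvar_power monom_degree_single
      intro!: exI[of _ "xvar (Suc m) ^ socle_exponent n B m"])


section \<open>Free graded modules\<close>

text \<open>The free module on \<open>J\<close>, as finitely supported coordinate functions.\<close>

definition vectors :: "(nat \<Rightarrow> nat) \<Rightarrow> 'b set \<Rightarrow> ('b \<Rightarrow> 'k::field npoly set) set" where
  "vectors n J = {v. (\<forall>b. v b \<in> carrier (truncated_poly n)) \<and>
     finite {b. v b \<noteq> \<zero>\<^bsub>truncated_poly n\<^esub>} \<and> {b. v b \<noteq> \<zero>\<^bsub>truncated_poly n\<^esub>} \<subseteq> J}"

text \<open>The injection \<open>\<iota>\<close> moves the carriers into the given universe, and \<open>\<delta> b\<close> is the degree of the basis
  vector \<open>b\<close>. The bound on \<open>n\<close> makes the ring nontrivial, so that basis vectors with different indices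
  are different.\<close>

locale free_modules =
  fixes n :: "nat \<Rightarrow> nat" and \<iota> :: "('b \<Rightarrow> 'k::field npoly set) \<Rightarrow> 'u" and \<delta> :: "'b \<Rightarrow> int"
  assumes inj: "inj_on \<iota> (vectors n UNIV)"
    and n_pos: "\<And>i. i \<ge> 1 \<Longrightarrow> n i \<ge> 2"
begin

abbreviation \<Lambda> :: "'k npoly set ring" where "\<Lambda> \<equiv> truncated_poly n"

interpretation L: cring "\<Lambda>" by (rule cring_truncated_poly)

definition \<kappa> :: "'u \<Rightarrow> 'b \<Rightarrow> 'k npoly set" where
  "\<kappa> = inv_into (vectors n UNIV) \<iota>"

definition free_module :: "'b set \<Rightarrow> ('k npoly set, 'u) graded_module" where
  "free_module J = \<lparr>carrier = \<iota> ` vectors n J, monoid.mult = undefined, one = undefined,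
     ring.zero = \<iota> (\<lambda>b. \<zero>\<^bsub>\<Lambda>\<^esub>), add = (\<lambda>x y. \<iota> (\<lambda>b. \<kappa> x b \<oplus>\<^bsub>\<Lambda>\<^esub> \<kappa> y b)),
     module.smult = (\<lambda>r x. \<iota> (\<lambda>b. r \<otimes>\<^bsub>\<Lambda>\<^esub> \<kappa> x b)),
     piece = (\<lambda>j. \<iota> ` {v \<in> vectors n J. \<forall>b. v b \<in> truncated_poly_piece n (j - \<delta> b)})\<rparr>"

lemma vectors_mono: "v \<in> vectors n J \<Longrightarrow> v \<in> vectors n UNIV"
  by (auto simp: vectors_def)

lemma kappa_iota: "v \<in> vectors n J \<Longrightarrow> \<kappa> (\<iota> v) = v"
  unfolding \<kappa>_def by (rule inv_into_f_f[OF inj vectors_mono])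

lemma iota_eq_iff: "v \<in> vectors n J \<Longrightarrow> w \<in> vectors n J' \<Longrightarrow> \<iota> v = \<iota> w \<longleftrightarrow> v = w"
  by (metis kappa_iota)

lemma vectors_zero [simp]: "(\<lambda>b. \<zero>\<^bsub>\<Lambda>\<^esub>) \<in> vectors n J"
  by (simp add: vectors_def)

lemma vectors_closed: "v \<in> vectors n J \<Longrightarrow> v b \<in> carrier \<Lambda>"
  by (simp add: vectors_def)

lemma vectors_finite: "v \<in> vectors n J \<Longrightarrow> finite {b. v b \<noteq> \<zero>\<^bsub>\<Lambda>\<^esub>}"
  by (simp add: vectors_def)

lemma vectors_support: "v \<in> vectors n J \<Longrightarrow> v b \<noteq> \<zero>\<^bsub>\<Lambda>\<^esub> \<Longrightarrow> b \<in> J"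
  by (auto simp: vectors_def)

lemma vectorsI:
  assumes "\<And>b. v b \<in> carrier \<Lambda>" "finite S" "\<And>b. v b \<noteq> \<zero>\<^bsub>\<Lambda>\<^esub> \<Longrightarrow> b \<in> S \<and> b \<in> J"
  shows "v \<in> vectors n J"
proof -
  have "{b. v b \<noteq> \<zero>\<^bsub>\<Lambda>\<^esub>} \<subseteq> S" "{b. v b \<noteq> \<zero>\<^bsub>\<Lambda>\<^esub>} \<subseteq> J" using assms(3) by blast+
  then show ?thesis using assms(1) finite_subset[OF _ assms(2)] by (simp add: vectors_def)
qed

lemma vectors_add [simp]:
  assumes "v \<in> vectors n J" "w \<in> vectors n J"
  shows "(\<lambda>b. v b \<oplus>\<^bsub>\<Lambda>\<^esub> w b) \<in> vectors n J"
proof -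
  have "v b \<noteq> \<zero>\<^bsub>\<Lambda>\<^esub> \<or> w b \<noteq> \<zero>\<^bsub>\<Lambda>\<^esub>" if "v b \<oplus>\<^bsub>\<Lambda>\<^esub> w b \<noteq> \<zero>\<^bsub>\<Lambda>\<^esub>" for b using that by auto
  then show ?thesis
    using vectors_support[OF assms(1)] vectors_support[OF assms(2)] vectors_closed[OF assms(1)] vectors_closed[OF assms(2)]
      vectors_finite[OF assms(1)] vectors_finite[OF assms(2)]
    by (intro vectorsI[where S = "{b. v b \<noteq> \<zero>\<^bsub>\<Lambda>\<^esub>} \<union> {b. w b \<noteq> \<zero>\<^bsub>\<Lambda>\<^esub>}"]) (simp, simp, blast)
qed

lemma vectors_map:
  assumes "v \<in> vectors n J" and f: "\<And>b r. r \<in> carrier \<Lambda> \<Longrightarrow> f b r \<in> carrier \<Lambda>" "\<And>b. f b \<zero>\<^bsub>\<Lambda>\<^esub> = \<zero>\<^bsub>\<Lambda>\<^esub>"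
  shows "(\<lambda>b. f b (v b)) \<in> vectors n J"
proof -
  have "v b \<noteq> \<zero>\<^bsub>\<Lambda>\<^esub>" if "f b (v b) \<noteq> \<zero>\<^bsub>\<Lambda>\<^esub>" for b using that f(2) by metis
  then show ?thesis
    using f(1)[OF vectors_closed[OF assms(1)]] vectors_support[OF assms(1)] vectors_finite[OF assms(1)]
    by (intro vectorsI[where S = "{b. v b \<noteq> \<zero>\<^bsub>\<Lambda>\<^esub>}"]) simp_all
qed

lemma vectors_smult [simp]: "r \<in> carrier \<Lambda> \<Longrightarrow> v \<in> vectors n J \<Longrightarrow> (\<lambda>b. r \<otimes>\<^bsub>\<Lambda>\<^esub> v b) \<in> vectors n J"
  using vectors_map[where f = "\<lambda>b x. r \<otimes>\<^bsub>\<Lambda>\<^esub> x"] by simp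

lemma vectors_neg [simp]: "v \<in> vectors n J \<Longrightarrow> (\<lambda>b. \<ominus>\<^bsub>\<Lambda>\<^esub> v b) \<in> vectors n J"
  using vectors_map[where f = "\<lambda>b x. \<ominus>\<^bsub>\<Lambda>\<^esub> x"] by simp

lemma free_module_simps:
  "carrier (free_module J) = \<iota> ` vectors n J"
  "\<zero>\<^bsub>free_module J\<^esub> = \<iota> (\<lambda>b. \<zero>\<^bsub>\<Lambda>\<^esub>)"
  "x \<oplus>\<^bsub>free_module J\<^esub> y = \<iota> (\<lambda>b. \<kappa> x b \<oplus>\<^bsub>\<Lambda>\<^esub> \<kappa> y b)"
  "r \<odot>\<^bsub>free_module J\<^esub> x = \<iota> (\<lambda>b. r \<otimes>\<^bsub>\<Lambda>\<^esub> \<kappa> x b)"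
  "piece (free_module J) j = \<iota> ` {v \<in> vectors n J. \<forall>b. v b \<in> truncated_poly_piece n (j - \<delta> b)}"
  by (simp_all add: free_module_def)

lemma module_free_module: "module \<Lambda> (free_module J)"
proof (rule moduleI[OF cring_truncated_poly])
  \<comment> \<open>Ring elements are cosets, hence sets; equations between them must not be split elementwise.\<close>
  note [simp] = kappa_iota[of _ J] vectors_closed[of _ J] and [rule del] = equalityI
  show "abelian_group (free_module J)"
  proof (rule abelian_groupI)
    fix x assume "x \<in> carrier (free_module J)"
    then obtain v where v: "v \<in> vectors n J" "x = \<iota> v" by (auto simp: free_module_simps)
    show "\<exists>y\<in>carrier (free_module J). y \<oplus>\<^bsub>free_module J\<^esub> x = \<zero>\<^bsub>free_module J\<^esub>"
      using v by (auto simp: free_module_simps L.l_neg intro!: bexI[OF _ vectors_neg[OF v(1)]])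
  qed (auto simp: free_module_simps L.a_ac)
qed (auto simp: free_module_simps kappa_iota[of _ J] vectors_closed[of _ J] L.l_distr L.r_distr L.m_assoc)

lemma finsum_free_module:
  assumes "finite S" "f \<in> S \<rightarrow> carrier (free_module J)"
  shows "\<kappa> (finsum (free_module J) f S) b = finsum \<Lambda> (\<lambda>i. \<kappa> (f i) b) S"
proof -
  interpret M: module \<Lambda> "free_module J" by (rule module_free_module)
  note [simp] = kappa_iota[of _ J] vectors_closed[of _ J] and [rule del] = equalityI
  have cl: "\<kappa> x b \<in> carrier \<Lambda>" if "x \<in> carrier (free_module J)" for x b
    using that by (auto simp: free_module_simps)
  show ?thesis
    using assms
  proof (induction S rule: finite_induct)
    case empty
    then show ?case by (simp add: free_module_simps(2) kappa_iota[OF vectors_zero])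
  next
    case (insert i S)
    have s: "finsum (free_module J) f S \<in> carrier (free_module J)" using insert by (intro M.M.finsum_closed) auto
    have "(\<lambda>i. \<kappa> (f i) b) \<in> S \<rightarrow> carrier \<Lambda>" "\<kappa> (f i) b \<in> carrier \<Lambda>" using insert cl by auto
    moreover have "\<kappa> (f i \<oplus>\<^bsub>free_module J\<^esub> finsum (free_module J) f S) b
        = \<kappa> (f i) b \<oplus>\<^bsub>\<Lambda>\<^esub> \<kappa> (finsum (free_module J) f S) b"
      using insert.prems s by (auto simp: free_module_simps Pi_iff)
    ultimately show ?case using insert by (simp add: M.M.finsum_insert)
  qed
qed

lemma carrier_free_module_eqI:
  assumes "x \<in> carrier (free_module J)" "y \<in> carrier (free_module J)" "\<And>b. \<kappa> x b = \<kappa> y b"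
  shows "x = y"
proof -
  have "\<kappa> x = \<kappa> y" using assms(3) by blast
  then show ?thesis using assms(1,2) by (auto simp: free_module_simps kappa_iota[of _ J])
qed

lemma piece_free_module_subgroup: "subgroup (piece (free_module J) j) (add_monoid (free_module J))"
proof -
  interpret M: module \<Lambda> "free_module J" by (rule module_free_module)
  note [simp] = kappa_iota[of _ J] vectors_closed[of _ J] and [rule del] = equalityI
  have neg: "\<ominus>\<^bsub>free_module J\<^esub> \<iota> v = \<iota> (\<lambda>b. \<ominus>\<^bsub>\<Lambda>\<^esub> v b)" if "v \<in> vectors n J" for v
    using that by (intro M.M.minus_equality) (auto simp: free_module_simps L.l_neg)
  have sub: "\<zero>\<^bsub>\<Lambda>\<^esub> \<in> truncated_poly_piece n i"
    "r \<in> truncated_poly_piece n i \<Longrightarrow> r' \<in> truncated_poly_piece n i \<Longrightarrow> r \<oplus>\<^bsub>\<Lambda>\<^esub> r' \<in> truncated_poly_piece n i"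
    "r \<in> truncated_poly_piece n i \<Longrightarrow> \<ominus>\<^bsub>\<Lambda>\<^esub> r \<in> truncated_poly_piece n i"
    for i and r r' :: "'k npoly set"
    using subgroup.one_closed[OF piece_subgroup] subgroup.m_closed[OF piece_subgroup] subgroup.m_inv_closed[OF piece_subgroup]
    by (simp_all add: a_inv_def)
  show ?thesis
  proof (rule M.M.add.subgroupI, goal_cases)
    case 1
    then show ?case by (auto simp: free_module_simps)
  next
    case 2
    then show ?case using sub(1) vectors_zero[of J] unfolding free_module_simps by blast
  next
    case (3 x)
    then obtain v where v: "v \<in> vectors n J" "x = \<iota> v" "\<And>b. v b \<in> truncated_poly_piece n (j - \<delta> b)"
      by (auto simp: free_module_simps)
    then have "\<ominus>\<^bsub>free_module J\<^esub> x \<in> piece (free_module J) j"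
      unfolding v(2) neg[OF v(1)] using sub(3) by (auto simp: free_module_simps)
    then show ?case by (simp only: a_inv_def)
  next
    case (4 x y)
    then show ?case using sub(2) by (auto simp: free_module_simps)
  qed
qed

text \<open>The homogeneous component of degree \<open>j\<close> is taken coordinate by coordinate, in degree \<open>j - \<delta> b\<close> at
  the coordinate \<open>b\<close>. Uniqueness holds because the projections of the ring are additive.\<close>

lemma is_graded_module_free_module: "is_graded_module n (free_module J)"
  unfolding is_graded_module_def
proof (intro conjI allI ballI module_free_module piece_free_module_subgroup)
  interpret M: module \<Lambda> "free_module J" by (rule module_free_module)
  note [simp] = kappa_iota[of _ J] vectors_closed[of _ J] and [rule del] = equalityI
  let ?M = "free_module J"
  fix x assume "x \<in> carrier ?M"
  then obtain v where v: "v \<in> vectors n J" "x = \<iota> v" by (auto simp: free_module_simps)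
  define p where "p j = (\<lambda>b. component n (j - \<delta> b) (v b))" for j
  have p: "p j \<in> vectors n J" for j
    unfolding p_def using vectors_map[OF v(1), of "\<lambda>b. component n (j - \<delta> b)"]
    by (simp add: component_closed component_zero)
  have p_piece: "\<iota> (p j) \<in> piece ?M j" for j
    using p[of j] v(1) by (auto simp: free_module_simps p_def intro!: component_in_piece)
  let ?S = "{j. \<iota> (p j) \<noteq> \<zero>\<^bsub>?M\<^esub>}"
  have zero_iff: "\<iota> w = \<zero>\<^bsub>?M\<^esub> \<longleftrightarrow> (\<forall>b. w b = \<zero>\<^bsub>\<Lambda>\<^esub>)" if "w \<in> vectors n J" for w
    using iota_eq_iff[OF that vectors_zero[of J]] by (auto simp: free_module_simps fun_eq_iff)
  have "?S \<subseteq> (\<Union>b\<in>{b. v b \<noteq> \<zero>\<^bsub>\<Lambda>\<^esub>}. (\<lambda>i. i + \<delta> b) ` {i. component n i (v b) \<noteq> \<zero>\<^bsub>\<Lambda>\<^esub>})"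
  proof
    fix j assume "j \<in> ?S"
    then obtain b where b: "component n (j - \<delta> b) (v b) \<noteq> \<zero>\<^bsub>\<Lambda>\<^esub>" using zero_iff[OF p[of j]] by (auto simp: p_def)
    then have "v b \<noteq> \<zero>\<^bsub>\<Lambda>\<^esub>" using component_zero by metis
    then show "j \<in> (\<Union>b\<in>{b. v b \<noteq> \<zero>\<^bsub>\<Lambda>\<^esub>}. (\<lambda>i. i + \<delta> b) ` {i. component n i (v b) \<noteq> \<zero>\<^bsub>\<Lambda>\<^esub>})"
      using b by (intro UN_I[of b] image_eqI[of _ _ "j - \<delta> b"]) auto
  qed
  moreover have "finite \<dots>"
    by (intro finite_UN_I finite_imageI component_finite vectors_finite[OF v(1)] vectors_closed[OF v(1)])
  ultimately have fin: "finite ?S" by (rule finite_subset)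
  have coord: "\<kappa> (finsum ?M f S) b = finsum \<Lambda> (\<lambda>j. \<kappa> (f j) b) S"
    if "finite S" "f \<in> (\<Pi> j\<in>UNIV. piece ?M j)" for S f b
    using that by (intro finsum_free_module) (auto simp: free_module_simps)
  show "\<exists>!f. f \<in> (\<Pi> j\<in>UNIV. piece ?M j) \<and> finite {j. f j \<noteq> \<zero>\<^bsub>?M\<^esub>} \<and> x = finsum ?M f {j. f j \<noteq> \<zero>\<^bsub>?M\<^esub>}"
  proof (rule ex1I[of _ "\<lambda>j. \<iota> (p j)"], intro conjI fin)
    show "(\<lambda>j. \<iota> (p j)) \<in> (\<Pi> j\<in>UNIV. piece ?M j)" using p_piece by auto
    show "x = finsum ?M (\<lambda>j. \<iota> (p j)) ?S"
    proof (rule carrier_free_module_eqI)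
      show "x \<in> carrier ?M" "finsum ?M (\<lambda>j. \<iota> (p j)) ?S \<in> carrier ?M"
        using v p by (auto simp: free_module_simps intro!: M.M.finsum_closed[unfolded free_module_simps])
      fix b
      have "finsum \<Lambda> (\<lambda>j. \<kappa> (\<iota> (p j)) b) ?S = finsum \<Lambda> (\<lambda>j. component n (j - \<delta> b) (v b)) ?S"
        using p by (simp add: kappa_iota[OF p]) (simp add: p_def)
      also have "\<dots> = finsum \<Lambda> (\<lambda>i. component n i (v b)) ((\<lambda>j. j - \<delta> b) ` ?S)"
        using v(1) by (subst L.finsum_reindex) (auto simp: inj_on_def component_closed)
      also have "\<dots> = v b"
      proof (rule component_sum)
        show "{j. component n j (v b) \<noteq> \<zero>\<^bsub>\<Lambda>\<^esub>} \<subseteq> (\<lambda>j. j - \<delta> b) ` ?S"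
        proof
          fix i assume i: "i \<in> {j. component n j (v b) \<noteq> \<zero>\<^bsub>\<Lambda>\<^esub>}"
          then have "p (i + \<delta> b) b \<noteq> \<zero>\<^bsub>\<Lambda>\<^esub>" by (simp add: p_def)
          then have "i + \<delta> b \<in> ?S" using zero_iff[OF p] by auto
          then show "i \<in> (\<lambda>j. j - \<delta> b) ` ?S" by (rule rev_image_eqI) simp
        qed
      qed (use v(1) fin in auto)
      finally show "\<kappa> x b = \<kappa> (finsum ?M (\<lambda>j. \<iota> (p j)) ?S) b"
        using coord[OF fin, of "\<lambda>j. \<iota> (p j)" b] p_piece v by auto
    qed
  next
    fix f assume f: "f \<in> (\<Pi> j\<in>UNIV. piece ?M j) \<and> finite {j. f j \<noteq> \<zero>\<^bsub>?M\<^esub>} \<and> x = finsum ?M f {j. f j \<noteq> \<zero>\<^bsub>?M\<^esub>}"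
    let ?T = "{j. f j \<noteq> \<zero>\<^bsub>?M\<^esub>}"
    show "f = (\<lambda>j. \<iota> (p j))"
    proof
      fix i
      obtain w where w: "w \<in> vectors n J" "f i = \<iota> w" "\<And>b. w b \<in> truncated_poly_piece n (i - \<delta> b)"
        using f by (auto simp: free_module_simps Pi_iff)
      have "p i b = w b" for b
      proof -
        have fb: "\<kappa> (f j) b \<in> truncated_poly_piece n (j - \<delta> b)" for j
        proof -
          have "f j \<in> piece ?M j" using f by blast
          then show ?thesis by (auto simp: free_module_simps)
        qed
        then have fc: "\<kappa> (f j) b \<in> carrier \<Lambda>" for j using piece_subset_carrier by blast
        have "v b = finsum \<Lambda> (\<lambda>j. \<kappa> (f j) b) ?T" 
        proof -
          have "v b = \<kappa> x b" using v by simp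
          also have "\<dots> = \<kappa> (finsum ?M f ?T) b" using f by simp
          finally show ?thesis using coord[of ?T f b] f by simp
        qed
        also have "\<dots> = finsum \<Lambda> (\<lambda>j. \<kappa> (f j) b) (insert i ?T)"
          using f fc by (intro L.add.finprod_mono_neutral_cong_left) (auto simp: free_module_simps kappa_iota[OF vectors_zero])
        finally have vb: "v b = finsum \<Lambda> (\<lambda>j. \<kappa> (f j) b) (insert i ?T)" .
        have hom: "component n (i - \<delta> b) (finsum \<Lambda> g S) = finsum \<Lambda> (\<lambda>j. component n (i - \<delta> b) (g j)) S"
          if "finite S" "g \<in> S \<rightarrow> carrier \<Lambda>" for g and S :: "int set"
          using that
        proof (induction S rule: finite_induct)
          case (insert j S)
          then show ?case
            by (simp add: component_add component_closed Pi_iff L.finsum_insert L.finsum_closed)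
        qed (simp add: component_zero)
        have "p i b = finsum \<Lambda> (\<lambda>j. component n (i - \<delta> b) (\<kappa> (f j) b)) (insert i ?T)"
          unfolding p_def vb using f fc by (intro hom) auto
        also have "\<dots> = finsum \<Lambda> (\<lambda>j. if i = j then \<kappa> (f j) b else \<zero>\<^bsub>\<Lambda>\<^esub>) (insert i ?T)"
          using fc by (intro L.finsum_cong') (auto simp: component_piece[OF fb])
        also have "\<dots> = \<kappa> (f i) b"
          using f fc by (intro L.add.finprod_singleton) auto
        finally show ?thesis using w by simp
      qed
      then show "f i = \<iota> (p i)" using w(2) by (metis ext)
    qed
  qed
next
  note [simp] = kappa_iota[of _ J] vectors_closed[of _ J]
  fix i j and r :: "'k npoly set" and x
  assume r: "r \<in> truncated_poly_piece n i" and x: "x \<in> piece (free_module J) j"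
  then obtain v where v: "v \<in> vectors n J" "x = \<iota> v" "\<And>b. v b \<in> truncated_poly_piece n (j - \<delta> b)"
    by (auto simp: free_module_simps)
  have "r \<otimes>\<^bsub>\<Lambda>\<^esub> v b \<in> truncated_poly_piece n (i + j - \<delta> b)" for b
    using piece_mult[OF r v(3)[of b]] by (simp add: add_diff_eq)
  then show "r \<odot>\<^bsub>free_module J\<^esub> x \<in> piece (free_module J) (i + j)"
    using v r piece_subset_carrier[of n i] vectors_smult[of r v J] by (auto simp: free_module_simps)
qed

definition unit_vector :: "'b \<Rightarrow> 'b \<Rightarrow> 'k npoly set" where
  "unit_vector b = (\<lambda>b'. if b' = b then \<one>\<^bsub>\<Lambda>\<^esub> else \<zero>\<^bsub>\<Lambda>\<^esub>)"

lemma unit_vector_in_vectors: "b \<in> J \<Longrightarrow> unit_vector b \<in> vectors n J"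
  by (auto simp: vectors_def unit_vector_def)

definition basis :: "'b set \<Rightarrow> 'u set" where
  "basis J = (\<lambda>b. \<iota> (unit_vector b)) ` J"

lemma basis_subset: "basis J \<subseteq> carrier (free_module J)"
  by (auto simp: basis_def free_module_simps unit_vector_in_vectors)

lemma basis_homogeneous: "basis J \<subseteq> (\<Union>j. piece (free_module J) j)"
proof
  fix x assume "x \<in> basis J"
  then obtain b where b: "b \<in> J" "x = \<iota> (unit_vector b)" by (auto simp: basis_def)
  have 1: "\<one>\<^bsub>\<Lambda>\<^esub> \<in> truncated_poly_piece n 0"
    by (auto simp: truncated_poly_one truncated_poly_piece_eq monom_degree_def intro!: exI[of _ 1])
  have 0: "\<zero>\<^bsub>\<Lambda>\<^esub> \<in> truncated_poly_piece n i" for i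
    using subgroup.one_closed[OF piece_subgroup] by simp
  have "x \<in> piece (free_module J) (\<delta> b)"
    using unit_vector_in_vectors[OF b(1)] 0 1 b(2) by (auto simp: free_module_simps unit_vector_def)
  then show "x \<in> (\<Union>j. piece (free_module J) j)" by blast
qed

lemma lin_indep_basis: "lin_indep \<Lambda> (free_module J) (basis J)"
  unfolding lin_indep_def
proof (intro allI impI ballI, elim conjE)
  interpret M: module \<Lambda> "free_module J" by (rule module_free_module)
  note [simp] = kappa_iota[of _ J] vectors_closed[of _ J] and [rule del] = equalityI
  fix c S x
  assume S: "finite S" "S \<subseteq> basis J" "c \<in> S \<rightarrow> carrier \<Lambda>"
    and z: "finsum (free_module J) (\<lambda>b. c b \<odot>\<^bsub>free_module J\<^esub> b) S = \<zero>\<^bsub>free_module J\<^esub>" and x: "x \<in> S"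
  obtain b where b: "b \<in> J" "x = \<iota> (unit_vector b)" using S(2) x by (auto simp: basis_def)
  have cl: "(\<lambda>b. c b \<odot>\<^bsub>free_module J\<^esub> b) \<in> S \<rightarrow> carrier (free_module J)"
    using S basis_subset[of J] by (auto intro!: M.smult_closed)
  have "\<zero>\<^bsub>\<Lambda>\<^esub> = \<kappa> (finsum (free_module J) (\<lambda>b. c b \<odot>\<^bsub>free_module J\<^esub> b) S) b"
    unfolding z by (simp add: free_module_simps(2) kappa_iota[OF vectors_zero])
  also have "\<dots> = finsum \<Lambda> (\<lambda>y. \<kappa> (c y \<odot>\<^bsub>free_module J\<^esub> y) b) S" by (rule finsum_free_module[OF S(1) cl])
  also have "\<dots> = finsum \<Lambda> (\<lambda>y. if x = y then c y else \<zero>\<^bsub>\<Lambda>\<^esub>) S"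
  proof (rule L.finsum_cong')
    fix y assume y: "y \<in> S"
    then obtain b' where b': "b' \<in> J" "y = \<iota> (unit_vector b')" using S(2) by (auto simp: basis_def)
    have cy: "c y \<in> carrier \<Lambda>" using S(3) y by auto
    note u = unit_vector_in_vectors[OF b'(1)]
    have k: "\<kappa> (c y \<odot>\<^bsub>free_module J\<^esub> y) b = c y \<otimes>\<^bsub>\<Lambda>\<^esub> unit_vector b' b"
      using cy u by (simp add: free_module_simps b'(2) kappa_iota[OF u] kappa_iota[OF vectors_smult[OF cy u]])
    show "\<kappa> (c y \<odot>\<^bsub>free_module J\<^esub> y) b = (if x = y then c y else \<zero>\<^bsub>\<Lambda>\<^esub>)"
    proof (cases "x = y")
      case True
      then have "unit_vector b' = unit_vector b"
        using iota_eq_iff[OF unit_vector_in_vectors[OF b(1)] u] b b' by simp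
      then show ?thesis using k cy True by (simp add: unit_vector_def)
    next
      case False
      then have "b \<noteq> b'" using b b' by blast
      then show ?thesis using k cy False by (simp add: unit_vector_def)
    qed
  qed (use S in auto)
  also have "\<dots> = c x" using S x by (intro L.add.finprod_singleton) auto
  finally show "c x = \<zero>\<^bsub>\<Lambda>\<^esub>" by simp
qed

lemma lin_span_basis: "lin_span \<Lambda> (free_module J) (basis J) = carrier (free_module J)"
proof
  interpret M: module \<Lambda> "free_module J" by (rule module_free_module)
  note [simp] = kappa_iota[of _ J] vectors_closed[of _ J] and [rule del] = equalityI
  show "lin_span \<Lambda> (free_module J) (basis J) \<subseteq> carrier (free_module J)"
  proof
    fix x assume "x \<in> lin_span \<Lambda> (free_module J) (basis J)"
    then obtain c S where S: "finite S" "S \<subseteq> basis J" "c \<in> S \<rightarrow> carrier \<Lambda>"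
      "x = finsum (free_module J) (\<lambda>b. c b \<odot>\<^bsub>free_module J\<^esub> b) S" by (auto simp: lin_span_def)
    then show "x \<in> carrier (free_module J)" using basis_subset[of J] by (auto intro!: M.M.finsum_closed M.smult_closed)
  qed
  have one: "\<one>\<^bsub>\<Lambda>\<^esub> \<noteq> \<zero>\<^bsub>\<Lambda>\<^esub>"
    using socle_monomial_mult_neq_zero[OF n_pos, where B = "{}" and C = "{}" and m = 0 and M = 0 and m' = 0 and M' = 0]
    by (simp add: socle_poly_refl truncated_poly_one)
  show "carrier (free_module J) \<subseteq> lin_span \<Lambda> (free_module J) (basis J)"
  proof
    fix x assume "x \<in> carrier (free_module J)"
    then obtain v where v: "v \<in> vectors n J" "x = \<iota> v" by (auto simp: free_module_simps)
    let ?u = "\<lambda>b. \<iota> (unit_vector b)"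
    let ?I = "{b. v b \<noteq> \<zero>\<^bsub>\<Lambda>\<^esub>}"
    have IJ: "?I \<subseteq> J" "finite ?I" using vectors_support[OF v(1)] vectors_finite[OF v(1)] by blast+
    have inju: "inj_on ?u J"
    proof (rule inj_onI)
      fix b b' assume "b \<in> J" "b' \<in> J" "?u b = ?u b'"
      then have "unit_vector b = unit_vector b'"
        using iota_eq_iff[OF unit_vector_in_vectors[of b J] unit_vector_in_vectors[of b' J]] by simp
      from fun_cong[OF this, of b] show "b = b'" using one by (simp add: unit_vector_def split: if_splits)
    qed
    define c where "c y = v (inv_into J ?u y)" for y
    have c: "c (?u b) = v b" if "b \<in> J" for b using inv_into_f_f[OF inju that] by (simp add: c_def)
    have cl: "(\<lambda>b. c b \<odot>\<^bsub>free_module J\<^esub> b) \<in> ?u ` ?I \<rightarrow> carrier (free_module J)"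
      using IJ(1) v(1) basis_subset by (fastforce simp: c_def basis_def)
    have "x = finsum (free_module J) (\<lambda>b. c b \<odot>\<^bsub>free_module J\<^esub> b) (?u ` ?I)"
    proof (rule carrier_free_module_eqI)
      show "finsum (free_module J) (\<lambda>b. c b \<odot>\<^bsub>free_module J\<^esub> b) (?u ` ?I) \<in> carrier (free_module J)"
        using cl by (intro M.M.finsum_closed)
      show "x \<in> carrier (free_module J)" using v by (simp add: free_module_simps)
      fix b
      have k: "\<kappa> (c (?u b') \<odot>\<^bsub>free_module J\<^esub> ?u b') b = (if b = b' then v b' else \<zero>\<^bsub>\<Lambda>\<^esub>)" if "b' \<in> ?I" for b'
      proof -
        have b': "b' \<in> J" using that IJ(1) by blast
        note u = unit_vector_in_vectors[OF b']
        have vb: "v b' \<in> carrier \<Lambda>" using v(1) by simp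
        show ?thesis
          unfolding c[OF b'] free_module_simps kappa_iota[OF u] kappa_iota[OF vectors_smult[OF vb u]]
          using vb by (simp add: unit_vector_def)
      qed
      have "\<kappa> (finsum (free_module J) (\<lambda>b. c b \<odot>\<^bsub>free_module J\<^esub> b) (?u ` ?I)) b =
          finsum \<Lambda> (\<lambda>y. \<kappa> (c y \<odot>\<^bsub>free_module J\<^esub> y) b) (?u ` ?I)"
        using IJ(2) cl by (intro finsum_free_module) auto
      also have "\<dots> = finsum \<Lambda> (\<lambda>b'. \<kappa> (c (?u b') \<odot>\<^bsub>free_module J\<^esub> ?u b') b) ?I"
        using inj_on_subset[OF inju IJ(1)] k v(1) by (subst L.finsum_reindex) auto
      also have "\<dots> = finsum \<Lambda> (\<lambda>b'. if b = b' then v b' else \<zero>\<^bsub>\<Lambda>\<^esub>) ?I"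
        using k v(1) by (intro L.finsum_cong') auto
      also have "\<dots> = v b"
      proof (cases "b \<in> ?I")
        case True
        then show ?thesis using IJ(2) v(1) by (intro L.add.finprod_singleton) auto
      next
        case False
        then have "finsum \<Lambda> (\<lambda>b'. if b = b' then v b' else \<zero>\<^bsub>\<Lambda>\<^esub>) ?I = finsum \<Lambda> (\<lambda>b'. \<zero>\<^bsub>\<Lambda>\<^esub>) ?I"
          by (intro L.finsum_cong') auto
        then show ?thesis using False by simp
      qed
      finally show "\<kappa> x b = \<kappa> (finsum (free_module J) (\<lambda>b. c b \<odot>\<^bsub>free_module J\<^esub> b) (?u ` ?I)) b"
        using v by simp
    qed
    moreover have "finite (?u ` ?I)" "?u ` ?I \<subseteq> basis J" "c \<in> ?u ` ?I \<rightarrow> carrier \<Lambda>"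
      using IJ v(1) by (auto simp: basis_def c_def)
    ultimately show "x \<in> lin_span \<Lambda> (free_module J) (basis J)" unfolding lin_span_def by blast
  qed
qed

end


section \<open>Sums of telescopes\<close>

text \<open>The degree of the generator of stage \<open>m\<close>. Each step of the telescope multiplies by a monomial, and
  for the step to preserve degrees the next generator must have the degree lowered by that of the
  monomial.\<close>

definition telescope_degree :: "(nat \<Rightarrow> nat) \<Rightarrow> nat set \<times> nat \<Rightarrow> int" where
  "telescope_degree n = (\<lambda>(B, m). - (\<Sum>k<m. int (socle_exponent n B k * 2 ^ (k + 1))))"

lemma telescope_degree_Suc:
  "int (socle_exponent n B k * 2 ^ (k + 1)) + (j - telescope_degree n (B, k)) = j - telescope_degree n (B, Suc k)"
  by (simp add: telescope_degree_def)

text \<open>For every set \<open>B\<close> of positions there is a telescope in which step \<open>m\<close> multiplies by the socle element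
  of \<open>x\<^sub>m\<^sub>+\<^sub>1\<close> if \<open>m \<in> B\<close>, and by 1 otherwise. A pair \<open>(B, m)\<close> indexes the generator of stage \<open>m\<close> of the
  telescope of \<open>B\<close>; the same indices serve in degrees 0 and \<open>-1\<close>.\<close>

locale sum_of_telescopes = free_modules n \<iota> "telescope_degree n"
  for n and \<iota> :: "(nat set \<times> nat \<Rightarrow> 'k::field npoly set) \<Rightarrow> 'u"
begin

interpretation L: cring "\<Lambda>" by (rule cring_truncated_poly)

abbreviation link :: "nat set \<Rightarrow> nat \<Rightarrow> 'k npoly set" where
  "link B k \<equiv> socle_monomial n B k (Suc k)"

text \<open>The linear map that sends the generator \<open>f\<^sub>m\<close> of degree \<open>-1\<close> to \<open>e\<^sub>m - y\<^sub>m e\<^sub>m\<^sub>+\<^sub>1\<close>, where \<open>y\<^sub>m\<close> is the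
  multiplier of step \<open>m\<close>, written in coordinates.\<close>

definition boundary :: "(nat set \<times> nat \<Rightarrow> 'k npoly set) \<Rightarrow> nat set \<times> nat \<Rightarrow> 'k npoly set" where
  "boundary v = (\<lambda>(B, m). v (B, m) \<ominus>\<^bsub>\<Lambda>\<^esub> (case m of 0 \<Rightarrow> \<zero>\<^bsub>\<Lambda>\<^esub> | Suc k \<Rightarrow> link B k \<otimes>\<^bsub>\<Lambda>\<^esub> v (B, k)))"

text \<open>All entries up to stage \<open>m\<close>, pushed forward to stage \<open>m\<close> and added up.\<close>

primrec collect :: "(nat set \<times> nat \<Rightarrow> 'k npoly set) \<Rightarrow> nat set \<Rightarrow> nat \<Rightarrow> 'k npoly set" where
  "collect v B 0 = v (B, 0)"
| "collect v B (Suc m) = v (B, Suc m) \<oplus>\<^bsub>\<Lambda>\<^esub> link B m \<otimes>\<^bsub>\<Lambda>\<^esub> collect v B m"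

text \<open>The partial sums on the way to stage \<open>M\<close>. They form the chain of degree \<open>-1\<close> along which the entries
  are pushed forward.\<close>

definition collect_below :: "nat \<Rightarrow> (nat set \<times> nat \<Rightarrow> 'k npoly set) \<Rightarrow> nat set \<times> nat \<Rightarrow> 'k npoly set" where
  "collect_below M v = (\<lambda>(B, m). if m < M then collect v B m else \<zero>\<^bsub>\<Lambda>\<^esub>)"

definition telescope_sum :: "nat set set \<Rightarrow> ('k npoly set, 'u) cochain_complex" where
  "telescope_sum F = \<lparr>cobj = (\<lambda>s. free_module (if s = 0 \<or> s = -1 then F \<times> UNIV else {})),
     cdiff = (\<lambda>s x. if s = -1 then \<iota> (boundary (\<kappa> x)) else \<iota> (\<lambda>b. \<zero>\<^bsub>\<Lambda>\<^esub>))\<rparr>"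

lemma cobj_telescope_sum:
  "cobj (telescope_sum F) s = free_module (if s = 0 \<or> s = -1 then F \<times> UNIV else {})"
  by (simp add: telescope_sum_def)

lemma cdiff_telescope_sum:
  "cdiff (telescope_sum F) s x = (if s = -1 then \<iota> (boundary (\<kappa> x)) else \<iota> (\<lambda>b. \<zero>\<^bsub>\<Lambda>\<^esub>))"
  by (simp add: telescope_sum_def)

lemma collect_closed: "(\<And>b. v b \<in> carrier \<Lambda>) \<Longrightarrow> collect v B m \<in> carrier \<Lambda>"
  by (induction m) simp_all

lemma collect_add:
  assumes "\<And>b. v b \<in> carrier \<Lambda>" "\<And>b. w b \<in> carrier \<Lambda>"
  shows "collect (\<lambda>b. v b \<oplus>\<^bsub>\<Lambda>\<^esub> w b) B m = collect v B m \<oplus>\<^bsub>\<Lambda>\<^esub> collect w B m"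
  using assms by (induction m) (simp_all add: collect_closed L.r_distr L.a_ac)

lemma collect_smult:
  assumes "r \<in> carrier \<Lambda>" "\<And>b. v b \<in> carrier \<Lambda>"
  shows "collect (\<lambda>b. r \<otimes>\<^bsub>\<Lambda>\<^esub> v b) B m = r \<otimes>\<^bsub>\<Lambda>\<^esub> collect v B m"
  using assms by (induction m) (simp_all add: collect_closed L.r_distr L.m_lcomm)

lemma collect_eq_zero:
  assumes "\<And>m. v (B, m) = \<zero>\<^bsub>\<Lambda>\<^esub>"
  shows "collect v B m = \<zero>\<^bsub>\<Lambda>\<^esub>"
  using assms by (induction m) simp_all

lemma boundary_closed: "(\<And>b. v b \<in> carrier \<Lambda>) \<Longrightarrow> boundary v b \<in> carrier \<Lambda>"
  by (cases b) (simp add: boundary_def split: nat.split)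

text \<open>Partial sums invert the difference operator \<open>boundary\<close>. In particular the telescope has no cohomology
  in degree \<open>-1\<close>.\<close>

lemma collect_boundary:
  assumes "\<And>b. v b \<in> carrier \<Lambda>"
  shows "collect (boundary v) B m = v (B, m)"
  using assms by (induction m) (simp_all add: boundary_def L.minus_eq L.a_assoc L.l_neg)

lemma collect_shift:
  assumes v: "\<And>b. v b \<in> carrier \<Lambda>" and z: "\<And>m. M < m \<Longrightarrow> v (B, m) = \<zero>\<^bsub>\<Lambda>\<^esub>" and "M \<le> N"
  shows "collect v B N = socle_monomial n B M N \<otimes>\<^bsub>\<Lambda>\<^esub> collect v B M"
  using \<open>M \<le> N\<close>
proof (induction N rule: dec_induct)
  case base
  then show ?case using v by (simp add: socle_poly_refl collect_closed flip: truncated_poly_one)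
next
  case (step N)
  have "link B N \<otimes>\<^bsub>\<Lambda>\<^esub> socle_monomial n B M N = socle_monomial n B M (Suc N)"
    unfolding truncated_poly_mult mult.commute[of "socle_poly n B N (Suc N)"]
    by (subst socle_poly_trans) (use step(1) in simp_all)
  then show ?case
    using step z[of "Suc N"] v by (simp add: collect_closed L.m_assoc[symmetric] del: truncated_poly_mult)
qed

lemma collect_unit_vector:
  assumes "m \<le> M"
  shows "collect (unit_vector (B, m)) B M = socle_monomial n B m M"
proof -
  let ?v = "unit_vector (B, m)"
  have v: "?v b \<in> carrier \<Lambda>" for b by (simp add: unit_vector_def)
  have lt: "collect ?v B j = \<zero>\<^bsub>\<Lambda>\<^esub>" if "j < m" for j
    using that by (induction j) (simp_all add: unit_vector_def)
  have "collect ?v B m = \<one>\<^bsub>\<Lambda>\<^esub>"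
    using lt by (cases m) (simp_all add: unit_vector_def)
  then show ?thesis
    using collect_shift[OF v _ assms, where B = B] by (simp add: unit_vector_def)
qed

lemma boundary_add:
  assumes "\<And>b. v b \<in> carrier \<Lambda>" "\<And>b. w b \<in> carrier \<Lambda>"
  shows "boundary (\<lambda>b. v b \<oplus>\<^bsub>\<Lambda>\<^esub> w b) b = boundary v b \<oplus>\<^bsub>\<Lambda>\<^esub> boundary w b"
  using assms by (cases b) (simp add: boundary_def L.r_distr L.minus_eq L.minus_add L.a_ac split: nat.split)

lemma boundary_smult:
  assumes "r \<in> carrier \<Lambda>" "\<And>b. v b \<in> carrier \<Lambda>"
  shows "boundary (\<lambda>b. r \<otimes>\<^bsub>\<Lambda>\<^esub> v b) b = r \<otimes>\<^bsub>\<Lambda>\<^esub> boundary v b"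
  using assms by (cases b) (simp add: boundary_def L.r_distr L.minus_eq L.r_minus L.m_lcomm split: nat.split)

lemma boundary_zero: "boundary (\<lambda>b. \<zero>\<^bsub>\<Lambda>\<^esub>) = (\<lambda>b. \<zero>\<^bsub>\<Lambda>\<^esub>)"
  by (auto simp: boundary_def L.minus_eq fun_eq_iff split: nat.split)

lemma boundary_vectors:
  assumes "v \<in> vectors n (F \<times> UNIV)"
  shows "boundary v \<in> vectors n (F \<times> UNIV)"
proof (rule vectorsI)
  let ?S = "{b. v b \<noteq> \<zero>\<^bsub>\<Lambda>\<^esub>}"
  show "boundary v b \<in> carrier \<Lambda>" for b using assms by (intro boundary_closed) (rule vectors_closed)
  show "finite (?S \<union> (\<lambda>(B, m). (B, Suc m)) ` ?S)" using vectors_finite[OF assms] by simp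
  show "b \<in> ?S \<union> (\<lambda>(B, m). (B, Suc m)) ` ?S \<and> b \<in> F \<times> UNIV" if b: "boundary v b \<noteq> \<zero>\<^bsub>\<Lambda>\<^esub>" for b
  proof -
    obtain B m where Bm: "b = (B, m)" by (cases b)
    have "v (B, m) \<noteq> \<zero>\<^bsub>\<Lambda>\<^esub> \<or> (\<exists>k. m = Suc k \<and> v (B, k) \<noteq> \<zero>\<^bsub>\<Lambda>\<^esub>)"
    proof (cases m)
      case 0
      then show ?thesis using b vectors_closed[OF assms, of "(B, 0)"] by (auto simp: Bm boundary_def L.minus_eq)
    next
      case (Suc k)
      then show ?thesis using b by (cases "v (B, k) = \<zero>\<^bsub>\<Lambda>\<^esub>") (auto simp: Bm boundary_def L.minus_eq)
    qed
    then show ?thesis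
    proof (elim disjE exE conjE)
      assume m: "v (B, m) \<noteq> \<zero>\<^bsub>\<Lambda>\<^esub>"
      then show ?thesis using vectors_support[OF assms m] by (simp add: Bm)
    next
      fix k assume k: "m = Suc k" "v (B, k) \<noteq> \<zero>\<^bsub>\<Lambda>\<^esub>"
      then have "b \<in> (\<lambda>(B, m). (B, Suc m)) ` ?S" by (intro image_eqI[of _ _ "(B, k)"]) (simp_all add: Bm)
      then show ?thesis using vectors_support[OF assms k(2)] by (simp add: Bm)
    qed
  qed
qed

lemma collect_below_vectors:
  assumes "v \<in> vectors n (F \<times> UNIV)"
  shows "collect_below M v \<in> vectors n (F \<times> UNIV)"
proof (rule vectorsI)
  let ?S = "{b. v b \<noteq> \<zero>\<^bsub>\<Lambda>\<^esub>}"
  show "collect_below M v b \<in> carrier \<Lambda>" for b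
    using collect_closed[OF vectors_closed[OF assms]] by (cases b) (simp add: collect_below_def)
  show "finite (fst ` ?S \<times> {..<M})" using vectors_finite[OF assms] by simp
  show "b \<in> fst ` ?S \<times> {..<M} \<and> b \<in> F \<times> UNIV" if b: "collect_below M v b \<noteq> \<zero>\<^bsub>\<Lambda>\<^esub>" for b
  proof -
    obtain B m where Bm: "b = (B, m)" by (cases b)
    have m: "m < M" "collect v B m \<noteq> \<zero>\<^bsub>\<Lambda>\<^esub>" using b by (auto simp: Bm collect_below_def split: if_splits)
    then obtain k where "v (B, k) \<noteq> \<zero>\<^bsub>\<Lambda>\<^esub>" using collect_eq_zero by blast
    then show ?thesis using vectors_support[OF assms] m(1) by (force simp: Bm)
  qed
qed

text \<open>Below stage \<open>M\<close> the recursion for \<open>collect\<close> returns the entries of \<open>v\<close>. At stage \<open>M\<close> the chain stops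
  and leaves the full sum behind.\<close>

lemma boundary_collect_below:
  assumes v: "v \<in> vectors n J" and z: "\<And>B m. M < m \<Longrightarrow> v (B, m) = \<zero>\<^bsub>\<Lambda>\<^esub>"
  shows "v (B, m) = (if m = M then collect v B M else \<zero>\<^bsub>\<Lambda>\<^esub>) \<oplus>\<^bsub>\<Lambda>\<^esub> boundary (collect_below M v) (B, m)"
proof -
  note cl = collect_closed[OF vectors_closed[OF v]] vectors_closed[OF v]
  show ?thesis
  proof (cases m)
    case 0
    then show ?thesis using cl by (simp add: boundary_def collect_below_def L.minus_eq)
  next
    case (Suc k)
    consider "m < M" | "m = M" | "M < m" by linarith
    then show ?thesis
    proof cases
      case 1
      then show ?thesis
        using cl Suc by (simp add: boundary_def collect_below_def L.minus_eq L.a_assoc L.r_neg)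
    next
      case 2
      show ?thesis
        unfolding 2[symmetric] using cl Suc by (simp add: boundary_def collect_below_def L.minus_eq L.a_assoc L.r_neg)
    next
      case 3
      then show ?thesis
        using cl Suc z[of m B] by (simp add: boundary_def collect_below_def L.minus_eq)
    qed
  qed
qed

lemma is_complex_telescope_sum: "is_complex n (telescope_sum F)"
  unfolding is_complex_def
proof (intro conjI allI ballI)
  fix s
  let ?V = "telescope_sum F"
  show "is_graded_module n (cobj ?V s)"
    unfolding cobj_telescope_sum by (rule is_graded_module_free_module)
  have zero_piece: "\<iota> (\<lambda>b. \<zero>\<^bsub>\<Lambda>\<^esub>) \<in> piece (free_module J) j" for J j
    using subgroup.one_closed[OF piece_free_module_subgroup, of J j] by (simp add: free_module_simps(2))
  show "cdiff ?V s \<in> graded_hom n (cobj ?V s) (cobj ?V (s + 1))"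
  proof (cases "s = -1")
    case False
    then show ?thesis
      using zero_piece
      by (auto simp: graded_hom_def cdiff_telescope_sum cobj_telescope_sum free_module_simps kappa_iota[OF vectors_zero])
  next
    case True
    let ?J = "F \<times> (UNIV :: nat set)"
    note ki = kappa_iota[of _ ?J]
    have "\<iota> (boundary (\<kappa> x)) \<in> piece (free_module ?J) j" if xj: "x \<in> piece (free_module ?J) j" for x j
    proof -
      obtain v where v: "v \<in> vectors n ?J" "x = \<iota> v" "\<And>b. v b \<in> truncated_poly_piece n (j - telescope_degree n b)"
        using xj by (auto simp: free_module_simps)
      have "boundary v b \<in> truncated_poly_piece n (j - telescope_degree n b)" for b
      proof -
        obtain B m where Bm: "b = (B, m)" by (cases b)
        let ?r = "case m of 0 \<Rightarrow> \<zero>\<^bsub>\<Lambda>\<^esub> | Suc k \<Rightarrow> link B k \<otimes>\<^bsub>\<Lambda>\<^esub> v (B, k)"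
        have r: "?r \<in> truncated_poly_piece n (j - telescope_degree n b)"
        proof (cases m)
          case 0
          then show ?thesis using subgroup.one_closed[OF piece_subgroup] by simp
        next
          case (Suc k)
          then show ?thesis
            using piece_mult[OF socle_monomial_Suc_in_piece[of n B k] v(3)[of "(B, k)"]]
            unfolding telescope_degree_Suc by (simp add: Bm)
        qed
        have "v b \<oplus>\<^bsub>\<Lambda>\<^esub> (\<ominus>\<^bsub>\<Lambda>\<^esub> ?r) \<in> truncated_poly_piece n (j - telescope_degree n b)"
          using subgroup.m_closed[OF piece_subgroup v(3)[of b] subgroup.m_inv_closed[OF piece_subgroup r]]
          by (simp add: a_inv_def)
        then show ?thesis by (simp add: boundary_def Bm L.minus_eq)
      qed
      then show ?thesis using boundary_vectors[OF v(1)] v(1,2) by (auto simp: free_module_simps ki)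
    qed
    moreover have "boundary (\<lambda>b. v b \<oplus>\<^bsub>\<Lambda>\<^esub> w b) = (\<lambda>b. boundary v b \<oplus>\<^bsub>\<Lambda>\<^esub> boundary w b)"
      if "v \<in> vectors n ?J" "w \<in> vectors n ?J" for v w
      using boundary_add[OF vectors_closed[OF that(1)] vectors_closed[OF that(2)]] by (rule ext)
    moreover have "boundary (\<lambda>b. r \<otimes>\<^bsub>\<Lambda>\<^esub> v b) = (\<lambda>b. r \<otimes>\<^bsub>\<Lambda>\<^esub> boundary v b)"
      if "r \<in> carrier \<Lambda>" "v \<in> vectors n ?J" for v r
      using boundary_smult[OF that(1) vectors_closed[OF that(2)]] by (rule ext)
    ultimately show ?thesis
      using True by (auto simp: graded_hom_def cdiff_telescope_sum cobj_telescope_sum free_module_simps ki boundary_vectors)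
  qed
  fix x assume x: "x \<in> carrier (cobj ?V s)"
  show "cdiff ?V (s + 1) (cdiff ?V s x) = \<zero>\<^bsub>cobj ?V (s + 2)\<^esub>"
    using x by (auto simp: cdiff_telescope_sum cobj_telescope_sum free_module_simps kappa_iota[OF vectors_zero] boundary_zero)
qed

text \<open>The differential takes the generators of degree \<open>-1\<close> to combinations of those of degree 0, which
  are cocycles; so a filtration with two steps suffices.\<close>

lemma semifree_telescope_sum: "semifree n (telescope_sum F)"
  unfolding semifree_def
proof (intro conjI is_complex_telescope_sum exI allI ballI)
  let ?V = "telescope_sum F"
  let ?J = "\<lambda>s :: int. if s = 0 \<or> s = -1 then F \<times> (UNIV :: nat set) else {}"
  let ?rank = "\<lambda>(s :: int) (x :: 'u). if s = 0 then 0 else (1 :: nat)"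
  fix s
  show "basis (?J s) \<subseteq> (\<Union>j. piece (cobj ?V s) j)"
    unfolding cobj_telescope_sum by (rule basis_homogeneous)
  show "lin_indep \<Lambda> (cobj ?V s) (basis (?J s))"
    unfolding cobj_telescope_sum by (rule lin_indep_basis)
  show "lin_span \<Lambda> (cobj ?V s) (basis (?J s)) = carrier (cobj ?V s)"
    unfolding cobj_telescope_sum by (rule lin_span_basis)
  fix x assume x: "x \<in> basis (?J s)"
  let ?S = "{c \<in> basis (?J (s + 1)). ?rank (s + 1) c < ?rank s x}"
  show "cdiff ?V s x \<in> lin_span \<Lambda> (cobj ?V (s + 1)) ?S"
  proof (cases "s = -1")
    case True
    then have "?S = basis (?J (s + 1))" by simp
    moreover have "cdiff ?V s x \<in> carrier (cobj ?V (s + 1))"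
      using cdiff_closed[OF is_complex_telescope_sum] x basis_subset[of "?J s"] unfolding cobj_telescope_sum by blast
    ultimately show ?thesis unfolding cobj_telescope_sum by (simp only: lin_span_basis)
  next
    case False
    have "cdiff ?V s x = finsum (cobj ?V (s + 1)) (\<lambda>b. \<zero>\<^bsub>\<Lambda>\<^esub> \<odot>\<^bsub>cobj ?V (s + 1)\<^esub> b) {}"
      using False by (simp add: cdiff_telescope_sum cobj_telescope_sum finsum_def finprod_def free_module_simps)
    then show ?thesis
      unfolding lin_span_def by (intro CollectI exI[of _ "\<lambda>_. \<zero>\<^bsub>\<Lambda>\<^esub>"] exI[of _ "{}"] conjI) simp_all
  qed
qed

end


section \<open>Tensor products of two telescopes\<close>

context sum_of_telescopes
begin

interpretation L: cring "\<Lambda>" by (rule cring_truncated_poly)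

lemma vectors_bounded:
  fixes v :: "nat set \<times> nat \<Rightarrow> 'k npoly set"
  assumes "v \<in> vectors n J"
  obtains M0 where "\<And>B m. M0 \<le> m \<Longrightarrow> v (B, m) = \<zero>\<^bsub>\<Lambda>\<^esub>"
proof -
  have "finite (snd ` {b. v b \<noteq> \<zero>\<^bsub>\<Lambda>\<^esub>})" using vectors_finite[OF assms] by simp
  then obtain M0 where M0: "snd ` {b. v b \<noteq> \<zero>\<^bsub>\<Lambda>\<^esub>} \<subseteq> {..<M0}" using finite_nat_iff_bounded by blast
  have "v (B, m) = \<zero>\<^bsub>\<Lambda>\<^esub>" if m: "M0 \<le> m" for B m
  proof (rule ccontr)
    assume "v (B, m) \<noteq> \<zero>\<^bsub>\<Lambda>\<^esub>"
    then have "m \<in> snd ` {b. v b \<noteq> \<zero>\<^bsub>\<Lambda>\<^esub>}" by (intro image_eqI[of _ _ "(B, m)"]) simp_all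
    then show False using M0 m by (meson lessThan_iff not_le subsetD)
  qed
  then show thesis by (rule that)
qed

lemma carrier_cobj_telescope_sum:
  "carrier (cobj (telescope_sum F) 0) = \<iota> ` vectors n (F \<times> UNIV)"
  "carrier (cobj (telescope_sum F) (-1)) = \<iota> ` vectors n (F \<times> UNIV)"
  "\<lbrakk>s \<noteq> 0; s \<noteq> -1\<rbrakk> \<Longrightarrow> carrier (cobj (telescope_sum F) s) = {\<zero>\<^bsub>cobj (telescope_sum F) s\<^esub>}"
proof -
  have "vectors n {} = {\<lambda>b :: nat set \<times> nat. \<zero>\<^bsub>\<Lambda>\<^esub>}"
  proof
    show "vectors n {} \<subseteq> {\<lambda>b :: nat set \<times> nat. \<zero>\<^bsub>\<Lambda>\<^esub>}"
    proof
      fix v :: "nat set \<times> nat \<Rightarrow> 'k npoly set" assume "v \<in> vectors n {}"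
      from vectors_support[OF this] have "v b = \<zero>\<^bsub>\<Lambda>\<^esub>" for b by blast
      then show "v \<in> {\<lambda>b. \<zero>\<^bsub>\<Lambda>\<^esub>}" by (simp add: fun_eq_iff)
    qed
  qed simp
  then show "\<lbrakk>s \<noteq> 0; s \<noteq> -1\<rbrakk> \<Longrightarrow> carrier (cobj (telescope_sum F) s) = {\<zero>\<^bsub>cobj (telescope_sum F) s\<^esub>}"
    by (simp add: cobj_telescope_sum free_module_simps)
qed (simp_all add: cobj_telescope_sum free_module_simps)

text \<open>A class in degree 0 with entries at stages before \<open>M0\<close> is homologous to its push-forward to a late
  stage \<open>M\<close>, whose entry for \<open>B\<close> carries the socle elements of \<open>B\<close> from \<open>M0\<close> to \<open>M\<close>. Multiplication by
  the socle elements of \<open>C\<close> up to \<open>M\<close> kills this entry when some position of \<open>B \<inter> C\<close> lies in the common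
  range. A class involves finitely many \<open>B\<close>, so one \<open>M\<close> serves all of them.\<close>

lemma killed_by_telescope_sum:
  assumes inf: "\<And>B. B \<in> F \<Longrightarrow> infinite (B \<inter> C)"
  shows "killed_by (socle_monomial n C) (telescope_sum F)"
  unfolding killed_by_def
proof (intro allI ballI)
  let ?V = "telescope_sum F" and ?J = "F \<times> (UNIV :: nat set)"
  fix s z m
  assume z: "z \<in> cocycles ?V s"
  then have zc: "z \<in> carrier (cobj ?V s)" by (simp add: cocycles_def)
  show "\<exists>M\<ge>m. socle_monomial n C m M \<odot>\<^bsub>cobj ?V s\<^esub> z \<in> coboundaries ?V s"
  proof (cases "s = 0")
    case False
    have "z = \<zero>\<^bsub>cobj ?V s\<^esub>"
    proof (cases "s = -1")
      case True
      then obtain v where v: "v \<in> vectors n ?J" "z = \<iota> v" using zc by (auto simp: carrier_cobj_telescope_sum)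
      have "\<iota> (boundary v) = \<iota> (\<lambda>b. \<zero>\<^bsub>\<Lambda>\<^esub>)"
        using z True by (simp add: cocycles_def cdiff_telescope_sum cobj_telescope_sum free_module_simps v(2) kappa_iota[OF v(1)])
      then have "boundary v = (\<lambda>b. \<zero>\<^bsub>\<Lambda>\<^esub>)" using iota_eq_iff[OF boundary_vectors[OF v(1)] vectors_zero] by simp
      moreover have "collect (boundary v) B j = v (B, j)" for B j
        by (rule collect_boundary[OF vectors_closed[OF v(1)]])
      ultimately have "v (B, j) = \<zero>\<^bsub>\<Lambda>\<^esub>" for B j
        using collect_eq_zero[of "\<lambda>b. \<zero>\<^bsub>\<Lambda>\<^esub>" B j] by metis
      then have "v = (\<lambda>b. \<zero>\<^bsub>\<Lambda>\<^esub>)" by auto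
      then show ?thesis using True by (simp add: v(2) cobj_telescope_sum free_module_simps)
    qed (use False zc carrier_cobj_telescope_sum(3) in blast)
    moreover have "\<zero>\<^bsub>cobj ?V s\<^esub> \<in> coboundaries ?V s"
      using subgroup.one_closed[OF coboundaries_subgroup[OF is_complex_telescope_sum]] by simp
    ultimately show ?thesis
      using coboundaries_smult[OF is_complex_telescope_sum poly_class_in_carrier] by blast
  next
    case True
    then obtain v where v: "v \<in> vectors n ?J" "z = \<iota> v" using zc by (auto simp: carrier_cobj_telescope_sum)
    note vc = vectors_closed[OF v(1)]
    obtain M0 where M0: "\<And>B j. M0 \<le> j \<Longrightarrow> v (B, j) = \<zero>\<^bsub>\<Lambda>\<^esub>" using vectors_bounded[OF v(1)] by blast
    \<comment> \<open>Only the telescopes of the sets in \<open>?Bs\<close> contribute to \<open>v\<close>; \<open>j\<close> picks a common position for each.\<close>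
    let ?Bs = "fst ` {b. v b \<noteq> \<zero>\<^bsub>\<Lambda>\<^esub>}"
    have Bs: "finite ?Bs" "?Bs \<subseteq> F"
      using vectors_finite[OF v(1)] vectors_support[OF v(1)] by (blast, fastforce)
    have "\<exists>j\<in>B \<inter> C. max M0 m \<le> j" if "B \<in> ?Bs" for B
      using inf[of B] Bs(2) that unfolding infinite_nat_iff_unbounded_le by blast
    then obtain j where j: "\<And>B. B \<in> ?Bs \<Longrightarrow> j B \<in> B \<inter> C \<and> max M0 m \<le> j B" by metis
    define M where "M = Suc (Max (insert (max M0 m) (j ` ?Bs)))"
    have Mj: "j B < M" if "B \<in> ?Bs" for B
      unfolding M_def less_Suc_eq_le using that Bs(1) by (intro Max_ge) auto
    have "max M0 m \<le> Max (insert (max M0 m) (j ` ?Bs))" using Bs(1) by (intro Max_ge) auto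
    then have M: "M0 \<le> M" "m \<le> M" by (auto simp: M_def)
    let ?r = "socle_monomial n C m M"
    let ?w = "\<lambda>b. ?r \<otimes>\<^bsub>\<Lambda>\<^esub> v b"
    have w: "?w \<in> vectors n ?J" using v(1) by simp
    have 0: "collect ?w B M = \<zero>\<^bsub>\<Lambda>\<^esub>" for B
    proof (cases "B \<in> ?Bs")
      case True
      have "collect ?w B M = ?r \<otimes>\<^bsub>\<Lambda>\<^esub> (socle_monomial n B M0 M \<otimes>\<^bsub>\<Lambda>\<^esub> collect v B M0)"
        using collect_smult[OF poly_class_in_carrier vc] collect_shift[of v M0 B M] vc M0 M(1) by simp
      also have "\<dots> = (?r \<otimes>\<^bsub>\<Lambda>\<^esub> socle_monomial n B M0 M) \<otimes>\<^bsub>\<Lambda>\<^esub> collect v B M0"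
        using collect_closed[of v, OF vc] by (simp only: L.m_assoc poly_class_in_carrier)
      also have "?r \<otimes>\<^bsub>\<Lambda>\<^esub> socle_monomial n B M0 M = \<zero>\<^bsub>\<Lambda>\<^esub>"
        using j[OF True] Mj[OF True] by (intro socle_monomial_mult_eq_zero[where j = "j B", OF n_pos]) auto
      finally show ?thesis using collect_closed[of v, OF vc] by simp
    next
      case False
      then have "v (B, i) = \<zero>\<^bsub>\<Lambda>\<^esub>" for i by (metis (mono_tags, lifting) fst_conv image_eqI mem_Collect_eq)
      then show ?thesis by (intro collect_eq_zero) simp
    qed
    have "?w (B, i) = boundary (collect_below M ?w) (B, i)" for B i
      using boundary_collect_below[OF w, of M B i] M0 M(1) 0
        boundary_closed[of "collect_below M ?w", OF vectors_closed[OF collect_below_vectors[OF w]]]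
      by simp
    then have "?w = boundary (collect_below M ?w)" by auto
    then have "?r \<odot>\<^bsub>cobj ?V s\<^esub> z = cdiff ?V (s - 1) (\<iota> (collect_below M ?w))"
      using True by (simp add: cobj_telescope_sum cdiff_telescope_sum free_module_simps v(2) kappa_iota[OF v(1)]
          kappa_iota[OF collect_below_vectors[OF w]])
    moreover have "\<iota> (collect_below M ?w) \<in> carrier (cobj ?V (s - 1))"
      using True collect_below_vectors[OF w] by (simp add: carrier_cobj_telescope_sum)
    ultimately show ?thesis using coboundariesI M(2) by metis
  qed
qed

text \<open>The generator \<open>e\<^sub>0\<close> of the telescope of \<open>B\<close>, multiplied by socle elements of \<open>C\<close> and pushed forward along
  the telescope of \<open>B\<close>, stays a nonzero monomial; but a boundary collects to zero at late stages.\<close>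

lemma not_killed_by_telescope_sum:
  assumes B: "B \<in> F" "B \<inter> C = {}"
  shows "\<not> killed_by (socle_monomial n C) (telescope_sum F)"
proof
  let ?V = "telescope_sum F" and ?J = "F \<times> (UNIV :: nat set)" and ?e = "unit_vector (B, 0)"
  assume K: "killed_by (socle_monomial n C) ?V"
  have e: "?e \<in> vectors n ?J" using B(1) by (intro unit_vector_in_vectors) simp
  have "\<iota> ?e \<in> cocycles ?V 0"
    using e by (simp add: cocycles_def carrier_cobj_telescope_sum cdiff_telescope_sum) (simp add: cobj_telescope_sum free_module_simps)
  then obtain M where "socle_monomial n C 0 M \<odot>\<^bsub>cobj ?V 0\<^esub> \<iota> ?e \<in> coboundaries ?V 0"
    using K unfolding killed_by_def by blast
  then obtain g where g: "g \<in> vectors n ?J"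
      "socle_monomial n C 0 M \<odot>\<^bsub>cobj ?V 0\<^esub> \<iota> ?e = cdiff ?V (-1) (\<iota> g)"
    by (auto simp: coboundaries_def carrier_cobj_telescope_sum)
  let ?r = "socle_monomial n C 0 M"
  have "\<iota> (\<lambda>b. ?r \<otimes>\<^bsub>\<Lambda>\<^esub> ?e b) = \<iota> (boundary g)"
    using g(2) by (simp add: cobj_telescope_sum cdiff_telescope_sum free_module_simps kappa_iota[OF e] kappa_iota[OF g(1)])
  then have eq: "(\<lambda>b. ?r \<otimes>\<^bsub>\<Lambda>\<^esub> ?e b) = boundary g"
    using iota_eq_iff[OF vectors_smult[OF poly_class_in_carrier e] boundary_vectors[OF g(1)]] by simp
  obtain N where N: "\<And>B j. N \<le> j \<Longrightarrow> g (B, j) = \<zero>\<^bsub>\<Lambda>\<^esub>" using vectors_bounded[OF g(1)] by blast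
  have "?r \<otimes>\<^bsub>\<Lambda>\<^esub> socle_monomial n B 0 N = collect (\<lambda>b. ?r \<otimes>\<^bsub>\<Lambda>\<^esub> ?e b) B N"
    using collect_smult[OF poly_class_in_carrier vectors_closed[OF e]] by (simp add: collect_unit_vector)
  also have "\<dots> = \<zero>\<^bsub>\<Lambda>\<^esub>"
    unfolding eq using collect_boundary[of g, OF vectors_closed[OF g(1)]] N by simp
  finally show False
    using socle_monomial_mult_neq_zero[where n = n, OF n_pos, where B = C and C = B and m = 0 and M = M and m' = 0 and M' = N] B(2) by blast
qed

lemma telescope_telescope_sum:
  "telescope n (telescope_sum {C}) (socle_monomial n C) (\<lambda>m. \<iota> (unit_vector (C, m)))
     (\<lambda>M x. collect (\<kappa> x) C M) (\<lambda>M x. \<iota> (collect_below M (\<kappa> x)))"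
proof
  let ?V = "telescope_sum {C}" and ?J = "{C} \<times> (UNIV :: nat set)"
  note ki = kappa_iota[of _ ?J]
  have carrier: "x \<in> carrier (cobj ?V 0) \<Longrightarrow> \<exists>v\<in>vectors n ?J. x = \<iota> v"
    "x \<in> carrier (cobj ?V (-1)) \<Longrightarrow> \<exists>v\<in>vectors n ?J. x = \<iota> v" for x
    by (auto simp: carrier_cobj_telescope_sum)
  have u: "unit_vector (C, m) \<in> vectors n ?J" for m by (intro unit_vector_in_vectors) simp
  show "is_complex n ?V" by (rule is_complex_telescope_sum)
  show "carrier (cobj ?V s) = {\<zero>\<^bsub>cobj ?V s\<^esub>}" if "s \<noteq> 0" "s \<noteq> -1" for s
    using that by (rule carrier_cobj_telescope_sum)
  show "socle_monomial n C m M \<in> carrier \<Lambda>" for m M by simp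
  show "\<iota> (unit_vector (C, m)) \<in> carrier (cobj ?V 0)" for m
    using u by (simp add: carrier_cobj_telescope_sum)
  have add: "(\<lambda>b. v b \<oplus>\<^bsub>\<Lambda>\<^esub> w b) \<in> vectors n ?J" if "v \<in> vectors n ?J" "w \<in> vectors n ?J" for v w
    using that by simp
  have smult: "(\<lambda>b. r \<otimes>\<^bsub>\<Lambda>\<^esub> v b) \<in> vectors n ?J" if "r \<in> carrier \<Lambda>" "v \<in> vectors n ?J" for r v
    using that by simp
  show "linear_functional n (cobj ?V 0) (\<lambda>x. collect (\<kappa> x) C M)" for M
    unfolding linear_functional_def
  proof (intro conjI ballI Pi_I)
    fix x assume "x \<in> carrier (cobj ?V 0)"
    then obtain v where v: "v \<in> vectors n ?J" "x = \<iota> v" using carrier by blast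
    show "collect (\<kappa> x) C M \<in> carrier \<Lambda>" unfolding v(2) ki[OF v(1)] by (rule collect_closed[OF vectors_closed[OF v(1)]])
    { fix r :: "'k npoly set" assume r: "r \<in> carrier \<Lambda>"
      show "collect (\<kappa> (r \<odot>\<^bsub>cobj ?V 0\<^esub> x)) C M = r \<otimes>\<^bsub>\<Lambda>\<^esub> collect (\<kappa> x) C M"
        by (simp add: cobj_telescope_sum free_module_simps v(2) ki[OF v(1)] ki[OF smult[OF r v(1)]]
            collect_smult[OF r vectors_closed[OF v(1)]]) }
    fix x' assume "x' \<in> carrier (cobj ?V 0)"
    then obtain w where w: "w \<in> vectors n ?J" "x' = \<iota> w" using carrier by blast
    show "collect (\<kappa> (x \<oplus>\<^bsub>cobj ?V 0\<^esub> x')) C M = collect (\<kappa> x) C M \<oplus>\<^bsub>\<Lambda>\<^esub> collect (\<kappa> x') C M"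
      by (simp add: cobj_telescope_sum free_module_simps v(2) w(2) ki[OF v(1)] ki[OF w(1)] ki[OF add[OF v(1) w(1)]]
          collect_add[OF vectors_closed[OF v(1)] vectors_closed[OF w(1)]])
  qed
  show "linear_map n (cobj ?V 0) (cobj ?V (-1)) (\<lambda>x. \<iota> (collect_below M (\<kappa> x)))" for M
    unfolding linear_map_def
  proof (intro conjI ballI Pi_I)
    fix x assume "x \<in> carrier (cobj ?V 0)"
    then obtain v where v: "v \<in> vectors n ?J" "x = \<iota> v" using carrier by blast
    note cv = collect_below_vectors[OF v(1), of M]
    show "\<iota> (collect_below M (\<kappa> x)) \<in> carrier (cobj ?V (-1))"
      unfolding v(2) ki[OF v(1)] carrier_cobj_telescope_sum using cv by (rule imageI)
    { fix r :: "'k npoly set" assume r: "r \<in> carrier \<Lambda>"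
      have "collect_below M (\<lambda>b. r \<otimes>\<^bsub>\<Lambda>\<^esub> v b) = (\<lambda>b. r \<otimes>\<^bsub>\<Lambda>\<^esub> collect_below M v b)"
        using r by (simp add: collect_below_def fun_eq_iff collect_smult[OF r vectors_closed[OF v(1)]])
      then show "\<iota> (collect_below M (\<kappa> (r \<odot>\<^bsub>cobj ?V 0\<^esub> x))) = r \<odot>\<^bsub>cobj ?V (-1)\<^esub> \<iota> (collect_below M (\<kappa> x))"
        by (simp add: cobj_telescope_sum free_module_simps v(2) ki[OF v(1)] ki[OF smult[OF r v(1)]] ki[OF cv]) }
    fix x' assume "x' \<in> carrier (cobj ?V 0)"
    then obtain w where w: "w \<in> vectors n ?J" "x' = \<iota> w" using carrier by blast
    note cw = collect_below_vectors[OF w(1), of M]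
    have "collect_below M (\<lambda>b. v b \<oplus>\<^bsub>\<Lambda>\<^esub> w b) = (\<lambda>b. collect_below M v b \<oplus>\<^bsub>\<Lambda>\<^esub> collect_below M w b)"
      by (simp add: collect_below_def fun_eq_iff collect_add[OF vectors_closed[OF v(1)] vectors_closed[OF w(1)]])
    then show "\<iota> (collect_below M (\<kappa> (x \<oplus>\<^bsub>cobj ?V 0\<^esub> x'))) =
        \<iota> (collect_below M (\<kappa> x)) \<oplus>\<^bsub>cobj ?V (-1)\<^esub> \<iota> (collect_below M (\<kappa> x'))"
      by (simp add: cobj_telescope_sum free_module_simps v(2) w(2) ki[OF v(1)] ki[OF w(1)] ki[OF add[OF v(1) w(1)]] ki[OF cv] ki[OF cw])
  qed
  show "collect (\<kappa> (\<iota> (unit_vector (C, m)))) C M = socle_monomial n C m M" if "m \<le> M" for m M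
    unfolding ki[OF u] using that by (rule collect_unit_vector)
  show "\<forall>\<^sub>F M in sequentially. collect (\<kappa> x) C M \<odot>\<^bsub>cobj ?V 0\<^esub> \<iota> (unit_vector (C, M))
      \<oplus>\<^bsub>cobj ?V 0\<^esub> cdiff ?V (-1) (\<iota> (collect_below M (\<kappa> x))) = x"
    if x: "x \<in> carrier (cobj ?V 0)" for x
  proof -
    obtain v where v: "v \<in> vectors n ?J" "x = \<iota> v" using x carrier by blast
    obtain M0 where M0: "\<And>B j. M0 \<le> j \<Longrightarrow> v (B, j) = \<zero>\<^bsub>\<Lambda>\<^esub>" using vectors_bounded[OF v(1)] by blast
    have "collect (\<kappa> x) C M \<odot>\<^bsub>cobj ?V 0\<^esub> \<iota> (unit_vector (C, M))
      \<oplus>\<^bsub>cobj ?V 0\<^esub> cdiff ?V (-1) (\<iota> (collect_below M (\<kappa> x))) = x" if "M0 \<le> M" for M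
    proof -
      have cc: "collect v B M \<in> carrier \<Lambda>" for B by (rule collect_closed[OF vectors_closed[OF v(1)]])
      note cb = collect_below_vectors[OF v(1), of M]
      have "collect v C M \<otimes>\<^bsub>\<Lambda>\<^esub> unit_vector (C, M) (B, j) \<oplus>\<^bsub>\<Lambda>\<^esub> boundary (collect_below M v) (B, j) = v (B, j)" for B j
      proof -
        have "collect v B M = \<zero>\<^bsub>\<Lambda>\<^esub>" if "B \<noteq> C"
          using vectors_support[OF v(1)] that by (intro collect_eq_zero) blast
        then have "collect v C M \<otimes>\<^bsub>\<Lambda>\<^esub> unit_vector (C, M) (B, j) = (if j = M then collect v B M else \<zero>\<^bsub>\<Lambda>\<^esub>)"
          using cc by (auto simp: unit_vector_def)
        then show ?thesis using boundary_collect_below[OF v(1), of M B j] M0 that by simp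
      qed
      then have "(\<lambda>b. collect v C M \<otimes>\<^bsub>\<Lambda>\<^esub> unit_vector (C, M) b \<oplus>\<^bsub>\<Lambda>\<^esub> boundary (collect_below M v) b) = v"
        by auto
      then show ?thesis
        by (simp add: cobj_telescope_sum cdiff_telescope_sum free_module_simps v(2) ki[OF v(1)] ki[OF u] ki[OF cb]
            ki[OF smult[OF cc u]] ki[OF boundary_vectors[OF cb]])
    qed
    then show ?thesis unfolding eventually_sequentially by blast
  qed
  show "\<forall>\<^sub>F M in sequentially. collect (\<kappa> (cdiff ?V (-1) x)) C M = \<zero>\<^bsub>\<Lambda>\<^esub> \<and>
      \<iota> (collect_below M (\<kappa> (cdiff ?V (-1) x))) = x"
    if x: "x \<in> carrier (cobj ?V (-1))" for x
  proof -
    obtain v where v: "v \<in> vectors n ?J" "x = \<iota> v" using x carrier by blast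
    obtain M0 where M0: "\<And>B j. M0 \<le> j \<Longrightarrow> v (B, j) = \<zero>\<^bsub>\<Lambda>\<^esub>" using vectors_bounded[OF v(1)] by blast
    have c: "collect (boundary v) B j = v (B, j)" for B j
      by (rule collect_boundary[OF vectors_closed[OF v(1)]])
    have "collect_below M (boundary v) = v" if "M0 \<le> M" for M
      using M0 that by (auto simp: collect_below_def fun_eq_iff c not_less)
    then show ?thesis
      unfolding eventually_sequentially
      using M0 by (intro exI[of _ M0]) (simp add: cdiff_telescope_sum v(2) ki[OF v(1)] ki[OF boundary_vectors[OF v(1)]] c)
  qed
  show "\<forall>\<^sub>F M in sequentially. \<forall>N\<ge>M. socle_monomial n C M N \<otimes>\<^bsub>\<Lambda>\<^esub> collect (\<kappa> x) C M = collect (\<kappa> x) C N"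
    if x: "x \<in> carrier (cobj ?V 0)" for x
  proof -
    obtain v where v: "v \<in> vectors n ?J" "x = \<iota> v" using x carrier by blast
    obtain M0 where M0: "\<And>B j. M0 \<le> j \<Longrightarrow> v (B, j) = \<zero>\<^bsub>\<Lambda>\<^esub>" using vectors_bounded[OF v(1)] by blast
    have "collect v C N = socle_monomial n C M N \<otimes>\<^bsub>\<Lambda>\<^esub> collect v C M" if "M0 \<le> M" "M \<le> N" for M N
      by (rule collect_shift[OF vectors_closed[OF v(1)]]) (use M0 that in auto)
    then show ?thesis unfolding eventually_sequentially v(2) ki[OF v(1)] by metis
  qed
qed

text \<open>The complex is semifree, hence a resolution of itself; so resolutions exist and the one chosen in
  the derived tensor product is a complex \<open>P\<close> with a quasi-isomorphism to the complex. The criterion for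
  tensoring with a telescope applies to every \<open>P\<close>, and it only depends on cohomology.\<close>

theorem acyclic_derived_tensor_telescope_sum_iff:
  "acyclic_complex (derived_tensor n (telescope_sum F) (telescope_sum {C})) \<longleftrightarrow>
    killed_by (socle_monomial n C) (telescope_sum F)"
proof -
  let ?V = "telescope_sum F"
  define P :: "('k npoly set, 'u) cochain_complex" where "P = (SOME P. semifree_resolution n P ?V)"
  have "semifree_resolution n ?V ?V"
    using semifree_telescope_sum quasi_iso_id[OF is_complex_telescope_sum] by (auto simp: semifree_resolution_def)
  then have "semifree_resolution n P ?V" unfolding P_def by (rule someI)
  then obtain q where P: "is_complex n P" and q: "quasi_iso n P ?V q"
    by (auto simp: semifree_resolution_def semifree_def)
  interpret T: telescope n "telescope_sum {C}" "socle_monomial n C" "\<lambda>m. \<iota> (unit_vector (C, m))"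
     "\<lambda>M x. collect (\<kappa> x) C M" "\<lambda>M x. \<iota> (collect_below M (\<kappa> x))"
    by (rule telescope_telescope_sum)
  interpret T: tensor_telescope n "telescope_sum {C}" "socle_monomial n C" "\<lambda>m. \<iota> (unit_vector (C, m))"
     "\<lambda>M x. collect (\<kappa> x) C M" "\<lambda>M x. \<iota> (collect_below M (\<kappa> x))" P
    by unfold_locales (rule P)
  show ?thesis
    using T.acyclic_tensor_telescope_iff killed_by_quasi_iso[OF P is_complex_telescope_sum q, of "socle_monomial n C"]
    by (simp add: derived_tensor_def P_def)
qed

end


section \<open>Counting Bousfield classes\<close>

text \<open>The finite initial segments of a set, coded as numbers. This is the branch of the set in the binary
  tree; distinct branches share only finitely many nodes, so these are continuum many almost disjoint
  sets.\<close>

definition prefix_codes :: "nat set \<Rightarrow> nat set" where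
  "prefix_codes A = range (\<lambda>k. prod_encode (k, set_encode (A \<inter> {..<k})))"

lemma infinite_prefix_codes_diff:
  assumes "A \<noteq> B"
  shows "infinite (prefix_codes A - prefix_codes B)"
proof -
  let ?f = "\<lambda>k. prod_encode (k, set_encode (A \<inter> {..<k}))"
  obtain j where j: "j \<in> A \<longleftrightarrow> j \<notin> B" using assms by blast
  have "?f k \<notin> prefix_codes B" if "j < k" for k
  proof
    assume "?f k \<in> prefix_codes B"
    then have "set_encode (A \<inter> {..<k}) = set_encode (B \<inter> {..<k})"
      by (auto simp: prefix_codes_def prod_encode_eq)
    then have "A \<inter> {..<k} = B \<inter> {..<k}" by (metis finite_Int finite_lessThan set_encode_inverse)
    then show False using j that by blast
  qed
  then have "?f ` {j<..} \<subseteq> prefix_codes A - prefix_codes B" by (auto simp: prefix_codes_def)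
  moreover have "infinite (?f ` {j<..})"
    using infinite_Ioi[of j] by (subst finite_image_iff) (auto simp: inj_on_def prod_encode_eq)
  ultimately show ?thesis using finite_subset by blast
qed

lemma inj_graph_of_support: "inj (\<lambda>v. (\<lambda>a. (a, v a)) ` {a. v a \<noteq> z})"
proof (rule injI, rule ext)
  fix v w :: "'a \<Rightarrow> 'b" and a
  assume eq: "(\<lambda>a. (a, v a)) ` {a. v a \<noteq> z} = (\<lambda>a. (a, w a)) ` {a. w a \<noteq> z}"
  have "(a, c) \<in> (\<lambda>a. (a, u a)) ` {a. u a \<noteq> z} \<longleftrightarrow> c = u a \<and> c \<noteq> z" for c and u :: "'a \<Rightarrow> 'b" by auto
  from this[of _ v] this[of _ w] show "v a = w a" unfolding eq by metis
qed

lemma countable_poly_mapping: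
  assumes "countable (UNIV :: 'a set)" "countable (UNIV :: 'b::zero set)"
  shows "countable (UNIV :: ('a \<Rightarrow>\<^sub>0 'b) set)"
proof -
  let ?g = "\<lambda>v :: 'a \<Rightarrow> 'b. (\<lambda>a. (a, v a)) ` {a. v a \<noteq> 0}"
  have "inj (\<lambda>p :: 'a \<Rightarrow>\<^sub>0 'b. ?g (Poly_Mapping.lookup p))"
    by (intro injI poly_mapping_eqI fun_cong[OF injD[OF inj_graph_of_support[of 0]]])
  moreover have "countable {A :: ('a \<times> 'b) set. finite A \<and> A \<subseteq> UNIV \<times> UNIV}"
    using assms by (intro countable_Collect_finite_subset countable_SIGMA)
  then have "countable (range (\<lambda>p :: 'a \<Rightarrow>\<^sub>0 'b. ?g (Poly_Mapping.lookup p)))"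
    by (rule countable_subset[rotated]) auto
  ultimately show ?thesis by (rule countable_image_inj_on[rotated])
qed

text \<open>The ring is countable and the basis has the cardinality of the continuum, so there are only continuum
  many vectors: a vector is determined by the finite graph of its nonzero coordinates.\<close>

lemma vectors_embedding:
  assumes k: "countable (UNIV :: 'k::field set)" and u: "|UNIV :: nat set set| \<le>o |UNIV :: 'u set|"
  obtains \<iota> :: "(nat set \<times> nat \<Rightarrow> 'k::field npoly set) \<Rightarrow> 'u" where "inj_on \<iota> (vectors n UNIV)"
proof -
  let ?z = "\<zero>\<^bsub>truncated_poly n\<^esub> :: 'k npoly set"
  let ?C = "carrier (truncated_poly n) :: 'k npoly set set"
  let ?S = "UNIV :: (nat set \<times> nat) set"
  have inf: "infinite (UNIV :: nat set set)" by (simp add: Finite_Set.finite_set)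
  have "|UNIV :: nat set| \<le>o |UNIV :: nat set set|"
    using inf by (simp add: infinite_iff_card_of_nat)
  then have S: "|?S| =o |UNIV :: nat set set|"
    using card_of_Times_infinite[OF inf, of "UNIV :: nat set"] by simp
  then have infS: "infinite ?S" using inf card_of_ordIso_finite by blast
  have "countable (UNIV :: 'k npoly set)"
    by (intro countable_poly_mapping k) simp_all
  then have "countable ?C" by (simp add: carrier_truncated_poly)
  then have "|?C| \<le>o |UNIV :: nat set|"
    unfolding countable_def card_of_ordLeq[symmetric] by blast
  then have "|?C| \<le>o |?S|"
    using infS infinite_iff_card_of_nat ordLeq_transitive by blast
  moreover have "?C \<noteq> {}" using poly_class_in_carrier by blast
  ultimately have T: "|?S \<times> ?C| =o |?S|"
    using card_of_Times_infinite[OF infS] by blast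
  then have "infinite (?S \<times> ?C)" using infS card_of_ordIso_finite by blast
  then have "|Fpow (?S \<times> ?C)| =o |?S \<times> ?C|" using eqpoll_Fpow eqpoll_iff_card_of_ordIso by blast
  then have le: "|Fpow (?S \<times> ?C)| \<le>o |UNIV :: 'u set|"
    using T S u by (meson ordIso_ordLeq_trans)
  let ?g = "\<lambda>v :: nat set \<times> nat \<Rightarrow> 'k npoly set. (\<lambda>b. (b, v b)) ` {b. v b \<noteq> ?z}"
  have "inj_on ?g (vectors n UNIV)"
    using inj_graph_of_support by (rule inj_on_subset) simp
  moreover have "?g ` vectors n UNIV \<subseteq> Fpow (?S \<times> ?C)"
  proof
    fix G assume "G \<in> ?g ` vectors n UNIV"
    then obtain v where "v \<in> vectors n UNIV" "G = ?g v" by blast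
    then show "G \<in> Fpow (?S \<times> ?C)" unfolding vectors_def Fpow_def by blast
  qed
  ultimately have "|vectors n UNIV :: (nat set \<times> nat \<Rightarrow> 'k npoly set) set| \<le>o |Fpow (?S \<times> ?C)|"
    using card_of_ordLeq by blast
  then have "|vectors n UNIV :: (nat set \<times> nat \<Rightarrow> 'k npoly set) set| \<le>o |UNIV :: 'u set|"
    using le ordLeq_transitive by blast
  then obtain \<iota> :: "(nat set \<times> nat \<Rightarrow> 'k npoly set) \<Rightarrow> 'u" where "inj_on \<iota> (vectors n UNIV)"
    unfolding card_of_ordLeq[symmetric] by blast
  then show thesis by (rule that)
qed

theorem theorem1:
  fixes n :: "nat \<Rightarrow> nat"
  assumes "countable (UNIV :: 'k::field set)"
    and "\<And>i. i \<ge> 1 \<Longrightarrow> n i \<ge> 2"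
    and universe: "|UNIV :: nat set set| \<le>o |UNIV :: 'u set|"
  shows "|UNIV :: nat set set set| \<le>o
    |bousfield_lattice n :: ('k::field npoly set, 'u) cochain_complex set set|"
proof -
  obtain \<iota> :: "(nat set \<times> nat \<Rightarrow> 'k npoly set) \<Rightarrow> 'u" where \<iota>: "inj_on \<iota> (vectors n UNIV)"
    using vectors_embedding[OF assms(1) universe] .
  interpret sum_of_telescopes n \<iota>
    by unfold_locales (use \<iota> assms(2) in auto)
  let ?\<Theta> = "\<lambda>S. bousfield_class n (telescope_sum (prefix_codes ` S))"
  let ?W = "\<lambda>A. telescope_sum {- prefix_codes A}"
  \<comment> \<open>The branch of \<open>A\<close> meets its own complement in the empty set and every other branch meets it in an infinite set.\<close>
  have mem: "?W A \<in> ?\<Theta> S \<longleftrightarrow> A \<notin> S" for A S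
  proof
    assume "?W A \<in> ?\<Theta> S"
    then have "killed_by (socle_monomial n (- prefix_codes A)) (telescope_sum (prefix_codes ` S))"
      by (simp add: bousfield_class_def acyclic_derived_tensor_telescope_sum_iff)
    then show "A \<notin> S" using not_killed_by_telescope_sum[of "prefix_codes A" "prefix_codes ` S"] by blast
  next
    assume "A \<notin> S"
    have "infinite (B \<inter> - prefix_codes A)" if B: "B \<in> prefix_codes ` S" for B
    proof -
      obtain Z where "Z \<in> S" "B = prefix_codes Z" using B by blast
      then show ?thesis using infinite_prefix_codes_diff[of Z A] \<open>A \<notin> S\<close> by (auto simp: Diff_eq)
    qed
    then have "killed_by (socle_monomial n (- prefix_codes A)) (telescope_sum (prefix_codes ` S))"
      by (rule killed_by_telescope_sum)
    then show "?W A \<in> ?\<Theta> S"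
      by (simp add: bousfield_class_def acyclic_derived_tensor_telescope_sum_iff is_complex_telescope_sum)
  qed
  have "inj ?\<Theta>"
  proof (rule injI)
    fix S S' assume eq: "?\<Theta> S = ?\<Theta> S'"
    have "A \<in> S \<longleftrightarrow> A \<in> S'" for A using mem[of A S] mem[of A S'] eq by simp
    then show "S = S'" by blast
  qed
  moreover have "range ?\<Theta> \<subseteq> bousfield_lattice n"
    using is_complex_telescope_sum by (auto simp: bousfield_lattice_def)
  ultimately show ?thesis using card_of_ordLeq by blast
qed

end
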